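(* Let $M$ be a smooth closed Riemannian manifold, $H\in C^k(T^*M,\mathbb{R})$ ($k\ge 2$) a Tonelli Hamiltonian and $\lambda>0$. Let $u^-$ be the viscosity solution of $\lambda u+H(x,du)=0$ on $M$ and $\mathcal{S}^-$ the set of its viscosity subsolutions. Then $u^-$ is the pointwise supremum of all smooth (i.e. $C^\infty$) viscosity subsolutions; namely, for every $x\in M$, $$u^-(x)=\sup_{u\in\mathcal{S}^-}u(x)=\sup_{u\in C^\infty(M,\mathbb{R})\cap\mathcal{S}^-}u(x).$$
   Context: Tonelli Hamiltonian: $H_{pp}(x,p)$ is positive definite for all $(x,p)\in T^*M$, and $\lim_{|p|_x\to+\infty}H(x,p)/|p|_x=+\infty$ for every $x\in M$. The associated Lagrangian is $L(x,v)=\max_{p\in T^*_xM}\{\langle p,v\rangle-H(x,p)\}$. The equation $\lambda u+H(x,du)=0$ has a unique viscosity solution $u^-\in C(M,\mathbb{R})$. The paper defines $\mathcal{S}^-$ as the set of functions $u\in C(M,\mathbb{R})$ that are $\lambda$-dominated by $L$, i.e. for every absolutely continuous $\gamma:[a,b]\to M$, $e^{\lambda b}u(\gamma(b))-e^{\lambda a}u(\gamma(a))\le\int_a^be^{\lambda t}L(\gamma,\dot\gamma)\,dt$; this is equivalent to $u$ being a viscosity subsolution, and to $u$ being a (Lipschitz) almost everywhere subsolution, of $\lambda u+H(x,du)=0$. *)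

theory Defs
  imports "HOL-Analysis.Analysis" "HOL-Library.Extended_Nat"
begin

section \<open>Functions of class \<open>C\<^sup>k\<close> on open subsets of a Euclidean space\<close>

(* Meaningful for open S only, since the derivatives are two-sided.  For open S this is the usual
   notion: f is differentiable on S and all its directional derivatives are of class C^n. *)
primrec Cn_on :: "nat \<Rightarrow> 'a::euclidean_space set \<Rightarrow> ('a \<Rightarrow> 'b::real_normed_vector) \<Rightarrow> bool" where
  "Cn_on 0 S f \<longleftrightarrow> continuous_on S f"
| "Cn_on (Suc n) S f \<longleftrightarrow>
     (\<forall>x\<in>S. f differentiable (at x)) \<and> (\<forall>v. Cn_on n S (\<lambda>x. frechet_derivative f (at x) v))"

definition C_on :: "enat \<Rightarrow> 'a::euclidean_space set \<Rightarrow> ('a \<Rightarrow> 'b::real_normed_vector) \<Rightarrow> bool" where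
  "C_on k S f \<longleftrightarrow> (\<forall>n. enat n \<le> k \<longrightarrow> Cn_on n S f)"

section \<open>Closed smooth manifolds\<close>

(* A chart is a pair (U, \<phi>); only the values of \<phi> on U matter. *)
type_synonym ('m, 'e) chart = "'m set \<times> ('m \<Rightarrow> 'e)"

abbreviation cdom :: "('m, 'e) chart \<Rightarrow> 'm set" where
  "cdom c \<equiv> fst c"

abbreviation cmap :: "('m, 'e) chart \<Rightarrow> 'm \<Rightarrow> 'e" where
  "cmap c \<equiv> snd c"

definition cinv :: "('m, 'e) chart \<Rightarrow> 'e \<Rightarrow> 'm" where
  "cinv c = inv_into (cdom c) (cmap c)"

definition smooth_atlas :: "('m::topological_space, 'e::euclidean_space) chart set \<Rightarrow> bool" where
  "smooth_atlas A \<longleftrightarrow>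
     (\<Union>c\<in>A. cdom c) = UNIV \<and>
     (\<forall>c\<in>A. open (cdom c) \<and> open (cmap c ` cdom c) \<and>
        homeomorphism (cdom c) (cmap c ` cdom c) (cmap c) (cinv c)) \<and>
     (\<forall>c\<in>A. \<forall>d\<in>A. C_on \<infinity> (cmap c ` (cdom c \<inter> cdom d)) (cmap d \<circ> cinv c))"

(* Second countability follows from compactness. *)
definition closed_manifold :: "('m::t2_space, 'e::euclidean_space) chart set \<Rightarrow> bool" where
  "closed_manifold A \<longleftrightarrow> compact (UNIV :: 'm set) \<and> smooth_atlas A"

definition C_fun ::
    "('m::topological_space, 'e::euclidean_space) chart set \<Rightarrow> enat \<Rightarrow> ('m \<Rightarrow> real) set" where
  "C_fun A k = {u. \<forall>c\<in>A. C_on k (cmap c ` cdom c) (u \<circ> cinv c)}"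

section \<open>Tangent and cotangent spaces\<close>

(* A tangent vector at x is the family of its coordinate vectors in the charts around x, related by
   the derivatives of the transition maps (and 0 at every other pair, to make it unique). *)
type_synonym ('m, 'e) tangent = "('m, 'e) chart \<Rightarrow> 'e"

definition tangent_space ::
    "('m::topological_space, 'e::euclidean_space) chart set \<Rightarrow> 'm \<Rightarrow> ('m, 'e) tangent set" where
  "tangent_space A x = {v.
     (\<forall>c\<in>A. \<forall>d\<in>A. x \<in> cdom c \<inter> cdom d \<longrightarrow>
        v d = frechet_derivative (cmap d \<circ> cinv c) (at (cmap c x)) (v c)) \<and>
     (\<forall>c. \<not> (c \<in> A \<and> x \<in> cdom c) \<longrightarrow> v c = 0)}"

(* The tangent vector at x with coordinates e in the chart c. *)
definition tangent_of ::
    "('m::topological_space, 'e::euclidean_space) chart set \<Rightarrow> ('m, 'e) chart \<Rightarrow> 'm \<Rightarrow> 'e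
      \<Rightarrow> ('m, 'e) tangent" where
  "tangent_of A c x e = (\<lambda>d. if d \<in> A \<and> x \<in> cdom d
     then frechet_derivative (cmap d \<circ> cinv c) (at (cmap c x)) e else 0)"

(* A covector at x is a linear form on the tangent space at x, extended by 0; the pairing of p
   and v is p v. *)
type_synonym ('m, 'e) cotangent = "('m, 'e) tangent \<Rightarrow> real"

definition cotangent_space ::
    "('m::topological_space, 'e::euclidean_space) chart set \<Rightarrow> 'm \<Rightarrow> ('m, 'e) cotangent set" where
  "cotangent_space A x = {p.
     (\<forall>v\<in>tangent_space A x. \<forall>w\<in>tangent_space A x. \<forall>a b.
        p (\<lambda>c. a *\<^sub>R v c + b *\<^sub>R w c) = a * p v + b * p w) \<and>
     (\<forall>v. v \<notin> tangent_space A x \<longrightarrow> p v = 0)}"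

(* The covector with coordinates q in the chart c, i.e. the sum of q_i dx^i. *)
definition cotangent_of ::
    "('m::topological_space, 'e::euclidean_space) chart set \<Rightarrow> ('m, 'e) chart \<Rightarrow> 'm \<Rightarrow> 'e
      \<Rightarrow> ('m, 'e) cotangent" where
  "cotangent_of A c x q = (\<lambda>v. if v \<in> tangent_space A x then q \<bullet> v c else 0)"

definition chart_at :: "('m, 'e) chart set \<Rightarrow> 'm \<Rightarrow> ('m, 'e) chart" where
  "chart_at A x = (SOME c. c \<in> A \<and> x \<in> cdom c)"

(* The differential of u at x; by the chain rule the choice of the chart is irrelevant. *)
definition differential ::
    "('m::topological_space, 'e::euclidean_space) chart set \<Rightarrow> ('m \<Rightarrow> real) \<Rightarrow> 'm
      \<Rightarrow> ('m, 'e) cotangent" where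
  "differential A u x = (let c = chart_at A x in
     (\<lambda>v. if v \<in> tangent_space A x
       then frechet_derivative (u \<circ> cinv c) (at (cmap c x)) (v c) else 0))"

section \<open>Riemannian metrics\<close>

definition riemannian_metric ::
    "('m::topological_space, 'e::euclidean_space) chart set
      \<Rightarrow> ('m \<Rightarrow> ('m, 'e) tangent \<Rightarrow> ('m, 'e) tangent \<Rightarrow> real) \<Rightarrow> bool" where
  "riemannian_metric A g \<longleftrightarrow>
     (\<forall>x. \<forall>v\<in>tangent_space A x. \<forall>w\<in>tangent_space A x.
        g x v w = g x w v \<and>
        (\<forall>z\<in>tangent_space A x. \<forall>a b.
           g x (\<lambda>c. a *\<^sub>R v c + b *\<^sub>R w c) z = a * g x v z + b * g x w z) \<and>
        (v \<noteq> (\<lambda>c. 0) \<longrightarrow> g x v v > 0)) \<and>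
     (\<forall>c\<in>A. \<forall>i\<in>Basis. \<forall>j\<in>Basis. C_on \<infinity> (cmap c ` cdom c)
        (\<lambda>y. g (cinv c y) (tangent_of A c (cinv c y) i) (tangent_of A c (cinv c y) j)))"

(* The dual norm |p|_x. *)
definition conorm ::
    "('m::topological_space, 'e::euclidean_space) chart set
      \<Rightarrow> ('m \<Rightarrow> ('m, 'e) tangent \<Rightarrow> ('m, 'e) tangent \<Rightarrow> real)
      \<Rightarrow> 'm \<Rightarrow> ('m, 'e) cotangent \<Rightarrow> real" where
  "conorm A g x p = (SUP v \<in> {v \<in> tangent_space A x. g x v v \<le> 1}. p v)"

section \<open>Tonelli Hamiltonians\<close>

(* A function on the cotangent bundle is a curried function H x p, of which only the values with
   p in the cotangent space at x matter; it is of class C^k if it is so in the coordinates (y, q)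
   of the cotangent bundle induced by each chart. *)
definition C_cotangent_bundle ::
    "('m::topological_space, 'e::euclidean_space) chart set \<Rightarrow> enat
      \<Rightarrow> ('m \<Rightarrow> ('m, 'e) cotangent \<Rightarrow> real) \<Rightarrow> bool" where
  "C_cotangent_bundle A k H \<longleftrightarrow>
     (\<forall>c\<in>A. C_on k ((cmap c ` cdom c) \<times> (UNIV :: 'e set))
        (\<lambda>(y, q). H (cinv c y) (cotangent_of A c (cinv c y) q)))"

(* The bilinear form H_pp(x,p), applied to the covectors q and r. *)
definition fiber_hessian ::
    "('m \<Rightarrow> ('m, 'e) cotangent \<Rightarrow> real) \<Rightarrow> 'm \<Rightarrow> ('m, 'e) cotangent
      \<Rightarrow> ('m, 'e) cotangent \<Rightarrow> ('m, 'e) cotangent \<Rightarrow> real" where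
  "fiber_hessian H x p q r = deriv (\<lambda>s. deriv (\<lambda>t. H x (\<lambda>v. p v + s * q v + t * r v)) 0) 0"

definition tonelli ::
    "('m::topological_space, 'e::euclidean_space) chart set
      \<Rightarrow> ('m \<Rightarrow> ('m, 'e) tangent \<Rightarrow> ('m, 'e) tangent \<Rightarrow> real)
      \<Rightarrow> ('m \<Rightarrow> ('m, 'e) cotangent \<Rightarrow> real) \<Rightarrow> bool" where
  "tonelli A g H \<longleftrightarrow>
     (\<forall>x. \<forall>p\<in>cotangent_space A x. \<forall>q\<in>cotangent_space A x.
        q \<noteq> (\<lambda>v. 0) \<longrightarrow> fiber_hessian H x p q q > 0) \<and>
     (\<forall>x. filterlim (\<lambda>p. H x p / conorm A g x p) at_top
        (inf (filtercomap (conorm A g x) at_top) (principal (cotangent_space A x))))"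

(* For a Tonelli Hamiltonian and a tangent vector v at x the supremum is a maximum. *)
definition lagrangian ::
    "('m::topological_space, 'e::euclidean_space) chart set
      \<Rightarrow> ('m \<Rightarrow> ('m, 'e) cotangent \<Rightarrow> real) \<Rightarrow> 'm \<Rightarrow> ('m, 'e) tangent \<Rightarrow> real" where
  "lagrangian A H x v = (SUP p \<in> cotangent_space A x. p v - H x p)"

section \<open>Viscosity solutions of \<open>lam u + H(x, du) = 0\<close>\<close>

definition viscosity_subsolution ::
    "('m::topological_space, 'e::euclidean_space) chart set
      \<Rightarrow> ('m \<Rightarrow> ('m, 'e) cotangent \<Rightarrow> real) \<Rightarrow> real \<Rightarrow> ('m \<Rightarrow> real) \<Rightarrow> bool" where
  "viscosity_subsolution A H lam u \<longleftrightarrow> continuous_on UNIV u \<and>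
     (\<forall>f\<in>C_fun A 1. \<forall>x. (\<forall>\<^sub>F y in nhds x. u y - f y \<le> u x - f x) \<longrightarrow>
        lam * u x + H x (differential A f x) \<le> 0)"

definition viscosity_supersolution ::
    "('m::topological_space, 'e::euclidean_space) chart set
      \<Rightarrow> ('m \<Rightarrow> ('m, 'e) cotangent \<Rightarrow> real) \<Rightarrow> real \<Rightarrow> ('m \<Rightarrow> real) \<Rightarrow> bool" where
  "viscosity_supersolution A H lam u \<longleftrightarrow> continuous_on UNIV u \<and>
     (\<forall>f\<in>C_fun A 1. \<forall>x. (\<forall>\<^sub>F y in nhds x. u y - f y \<ge> u x - f x) \<longrightarrow>
        lam * u x + H x (differential A f x) \<ge> 0)"

definition viscosity_solution ::
    "('m::topological_space, 'e::euclidean_space) chart set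
      \<Rightarrow> ('m \<Rightarrow> ('m, 'e) cotangent \<Rightarrow> real) \<Rightarrow> real \<Rightarrow> ('m \<Rightarrow> real) \<Rightarrow> bool" where
  "viscosity_solution A H lam u \<longleftrightarrow>
     viscosity_subsolution A H lam u \<and> viscosity_supersolution A H lam u"

section \<open>Functions dominated by the Lagrangian\<close>

(* The finite families of non-overlapping compact subintervals of [a,b] are the divisions D of
   subsets of [a,b]. *)
definition abs_continuous_on :: "real \<Rightarrow> real \<Rightarrow> (real \<Rightarrow> 'a::real_normed_vector) \<Rightarrow> bool" where
  "abs_continuous_on a b f \<longleftrightarrow>
     (\<forall>\<epsilon>>0. \<exists>\<delta>>0. \<forall>D S. D division_of S \<and> S \<subseteq> {a..b} \<and> (\<Sum>I\<in>D. Sup I - Inf I) < \<delta> \<longrightarrow>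
        (\<Sum>I\<in>D. norm (f (Sup I) - f (Inf I))) < \<epsilon>)"

definition abs_continuous_curve ::
    "('m::topological_space, 'e::euclidean_space) chart set \<Rightarrow> real \<Rightarrow> real \<Rightarrow> (real \<Rightarrow> 'm) \<Rightarrow> bool" where
  "abs_continuous_curve A a b \<gamma> \<longleftrightarrow> continuous_on {a..b} \<gamma> \<and>
     (\<forall>c\<in>A. \<forall>s t. a \<le> s \<and> s \<le> t \<and> t \<le> b \<and> \<gamma> ` {s..t} \<subseteq> cdom c \<longrightarrow>
        abs_continuous_on s t (cmap c \<circ> \<gamma>))"

(* Defined for almost every t if \<gamma> is absolutely continuous; the junk values elsewhere do not
   affect the integral below. *)
definition velocity ::
    "('m::topological_space, 'e::euclidean_space) chart set \<Rightarrow> (real \<Rightarrow> 'm) \<Rightarrow> real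
      \<Rightarrow> ('m, 'e) tangent" where
  "velocity A \<gamma> t = (\<lambda>c. if c \<in> A \<and> \<gamma> t \<in> cdom c
     then vector_derivative (cmap c \<circ> \<gamma>) (at t) else 0)"

(* The Lagrangian is bounded below, so the action of a curve is either finite or +\<infinity>; in the
   latter case (the integrand is not integrable) the inequality holds trivially. *)
definition dominated ::
    "('m::topological_space, 'e::euclidean_space) chart set
      \<Rightarrow> ('m \<Rightarrow> ('m, 'e) cotangent \<Rightarrow> real) \<Rightarrow> real \<Rightarrow> ('m \<Rightarrow> real) \<Rightarrow> bool" where
  "dominated A H lam u \<longleftrightarrow>
     (\<forall>a b \<gamma>. a \<le> b \<and> abs_continuous_curve A a b \<gamma> \<and>
        (\<lambda>t. exp (lam * t) * lagrangian A H (\<gamma> t) (velocity A \<gamma> t)) absolutely_integrable_on {a..b} \<longrightarrow>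
        exp (lam * b) * u (\<gamma> b) - exp (lam * a) * u (\<gamma> a)
          \<le> integral {a..b} (\<lambda>t. exp (lam * t) * lagrangian A H (\<gamma> t) (velocity A \<gamma> t)))"

definition S_minus ::
    "('m::topological_space, 'e::euclidean_space) chart set
      \<Rightarrow> ('m \<Rightarrow> ('m, 'e) cotangent \<Rightarrow> real) \<Rightarrow> real \<Rightarrow> ('m \<Rightarrow> real) set" where
  "S_minus A H lam = {u. continuous_on UNIV u \<and> dominated A H lam u}"

end

theory Submission
  imports Defs
begin

text \<open>Everything rests on the fact that a viscosity subsolution u is a uniform limit of smooth
  functions w satisfying \<open>lam w + H(x, dw) \<le> 0\<close> pointwise. In a chart, duality rewrites the equation
  as the family of inequalities \<open>du(v) \<le> L(x, v) - lam u\<close>, one for each constant vector v. Such an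
  inequality holds in the integrated sense along the segments with direction v, so no regularity
  of u is needed to convolve it with a mollifier, and it is preserved up to a small error; convexity of
  H allows one to glue the local approximations with a partition of unity.

  A classical subsolution w is dominated, since w is absolutely continuous along absolutely
  continuous curves; it lies below every supersolution, since it is itself a test function
  at a minimum point of their difference. Both properties pass to uniform limits.\<close>

section \<open>Calculus of functions of class \<open>C\<^sup>n\<close>\<close>

text \<open>\<open>S_minus\<close> is defined by domination along all absolutely continuous curves,
  whereas test functions see only pointwise slopes. Passing from slopes to actions needs that such
  curves have a velocity almost everywhere, which is a Vitali covering argument, and that an almost
  everywhere bound on a derivative integrates, which is a gauge argument since the integrand is
  merely integrable. The converse passage uses only straight lines in a chart. The velocity giving
  equality in Fenchel's inequality depends on the gradient of the mollified function, so that
  gradient has to be bounded before the radius of mollification is fixed. Velocities of length at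
  most 1 provide the bound; no Lipschitz estimate for u enters. Gluing leaves a positive error e in
  the equation. As \<open>lam\<close> is positive, lowering the function by the constant e /
  \<open>lam\<close> removes it; the same positivity turns the test at a minimum into an inequality
  between functions.\<close>

lemma Cn_on_cong_imp:
  assumes "open S" "\<And>x. x \<in> S \<Longrightarrow> f x = g x" "Cn_on n S f"
  shows "Cn_on n S g"
  using assms(2,3)
proof (induction n arbitrary: f g)
  case 0
  then show ?case by (auto cong: continuous_on_cong)
next
  case (Suc n)
  have d: "(g has_derivative frechet_derivative f (at x)) (at x)" if "x \<in> S" for x
    using Suc.prems that \<open>open S\<close>
    by (auto intro!: has_derivative_transform_within_open[of f _ x UNIV S g] simp: frechet_derivative_works)
  have "frechet_derivative f (at x) v = frechet_derivative g (at x) v" if "x \<in> S" for x v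
    using frechet_derivative_at[OF d[OF that]] by simp
  then have "Cn_on n S (\<lambda>x. frechet_derivative g (at x) v)" for v
    using Suc.IH[of "\<lambda>x. frechet_derivative f (at x) v"] Suc.prems by simp
  then show ?case
    using d by (auto intro: differentiableI)
qed

lemma Cn_on_subset: "Cn_on n S f \<Longrightarrow> T \<subseteq> S \<Longrightarrow> Cn_on n T f"
  by (induction n arbitrary: f) (auto intro: continuous_on_subset)

text \<open>Derivatives here are two-sided, so being of class C^n only concerns neighbourhoods of
  points; a function on a manifold can then be examined differently near different points, as in
  \<open>extend_Cn_on\<close>.\<close>

lemma Cn_on_local:
  assumes "\<And>x. x \<in> S \<Longrightarrow> \<exists>T. open T \<and> x \<in> T \<and> Cn_on n T f"
  shows "Cn_on n S f"
  using assms
proof (induction n arbitrary: f)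
  case 0
  then show ?case
    by (force simp: continuous_on_eq_continuous_at intro!: continuous_at_imp_continuous_on)
next
  case (Suc n)
  show ?case
  proof (clarsimp, intro conjI ballI allI)
    show "f differentiable at x" if "x \<in> S" for x
      using Suc.prems[OF that] by auto
    show "Cn_on n S (\<lambda>x. frechet_derivative f (at x) v)" for v
      by (rule Suc.IH) (use Suc.prems in fastforce)
  qed
qed

lemma Cn_on_SucD:
  "Cn_on (Suc n) S f \<Longrightarrow> Cn_on n S f"
proof (induction n arbitrary: f)
  case 0
  then show ?case
    by (auto intro!: continuous_at_imp_continuous_on differentiable_imp_continuous_within)
next
  case (Suc n)
  then show ?case by (metis Cn_on.simps(2))
qed

lemma Cn_on_mono: "Cn_on n S f \<Longrightarrow> m \<le> n \<Longrightarrow> Cn_on m S f"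
  by (induction n) (auto simp del: Cn_on.simps(2) simp: le_Suc_eq dest: Cn_on_SucD)

lemma Cn_on_continuous: "Cn_on n S f \<Longrightarrow> continuous_on S f"
  using Cn_on_mono[of n S f 0] by simp

lemma Cn_on_has_derivative:
  "Cn_on n S f \<Longrightarrow> n \<noteq> 0 \<Longrightarrow> x \<in> S \<Longrightarrow> (f has_derivative frechet_derivative f (at x)) (at x)"
  using Cn_on_mono[of n S f 1] by (auto simp: frechet_derivative_works)

lemma Cn_on_SucI:
  assumes "open S" "\<And>x. x \<in> S \<Longrightarrow> (f has_derivative f' x) (at x)" "\<And>v. Cn_on n S (\<lambda>x. f' x v)"
  shows "Cn_on (Suc n) S f"
proof -
  have "f' x v = frechet_derivative f (at x) v" if "x \<in> S" for x v
    using frechet_derivative_at[OF assms(2)[OF that]] by simp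
  then show ?thesis
    using assms Cn_on_cong_imp[OF \<open>open S\<close>, of "\<lambda>x. f' x v" "\<lambda>x. frechet_derivative f (at x) v" n for v]
    by (auto simp: differentiable_def)
qed

lemma Cn_on_const [simp]: "Cn_on n S (\<lambda>x. c)"
proof (induction n arbitrary: c)
  case (Suc n)
  have "frechet_derivative (\<lambda>x. c) (at x) v = 0" for x :: 'a and v
    using frechet_derivative_at[OF has_derivative_const[of c "at x"]] by metis
  with Suc show ?case by simp
qed simp

lemma Cn_on_linear:
  assumes "bounded_linear f"
  shows "Cn_on n S f"
proof -
  have "Cn_on n UNIV f"
  proof (cases n)
    case 0
    then show ?thesis using assms by (simp add: linear_continuous_on)
  next
    case (Suc m)
    show ?thesis unfolding Suc
      by (rule Cn_on_SucI[where f' = "\<lambda>_. f"]) (auto intro: bounded_linear_imp_has_derivative assms)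
  qed
  then show ?thesis by (rule Cn_on_subset) simp
qed

lemma Cn_on_id [simp]: "Cn_on n S (\<lambda>x. x)"
  by (intro Cn_on_linear bounded_linear_ident)

lemma Cn_on_bounded_linear:
  assumes "bounded_linear h" "open S" "Cn_on n S f"
  shows "Cn_on n S (\<lambda>x. h (f x))"
  using assms(3)
proof (induction n arbitrary: f)
  case 0
  then show ?case using assms(1) by (auto intro: bounded_linear.continuous_on)
next
  case (Suc n)
  have *: "(f has_derivative frechet_derivative f (at x)) (at x)" if "x \<in> S" for x
    using Cn_on_has_derivative[OF Suc.prems] that by simp
  show ?case
    by (rule Cn_on_SucI[where f' = "\<lambda>x v. h (frechet_derivative f (at x) v)"])
      (use Suc * assms in \<open>auto intro!: bounded_linear.has_derivative[OF assms(1)]\<close>)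
qed

lemma Cn_on_add:
  assumes "open S" "Cn_on n S f" "Cn_on n S g"
  shows "Cn_on n S (\<lambda>x. f x + g x)"
  using assms(2,3)
proof (induction n arbitrary: f g)
  case 0
  then show ?case by (auto intro: continuous_intros)
next
  case (Suc n)
  show ?case
    by (rule Cn_on_SucI[where f' = "\<lambda>x v. frechet_derivative f (at x) v + frechet_derivative g (at x) v"])
      (use Suc assms Cn_on_has_derivative in \<open>auto intro!: has_derivative_add simp: frechet_derivative_works\<close>)
qed

lemma Cn_on_sum:
  assumes "open S" "\<And>i. i \<in> I \<Longrightarrow> Cn_on n S (f i)"
  shows "Cn_on n S (\<lambda>x. \<Sum>i\<in>I. f i x)"
  using assms(2) by (induction I rule: infinite_finite_induct) (auto intro: Cn_on_add[OF assms(1)])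

lemma Cn_on_bilinear:
  assumes "bounded_bilinear B" "open S" "Cn_on n S f" "Cn_on n S g"
  shows "Cn_on n S (\<lambda>x. B (f x) (g x))"
  using assms(3,4)
proof (induction n arbitrary: f g)
  case 0
  then show ?case using assms by (auto intro: bounded_bilinear.continuous_on)
next
  case (Suc n)
  show ?case
  proof (rule Cn_on_SucI[where f' = "\<lambda>x v. B (f x) (frechet_derivative g (at x) v) + B (frechet_derivative f (at x) v) (g x)"])
    show "((\<lambda>x. B (f x) (g x)) has_derivative
        (\<lambda>v. B (f x) (frechet_derivative g (at x) v) + B (frechet_derivative f (at x) v) (g x))) (at x)" if "x \<in> S" for x
      using Suc.prems that
      by (intro bounded_bilinear.FDERIV[OF assms(1)]) (auto simp: frechet_derivative_works)
    show "Cn_on n S (\<lambda>x. B (f x) (frechet_derivative g (at x) v) + B (frechet_derivative f (at x) v) (g x))" for v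
      using Suc.prems Suc.prems[THEN Cn_on_SucD] by (intro Cn_on_add[OF assms(2)] Suc.IH) auto
  qed (fact assms(2))
qed

lemmas Cn_on_mult = Cn_on_bilinear[OF bounded_bilinear_mult]
lemmas Cn_on_scaleR = Cn_on_bilinear[OF bounded_bilinear_scaleR]
lemmas Cn_on_inner = Cn_on_bilinear[OF bounded_bilinear_inner]

lemma Cn_on_diff:
  assumes "open S" "Cn_on n S f" "Cn_on n S g"
  shows "Cn_on n S (\<lambda>x. f x - g x)"
  using Cn_on_add[OF assms(1,2) Cn_on_bounded_linear[OF bounded_linear_minus[OF bounded_linear_ident] assms(1,3)]]
  by simp

text \<open>The chain rule evaluates the derivative of f in the direction Dg(v), which varies with
  x, whereas \<open>Cn_on\<close> speaks of fixed directions. Expanding that direction in the basis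
  leaves products to which the induction hypothesis applies with g unchanged.\<close>

lemma Cn_on_compose:
  fixes f :: "'b::euclidean_space \<Rightarrow> 'c::real_normed_vector" and g :: "'a::euclidean_space \<Rightarrow> 'b"
  assumes "open S" "open T" "g ` S \<subseteq> T" "Cn_on n T f" "Cn_on n S g"
  shows "Cn_on n S (\<lambda>x. f (g x))"
  using assms(4,5)
proof (induction n arbitrary: f)
  case 0
  then show ?case using continuous_on_compose2[of T f S g] assms(3) by auto
next
  case (Suc n)
  show ?case
  proof (rule Cn_on_SucI[where f' = "\<lambda>x v. \<Sum>b\<in>Basis. (frechet_derivative g (at x) v \<bullet> b) *\<^sub>R frechet_derivative f (at (g x)) b"])
    fix x assume x: "x \<in> S"
    then have "g x \<in> T" using assms(3) by auto
    have *: "(f has_derivative frechet_derivative f (at (g x))) (at (g x))"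
      using Cn_on_has_derivative[OF Suc.prems(1)] \<open>g x \<in> T\<close> by simp
    have 1: "((\<lambda>x. f (g x)) has_derivative (\<lambda>v. frechet_derivative f (at (g x)) (frechet_derivative g (at x) v))) (at x)"
      using Cn_on_has_derivative[OF Suc.prems(2)] x by (intro has_derivative_compose[of g _ x UNIV f, OF _ *]) simp
    have 2: "frechet_derivative f (at (g x)) w = (\<Sum>b\<in>Basis. (w \<bullet> b) *\<^sub>R frechet_derivative f (at (g x)) b)" for w
    proof -
      interpret bounded_linear "frechet_derivative f (at (g x))" using * by (rule has_derivative_bounded_linear)
      show ?thesis by (subst (1) euclidean_representation[of w, symmetric]) (simp only: sum scaleR)
    qed
    show "((\<lambda>x. f (g x)) has_derivative (\<lambda>v. \<Sum>b\<in>Basis. (frechet_derivative g (at x) v \<bullet> b) *\<^sub>R frechet_derivative f (at (g x)) b)) (at x)"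
      by (rule has_derivative_eq_rhs[OF 1]) (rule ext, rule 2)
  next
    fix v
    have "Cn_on n S (\<lambda>x. frechet_derivative f (at (g x)) b)" for b
      using Suc.prems Suc.prems[THEN Cn_on_SucD] by (intro Suc.IH) auto
    then show "Cn_on n S (\<lambda>x. \<Sum>b\<in>Basis. (frechet_derivative g (at x) v \<bullet> b) *\<^sub>R frechet_derivative f (at (g x)) b)"
      using Suc.prems by (intro Cn_on_sum Cn_on_scaleR Cn_on_inner assms) auto
  qed (fact assms(1))
qed

lemma Cn_on_inverse: "Cn_on n (- {0}) (inverse :: real \<Rightarrow> real)"
proof (induction n)
  case 0
  then show ?case by (auto intro: continuous_intros)
next
  case (Suc n)
  show ?case
  proof (rule Cn_on_SucI[where f' = "\<lambda>x v. - (inverse x * v * inverse x)"])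
    show "(inverse has_derivative (\<lambda>v. - (inverse x * v * inverse x))) (at x)" if "x \<in> - {0}" for x :: real
      using that has_derivative_inverse'[of x UNIV] by auto
    show "Cn_on n (- {0}) (\<lambda>x::real. - (inverse x * v * inverse x))" for v
      by (rule Cn_on_bounded_linear[OF bounded_linear_minus[OF bounded_linear_ident]])
        (auto intro!: Cn_on_mult Suc)
  qed auto
qed

lemma Cn_on_divide:
  fixes f g :: "'a::euclidean_space \<Rightarrow> real"
  assumes "open S" "Cn_on n S f" "Cn_on n S g" "\<And>x. x \<in> S \<Longrightarrow> g x \<noteq> 0"
  shows "Cn_on n S (\<lambda>x. f x / g x)"
  unfolding divide_inverse
  by (intro Cn_on_mult Cn_on_compose[OF _ _ _ Cn_on_inverse] assms) (use assms in auto)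

lemma C_on_infinity: "C_on \<infinity> S f \<longleftrightarrow> (\<forall>n. Cn_on n S f)"
  by (simp add: C_on_def)

lemma C_on_iff_Cn_on: "C_on (enat n) S f \<longleftrightarrow> Cn_on n S f"
  by (auto simp: C_on_def intro: Cn_on_mono)

lemma C_on_1: "C_on 1 S f \<longleftrightarrow> Cn_on 1 S f"
  using C_on_iff_Cn_on[of 1 S f] by (simp add: one_enat_def)

section \<open>Smooth cut-off functions\<close>

text \<open>Negative powers of t are built into the family so that the derivative of a member is a
  combination of members; smoothness of every order then follows from one induction.\<close>

definition flat :: "nat \<Rightarrow> real \<Rightarrow> real" where
  "flat k t = (if t > 0 then (1 / t) ^ k * exp (- 1 / t) else 0)"

lemma flat_tendsto_0: "(flat k \<longlongrightarrow> 0) (at 0)"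
proof -
  have "((\<lambda>t. (1 / t) ^ k / exp (1 / t)) \<longlongrightarrow> (0::real)) (at_right 0)"
    using filterlim_compose[OF tendsto_power_div_exp_0[of k] filterlim_inverse_at_top_right]
    by (simp add: inverse_eq_divide)
  then have "(flat k \<longlongrightarrow> 0) (at_right 0)"
    by (rule Lim_transform_eventually)
      (auto simp: flat_def eventually_at_filter exp_minus divide_inverse)
  moreover have "(flat k \<longlongrightarrow> 0) (at_left 0)"
    by (rule tendsto_eventually) (auto simp: flat_def eventually_at_filter)
  ultimately show ?thesis by (simp add: filterlim_at_split)
qed

lemma flat_has_derivative:
  "(flat k has_real_derivative (flat (k + 2) t - of_nat k * flat (k + 1) t)) (at t)"
proof (cases t "0::real" rule: linorder_cases)
  case less
  have "((\<lambda>_. 0) has_real_derivative 0) (at t)" by simp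
  then have "(flat k has_real_derivative 0) (at t)"
    by (rule has_field_derivative_transform_within_open[of _ _ _ "{..<0}"]) (use less in \<open>auto simp: flat_def\<close>)
  with less show ?thesis by (simp add: flat_def)
next
  case equal
  \<comment> \<open>Away from 0 the difference quotient of \<open>flat k\<close> at 0 is
    \<open>flat (Suc k)\<close>, which tends to 0.\<close>
  have "((\<lambda>h. (flat k (0 + h) - flat k 0) / h) \<longlongrightarrow> 0) (at 0)"
    by (rule Lim_transform_eventually[OF flat_tendsto_0[of "Suc k"]])
      (auto simp: flat_def eventually_at_filter field_simps)
  then show ?thesis using equal by (simp add: DERIV_def flat_def)
next
  case greater
  have "((\<lambda>t. (1 / t) ^ k * exp (- 1 / t)) has_real_derivative (flat (k + 2) t - of_nat k * flat (k + 1) t)) (at t)"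
  proof (cases k)
    case 0
    then show ?thesis using greater
      by (auto intro!: derivative_eq_intros simp: flat_def power2_eq_square)
  next
    case (Suc j)
    have 1: "((\<lambda>t. 1 / t) has_real_derivative - ((1 / t)\<^sup>2)) (at t)"
      using greater by (auto intro!: derivative_eq_intros simp: power2_eq_square)
    have 2: "((\<lambda>t. exp (- 1 / t)) has_real_derivative exp (- 1 / t) * (1 / t)\<^sup>2) (at t)"
      using greater by (auto intro!: derivative_eq_intros simp: power2_eq_square)
    show ?thesis
      by (rule DERIV_cong[OF DERIV_mult[OF DERIV_power_Suc[OF 1, of j] 2, folded Suc]])
        (use greater in \<open>simp add: Suc flat_def algebra_simps power2_eq_square\<close>)
  qed
  then show ?thesis
    by (rule has_field_derivative_transform_within_open[of _ _ _ "{0<..}"]) (use greater in \<open>auto simp: flat_def\<close>)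
qed

lemma Cn_on_flat: "Cn_on n UNIV (flat k)"
proof (induction n arbitrary: k)
  case 0
  show ?case
    by (simp add: continuous_at_imp_continuous_on DERIV_isCont[OF flat_has_derivative])
next
  case (Suc n)
  show ?case
  proof (rule Cn_on_SucI)
    show "(flat k has_derivative (\<lambda>v. (flat (k + 2) t - of_nat k * flat (k + 1) t) * v)) (at t)" for t
      using flat_has_derivative by (simp add: has_field_derivative_def)
    show "Cn_on n UNIV (\<lambda>t. (flat (k + 2) t - of_nat k * flat (k + 1) t) * v)" for v
      by (intro Cn_on_mult Cn_on_diff Suc) auto
  qed simp
qed

definition smooth_step :: "real \<Rightarrow> real" where
  "smooth_step t = flat 0 t / (flat 0 t + flat 0 (1 - t))"

lemma flat_add_flat_pos: "flat 0 t + flat 0 (1 - t) > 0"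
  by (auto simp: flat_def intro: add_pos_pos)

lemma Cn_on_smooth_step: "Cn_on n UNIV smooth_step"
proof -
  have "Cn_on n UNIV (\<lambda>t. flat 0 (1 - t))"
    by (rule Cn_on_compose[OF _ _ _ Cn_on_flat[of n 0]]) (auto intro: Cn_on_diff)
  moreover have "flat 0 t + flat 0 (1 - t) \<noteq> 0" for t using flat_add_flat_pos[of t] by simp
  ultimately show ?thesis
    unfolding smooth_step_def[abs_def] by (intro Cn_on_divide Cn_on_add Cn_on_flat) auto
qed

lemma smooth_step_simps:
  "t \<le> 0 \<Longrightarrow> smooth_step t = 0" "t \<ge> 1 \<Longrightarrow> smooth_step t = 1" "0 \<le> smooth_step t"
  using flat_add_flat_pos[of t] by (auto simp: smooth_step_def) (auto simp: flat_def)

text \<open>The squared distance keeps the function smooth at its centre. For r > 0 it equals 1 up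
  to distance r and vanishes from distance sqrt 2 * r on; the radius 2 * r used later is a
  convenient larger one.\<close>

definition bump :: "'a::euclidean_space \<Rightarrow> real \<Rightarrow> 'a \<Rightarrow> real" where
  "bump a r x = smooth_step (2 - (x - a) \<bullet> (x - a) / r\<^sup>2)"

lemma Cn_on_bump: "Cn_on n S (bump a r)"
proof -
  have "Cn_on n UNIV (\<lambda>x. 2 - (x - a) \<bullet> (x - a) * inverse (r\<^sup>2))"
    by (intro Cn_on_diff Cn_on_mult Cn_on_inner) (auto intro!: Cn_on_diff)
  then have "Cn_on n UNIV (\<lambda>x. smooth_step (2 - (x - a) \<bullet> (x - a) * inverse (r\<^sup>2)))"
    by (intro Cn_on_compose[OF _ _ _ Cn_on_smooth_step[of n]]) auto
  moreover have "bump a r = (\<lambda>x. smooth_step (2 - (x - a) \<bullet> (x - a) * inverse (r\<^sup>2)))"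
    by (rule ext) (simp add: bump_def divide_inverse)
  ultimately show ?thesis by (metis Cn_on_subset subset_UNIV)
qed

lemma bump_eq_1: "r > 0 \<Longrightarrow> norm (x - a) \<le> r \<Longrightarrow> bump a r x = 1"
  unfolding bump_def
  by (intro smooth_step_simps(2)) (auto simp: divide_simps dot_square_norm intro!: power_mono)

lemma bump_eq_0:
  assumes "r > 0" "norm (x - a) \<ge> 2 * r"
  shows "bump a r x = 0"
proof -
  have "(2 * r)\<^sup>2 \<le> (norm (x - a))\<^sup>2" using assms by (intro power_mono) auto
  then have "2 * r\<^sup>2 \<le> (norm (x - a))\<^sup>2"
    by (rule order_trans[rotated]) (simp add: power_mult_distrib)
  then show ?thesis
    unfolding bump_def using assms
    by (intro smooth_step_simps(1)) (auto simp: divide_simps dot_square_norm)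
qed

lemma bump_nonneg: "bump a r x \<ge> 0"
  by (simp add: bump_def smooth_step_simps)

text \<open>Only the kernel is differentiated, under the integral sign, so U need only be
  continuous. The derivative is again a convolution, with a directional derivative of K as kernel,
  and K is therefore left arbitrary in the induction.\<close>

lemma Cn_on_convolution:
  fixes K :: "'a::euclidean_space \<Rightarrow> real" and U :: "'a \<Rightarrow> real"
  assumes U: "continuous_on (cbox a b) U" and K: "Cn_on n UNIV K"
  shows "Cn_on n UNIV (\<lambda>y. integral (cbox a b) (\<lambda>z. K (y - z) * U z))"
  using K
proof (induction n arbitrary: K)
  case 0
  have "continuous_on (UNIV \<times> cbox a b) (\<lambda>(y, z). K (y - z) * U z)"
    using U 0 by (auto simp: split_beta intro!: continuous_intros continuous_on_compose2[of UNIV K] continuous_on_compose2[OF U])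
  then show ?case by (simp add: integral_continuous_on_param)
next
  case (Suc n)
  have bl: "bounded_linear (frechet_derivative K (at x))" for x
    using Cn_on_has_derivative[OF Suc.prems] by (auto intro: has_derivative_bounded_linear)
  have ck: "continuous_on UNIV K" by (rule Cn_on_continuous[OF Suc.prems])
  \<comment> \<open>\<open>leibniz_rule\<close> asks for a derivative that is continuous in the
    operator norm; in finite dimension continuity of all directional derivatives is enough.\<close>
  define DK where "DK x = Blinfun (frechet_derivative K (at x))" for x
  have DK: "blinfun_apply (DK x) = frechet_derivative K (at x)" for x
    by (simp add: DK_def bounded_linear_Blinfun_apply bl)
  have "continuous_on UNIV DK"
    by (rule continuous_on_blinfun_componentwise) (use Suc.prems in \<open>auto simp: DK intro: Cn_on_continuous\<close>)
  then have cont: "continuous_on (UNIV \<times> cbox a b) (\<lambda>(y, z). U z *\<^sub>R DK (y - z))"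
    by (auto simp: split_beta intro!: continuous_intros continuous_on_compose2[of UNIV DK] continuous_on_compose2[OF U])
  show ?case
  proof (rule Cn_on_SucI)
    fix y0 :: 'a
    have "((\<lambda>y. integral (cbox a b) (\<lambda>z. K (y - z) * U z)) has_derivative
        integral (cbox a b) (\<lambda>z. U z *\<^sub>R DK (y0 - z))) (at y0)"
    proof (rule leibniz_rule[where fx = "\<lambda>y z. U z *\<^sub>R DK (y - z)" and U = UNIV])
      fix x t :: 'a
      have "((\<lambda>x. K (x - t)) has_derivative frechet_derivative K (at (x - t))) (at x)"
        by (rule has_derivative_compose[where f = "\<lambda>x. x - t" and f' = "\<lambda>x. x"])
          (auto intro!: derivative_eq_intros Cn_on_has_derivative[OF Suc.prems])
      from has_derivative_mult_left[OF this, of "U t"]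
      show "((\<lambda>x. K (x - t) * U t) has_derivative blinfun_apply (U t *\<^sub>R DK (x - t))) (at x)"
        by (simp add: DK scaleR_blinfun.rep_eq mult.commute)
    next
      show "(\<lambda>z. K (x - z) * U z) integrable_on cbox a b" for x
        using U ck by (intro integrable_continuous) (auto intro!: continuous_intros continuous_on_compose2[of UNIV K])
      show "continuous_on (UNIV \<times> cbox a b) (\<lambda>(y, z). U z *\<^sub>R DK (y - z))" by (fact cont)
    qed auto
    moreover have "blinfun_apply (integral (cbox a b) (\<lambda>z. U z *\<^sub>R DK (y0 - z))) v =
        integral (cbox a b) (\<lambda>z. frechet_derivative K (at (y0 - z)) v * U z)" for v
    proof -
      have "continuous_on (cbox a b) (\<lambda>z. (\<lambda>(y, z). U z *\<^sub>R DK (y - z)) (y0, z))"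
        by (rule continuous_on_compose2[OF cont]) (auto intro!: continuous_intros)
      then have "(\<lambda>z. U z *\<^sub>R DK (y0 - z)) integrable_on cbox a b"
        by (intro integrable_continuous) simp
      from blinfun_apply_integral[OF this]
      show ?thesis by (simp add: DK scaleR_blinfun.rep_eq mult.commute)
    qed
    ultimately show "((\<lambda>y. integral (cbox a b) (\<lambda>z. K (y - z) * U z)) has_derivative
        (\<lambda>v. integral (cbox a b) (\<lambda>z. frechet_derivative K (at (y0 - z)) v * U z))) (at y0)"
      using has_derivative_eq_rhs by (metis (no_types, lifting) ext)
  next
    show "Cn_on n UNIV (\<lambda>x. integral (cbox a b) (\<lambda>z. frechet_derivative K (at (x - z)) v * U z))" for v
      using Suc.prems by (intro Suc.IH) auto
  qed simp
qed

section \<open>Absolutely continuous functions of one variable\<close>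

lemma division_telescope:
  fixes f :: "real \<Rightarrow> real"
  assumes "a \<le> b" "D division_of {a..b}"
  shows "(\<Sum>K\<in>D. f (Sup K) - f (Inf K)) = f b - f a"
proof -
  \<comment> \<open>Tagging each interval with its left endpoint gives a tagged division, for which
    increments are known to telescope.\<close>
  let ?p = "(\<lambda>K. (Inf K, K)) ` D"
  note D = division_ofD[OF assms(2)]
  have I: "\<exists>u v. K = {u..v} \<and> u \<le> v" if "K \<in> D" for K
    using D(3,4)[OF that] by (auto simp: cbox_interval)
  have "?p tagged_division_of {a..b}"
  proof (rule tagged_division_ofI)
    show "finite ?p" using D(1) by simp
    fix x K assume "(x, K) \<in> ?p"
    then have K: "K \<in> D" "x = Inf K" by auto
    then show "K \<subseteq> {a..b}" "\<exists>a b. K = cbox a b" using D(2,4) by auto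
    show "x \<in> K" using I[OF K(1)] K(2) by auto
    fix x' K' assume "(x', K') \<in> ?p" "(x, K) \<noteq> (x', K')"
    then show "interior K \<inter> interior K' = {}" using D(5) K by auto
  next
    have "{K. \<exists>x. (x, K) \<in> ?p} = D" by auto
    then show "\<Union>{K. \<exists>x. (x, K) \<in> ?p} = {a..b}" using D(6) by simp
  qed
  from additive_tagged_division_1[OF assms(1) this, of f]
  show ?thesis by (subst (asm) sum.reindex) (auto simp: inj_on_def)
qed

abbreviation variation_sum :: "(real \<Rightarrow> real) \<Rightarrow> real set set \<Rightarrow> real" where
  "variation_sum g D \<equiv> (\<Sum>K\<in>D. \<bar>g (Sup K) - g (Inf K)\<bar>)"

lemma division_interval:
  fixes S :: "real set"
  assumes "D division_of S" "K \<in> D"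
  shows "K = {Inf K..Sup K}" "Inf K \<le> Sup K" "K \<subseteq> S"
proof -
  show "K \<subseteq> S" using division_ofD(2)[OF assms] .
  obtain u v where "K = cbox u v" using division_ofD(4)[OF assms] by blast
  moreover have "K \<noteq> {}" using division_ofD(3)[OF assms] .
  ultimately show "K = {Inf K..Sup K}" "Inf K \<le> Sup K" by (auto simp: cbox_interval)
qed

text \<open>Here s is the sign of the total increment and the intervals of P move against it. The
  signed increments over a division Q containing P add up to the total; in the variation of Q each K
  in P counts with the opposite sign, a gain of at least 2 * k times its length.\<close>

lemma variation_refine_interval:
  fixes g :: "real \<Rightarrow> real"
  assumes "l \<le> u" "P division_of (\<Union>P)" "\<Union>P \<subseteq> {l..u}"
    and s: "s * (g u - g l) = \<bar>g u - g l\<bar>" "\<bar>s\<bar> = 1"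
    and sP: "\<And>K. K \<in> P \<Longrightarrow> s * (g (Sup K) - g (Inf K)) \<le> - (k * (Sup K - Inf K))"
  shows "\<exists>Q. Q division_of {l..u} \<and>
    \<bar>g u - g l\<bar> + 2 * k * (\<Sum>K\<in>P. Sup K - Inf K) \<le> variation_sum g Q"
proof -
  have abs: "\<bar>x\<bar> = \<bar>s * x\<bar>" for x using s(2) by (simp add: abs_mult)
  obtain Q where Q: "P \<subseteq> Q" "Q division_of {l..u}"
    using partial_division_extend_interval[of P l u] assms by (auto simp: cbox_interval)
  have fin: "finite Q" using Q(2) by (rule division_ofD)
  have "\<bar>g u - g l\<bar> = s * (\<Sum>K\<in>Q. g (Sup K) - g (Inf K))"
    using division_telescope[OF \<open>l \<le> u\<close> Q(2), of g] s by simp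
  also have "\<dots> = (\<Sum>K\<in>Q - P. s * (g (Sup K) - g (Inf K))) + (\<Sum>K\<in>P. s * (g (Sup K) - g (Inf K)))"
    unfolding sum_distrib_left by (rule sum.subset_diff[OF Q(1) fin])
  also have "\<dots> \<le> (\<Sum>K\<in>Q - P. \<bar>g (Sup K) - g (Inf K)\<bar>) + (\<Sum>K\<in>P. \<bar>g (Sup K) - g (Inf K)\<bar> - 2 * (k * (Sup K - Inf K)))"
  proof (intro add_mono sum_mono)
    fix K
    show "s * (g (Sup K) - g (Inf K)) \<le> \<bar>g (Sup K) - g (Inf K)\<bar>"
      using abs[of "g (Sup K) - g (Inf K)"] by simp
    assume "K \<in> P"
    with sP[OF this] abs[of "g (Sup K) - g (Inf K)"]
    show "s * (g (Sup K) - g (Inf K)) \<le> \<bar>g (Sup K) - g (Inf K)\<bar> - 2 * (k * (Sup K - Inf K))"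
      by simp
  qed
  also have "\<dots> = variation_sum g Q - 2 * k * (\<Sum>K\<in>P. Sup K - Inf K)"
    by (subst sum_subtractf) (simp add: sum.subset_diff[OF Q(1) fin] sum_distrib_left mult.assoc)
  finally show ?thesis using Q(2) by auto
qed

lemma division_refine:
  assumes D: "D division_of {a..b}" and Q: "\<And>I. I \<in> D \<Longrightarrow> Q I division_of I"
  shows "(\<Union>I\<in>D. Q I) division_of {a..b}"
    and "(\<Sum>I\<in>D. variation_sum g (Q I)) \<le> variation_sum g (\<Union>I\<in>D. Q I)"
proof -
  note D' = division_ofD[OF D]
  show div: "(\<Union>I\<in>D. Q I) division_of {a..b}"
  proof (rule division_ofI)
    show "finite (\<Union>I\<in>D. Q I)" using D'(1) Q by auto
    have "\<Union>(\<Union>I\<in>D. Q I) = (\<Union>I\<in>D. \<Union>(Q I))" by auto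
    then show "\<Union>(\<Union>I\<in>D. Q I) = {a..b}" using division_ofD(6)[OF Q] D'(6) by simp
    fix K assume "K \<in> (\<Union>I\<in>D. Q I)"
    then obtain I where I: "I \<in> D" "K \<in> Q I" by auto
    show "K \<subseteq> {a..b}" using division_ofD(2)[OF Q[OF I(1)] I(2)] D'(2)[OF I(1)] by auto
    show "K \<noteq> {}" "\<exists>a b. K = cbox a b" using division_ofD(3,4)[OF Q[OF I(1)] I(2)] by auto
    fix K' assume "K' \<in> (\<Union>I\<in>D. Q I)" and ne: "K \<noteq> K'"
    then obtain I' where I': "I' \<in> D" "K' \<in> Q I'" by auto
    show "interior K \<inter> interior K' = {}"
    proof (cases "I = I'")
      case True
      then show ?thesis using division_ofD(5)[OF Q[OF I(1)]] I I' ne by auto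
    next
      case False
      then have "interior I \<inter> interior I' = {}" using D'(5) I I' by auto
      moreover have "K \<subseteq> I" "K' \<subseteq> I'" using division_ofD(2)[OF Q] I I' by auto
      ultimately show ?thesis using interior_mono by blast
    qed
  qed
  \<comment> \<open>Families of neighbouring intervals may share a one-point interval, which the
    union counts only once. Such intervals add nothing to the variation, and the remaining ones have
    interior, so the families \<open>A I\<close> are disjoint.\<close>
  define A where "A I = {K \<in> Q I. Inf K < Sup K}" for I
  have fQ: "finite (Q I)" if "I \<in> D" for I using Q[OF that] by (rule division_ofD)
  have "(\<Sum>I\<in>D. variation_sum g (Q I)) = (\<Sum>I\<in>D. variation_sum g (A I))"
  proof (rule sum.cong[OF refl])
    fix I assume I: "I \<in> D"
    show "variation_sum g (Q I) = variation_sum g (A I)"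
      by (rule sum.mono_neutral_right)
        (use fQ[OF I] division_interval(2)[OF Q[OF I]] in \<open>force simp: A_def\<close>)+
  qed
  also have "\<dots> = variation_sum g (\<Union>I\<in>D. A I)"
  proof (rule sum.UNION_disjoint[symmetric])
    show "finite D" by (rule D')
    show "\<forall>I\<in>D. finite (A I)" using fQ by (auto simp: A_def)
    show "\<forall>I\<in>D. \<forall>J\<in>D. I \<noteq> J \<longrightarrow> A I \<inter> A J = {}"
    proof (intro ballI impI, rule ccontr)
      fix I J assume IJ: "I \<in> D" "J \<in> D" "I \<noteq> J" "A I \<inter> A J \<noteq> {}"
      then obtain K where K: "K \<in> Q I" "K \<in> Q J" "Inf K < Sup K" by (auto simp: A_def)
      have "interior K \<noteq> {}"
        by (subst division_interval(1)[OF Q[OF IJ(1)] K(1)]) (use K(3) in simp)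
      moreover have "interior K \<subseteq> interior I \<inter> interior J"
        using division_ofD(2)[OF Q] IJ K by (simp add: interior_mono)
      ultimately show False using D'(5) IJ by blast
    qed
  qed
  also have "\<dots> \<le> variation_sum g (\<Union>I\<in>D. Q I)"
    using division_ofD(1)[OF div] by (intro sum_mono2) (auto simp: A_def)
  finally show "(\<Sum>I\<in>D. variation_sum g (Q I)) \<le> variation_sum g (\<Union>I\<in>D. Q I)" .
qed

text \<open>R selects arbitrarily short intervals around every point of E, so by Vitali countably
  many disjoint ones cover E up to a null set. Every finite subfamily has total length at most
  \<epsilon> by the second hypothesis, hence so has the countable union.\<close>

lemma Vitali_variation_null:
  fixes g :: "real \<Rightarrow> real"
  assumes V: "\<And>x d. x \<in> E \<Longrightarrow> 0 < d \<Longrightarrow> \<exists>c e. c < e \<and> e - c < d \<and> x \<in> {c..e} \<and> R c e"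
    and B: "\<And>P. finite P \<Longrightarrow> P division_of (\<Union>P) \<Longrightarrow>
      (\<And>K. K \<in> P \<Longrightarrow> Inf K < Sup K \<and> K = {Inf K..Sup K} \<and> R (Inf K) (Sup K)) \<Longrightarrow> (\<Sum>K\<in>P. Sup K - Inf K) \<le> \<epsilon>"
  shows "\<exists>T. E \<subseteq> T \<and> T \<in> lmeasurable \<and> measure lebesgue T \<le> \<epsilon>"
proof -
  \<comment> \<open>The covering theorem is about balls, so an interval is rewritten as the ball
    around its midpoint.\<close>
  define cen where "cen = (\<lambda>(c::real, e::real). (c + e) / 2)"
  define rad where "rad = (\<lambda>(c::real, e::real). (e - c) / 2)"
  have cb: "cball (cen (c, e)) (rad (c, e)) = {c..e}" for c e
    unfolding cen_def rad_def cball_eq_atLeastAtMost by (simp add: field_simps)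
  define I where "I = {(c, e). c < e \<and> R c e}"
  have "0 < rad i" if "i \<in> I" for i using that by (auto simp: I_def rad_def)
  moreover have "\<exists>i. i \<in> I \<and> x \<in> cball (cen i) (rad i) \<and> rad i < d" if "x \<in> E" "0 < d" for x d
  proof -
    have "\<exists>c e. c < e \<and> e - c < d \<and> x \<in> {c..e} \<and> R c e" by (rule V[OF that])
    then obtain c e where "c < e \<and> e - c < d \<and> x \<in> {c..e} \<and> R c e" by blast
    then show ?thesis
      by (intro exI[of _ "(c, e)"]) (use cb[of c e] in \<open>auto simp: I_def rad_def\<close>)
  qed
  ultimately obtain C where C: "countable C" "C \<subseteq> I"
    "pairwise (\<lambda>i j. disjnt (cball (cen i) (rad i)) (cball (cen j) (rad j))) C"
    "negligible (E - (\<Union>i\<in>C. cball (cen i) (rad i)))"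
    by (rule Vitali_covering_theorem_cballs[of I rad E cen])
  define F where "F i = cball (cen i) (rad i)" for i
  have F: "F i = {fst i..snd i}" for i using cb[of "fst i" "snd i"] by (simp add: F_def)
  have lt: "fst i < snd i" "R (fst i) (snd i)" if "i \<in> C" for i using that C(2) by (auto simp: I_def)
  have bound: "measure lebesgue (\<Union>i\<in>C'. F i) \<le> \<epsilon>" if C': "C' \<subseteq> C" "finite C'" for C'
  proof -
    have int: "interior (F i) \<inter> interior (F j) = {}" if "i \<in> C'" "j \<in> C'" "F i \<noteq> F j" for i j
    proof -
      have "disjnt (F i) (F j)" using C(3) C' that unfolding pairwise_def F_def by (metis subsetD)
      then show ?thesis using interior_subset by (fastforce simp: disjnt_def)
    qed
    have "F ` C' division_of (\<Union>(F ` C'))"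
    proof (rule division_ofI)
      fix K assume K: "K \<in> F ` C'"
      then show "K \<noteq> {}" using lt C'(1) by (force simp: F less_imp_le)
      show "\<exists>a b. K = cbox a b" using K by (auto simp: F)
      show "K \<subseteq> \<Union>(F ` C')" using K by auto
      fix K' assume "K' \<in> F ` C'" "K \<noteq> K'"
      then show "interior K \<inter> interior K' = {}" using int K by (elim imageE) simp
    qed (use C' in auto)
    moreover have "Inf K < Sup K \<and> K = {Inf K..Sup K} \<and> R (Inf K) (Sup K)" if K: "K \<in> F ` C'" for K
      using that lt C'(1) by (auto simp: F less_imp_le subset_iff)
    ultimately have *: "(\<Sum>K\<in>F ` C'. Sup K - Inf K) \<le> \<epsilon>" using C'(2) by (intro B) auto
    have "measure lebesgue (\<Union>i\<in>C'. F i) \<le> (\<Sum>K\<in>F ` C'. measure lebesgue K)"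
    proof -
      have "K \<in> sets lebesgue" if "K \<in> F ` C'" for K using that by (auto simp: F)
      then show ?thesis using measure_UNION_le[of "F ` C'" "\<lambda>x. x" lebesgue] C'(2) by simp
    qed
    also have "\<dots> = (\<Sum>K\<in>F ` C'. Sup K - Inf K)"
      using lt C'(1) by (intro sum.cong) (auto simp: F less_imp_le subset_iff)
    finally show ?thesis using * by simp
  qed
  have T: "(\<Union>i\<in>C. F i) \<in> lmeasurable" "measure lebesgue (\<Union>i\<in>C. F i) \<le> \<epsilon>"
    using fmeasurable_UN_bound[OF C(1) _ bound] measure_UN_bound[OF C(1) _ bound] by (auto simp: F)
  let ?N = "E - (\<Union>i\<in>C. F i)"
  have N: "negligible ?N" using C(4) by (simp add: F_def)
  then have m: "?N \<in> lmeasurable" "measure lebesgue ?N = 0"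
    by (auto intro: negligible_imp_measurable negligible_imp_measure0)
  show ?thesis
  proof (intro exI[of _ "(\<Union>i\<in>C. F i) \<union> ?N"] conjI)
    show "(\<Union>i\<in>C. F i) \<union> ?N \<in> lmeasurable" using T m by (intro fmeasurable.Un)
    show "measure lebesgue ((\<Union>i\<in>C. F i) \<union> ?N) \<le> \<epsilon>"
      using measure_Un_le[of "\<Union>i\<in>C. F i" lebesgue ?N] T m fmeasurableD by fastforce
  qed auto
qed

(* Austin's argument: small intervals on which g moves against the trend of a nearly optimal
   division can be inserted into it, and increase the variation in proportion to their length. *)
lemma opposite_slopes_null:
  fixes g :: "real \<Rightarrow> real"
  assumes B: "\<And>D. D division_of {a..b} \<Longrightarrow> variation_sum g D \<le> B"
    and k: "k > 0" and E: "E \<subseteq> {a..b}"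
    and up: "\<And>x d. x \<in> E \<Longrightarrow> 0 < d \<Longrightarrow> \<exists>c e. c < e \<and> e - c < d \<and> x \<in> {c..e} \<and> g e - g c \<ge> k * (e - c)"
    and dn: "\<And>x d. x \<in> E \<Longrightarrow> 0 < d \<Longrightarrow> \<exists>c e. c < e \<and> e - c < d \<and> x \<in> {c..e} \<and> g e - g c \<le> - (k * (e - c))"
  shows "negligible E"
proof (cases "a \<le> b")
  case False
  then show ?thesis using E by simp
next
  case True
  define VS where "VS = variation_sum g ` {D. D division_of {a..b}}"
  have ne: "VS \<noteq> {}" using elementary_interval[of a b] by (auto simp: VS_def cbox_interval)
  have bdd: "bdd_above VS" using B by (auto simp: VS_def bdd_above_def)
  have upV: "variation_sum g D \<le> Sup VS" if "D division_of {a..b}" for D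
    by (rule cSup_upper[OF _ bdd]) (use that in \<open>auto simp: VS_def\<close>)
  show ?thesis
    unfolding negligible_outer_le
  proof (intro allI impI)
    fix \<epsilon> :: real assume "\<epsilon> > 0"
    \<comment> \<open>The slack 2 * k * \<epsilon> is the variation that would be gained by
      inserting adverse intervals of total length \<epsilon>, so no greater length can fit.\<close>
    have "Sup VS - 2 * k * \<epsilon> < Sup VS" using k \<open>\<epsilon> > 0\<close> by simp
    then obtain D where D: "D division_of {a..b}" "Sup VS - 2 * k * \<epsilon> < variation_sum g D"
      using less_cSup_iff[OF ne bdd] unfolding VS_def by blast
    note D' = division_ofD[OF D(1)]
    \<comment> \<open>An interval with zero increment receives the sign 1, so that
      \<open>sg I\<close> always has absolute value 1, as \<open>variation_refine_interval\<close>
      demands.\<close>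
    define sg where "sg I = (if g (Sup I) - g (Inf I) = 0 then 1 else sgn (g (Sup I) - g (Inf I)))" for I
    define R where "R c e \<longleftrightarrow> (\<exists>I\<in>D. {c..e} \<subseteq> I \<and> sg I * (g e - g c) \<le> - (k * (e - c)))" for c e
    \<comment> \<open>Away from the finitely many endpoints, a short interval around a point stays
      inside one interval of D and so has a definite trend to oppose.\<close>
    let ?N = "(\<Union>I\<in>D. {Inf I, Sup I})"
    have "\<exists>T. E - ?N \<subseteq> T \<and> T \<in> lmeasurable \<and> measure lebesgue T \<le> \<epsilon>"
    proof (rule Vitali_variation_null[where R = R])
      fix x d :: real assume x: "x \<in> E - ?N" and "0 < d"
      have "x \<in> \<Union>D" using x E D'(6) by blast
      then obtain I where I: "I \<in> D" "x \<in> I" by blast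
      define l u where "l = Inf I" and "u = Sup I"
      have lu: "I = {l..u}" "Inf I = l" "Sup I = u" "l \<le> u"
        unfolding l_def u_def using division_interval[OF D(1) I(1)] by auto
      have "x \<noteq> Inf I" "x \<noteq> Sup I" "x \<in> {l..u}" using x I(1) I(2)[unfolded lu(1)] by auto
      then have x': "l < x" "x < u" unfolding lu(2,3) by auto
      define d' where "d' = min d (min (x - l) (u - x))"
      have d': "d' > 0" using x' \<open>0 < d\<close> by (simp add: d'_def)
      have "\<exists>c e. c < e \<and> e - c < d' \<and> x \<in> {c..e} \<and> sg I * (g e - g c) \<le> - (k * (e - c))"
      proof (cases "sg I = 1")
        case True
        then show ?thesis using dn[of x d'] x d' by auto
      next
        case False
        then have "sg I = -1" by (auto simp: sg_def sgn_if split: if_splits)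
        moreover obtain c e where "c < e" "e - c < d'" "x \<in> {c..e}" "g e - g c \<ge> k * (e - c)"
          using up[of x d'] x d' by blast
        ultimately show ?thesis by (intro exI[of _ c] exI[of _ e]) simp
      qed
      then obtain c e where ce: "c < e" "e - c < d'" "x \<in> {c..e}" "sg I * (g e - g c) \<le> - (k * (e - c))"
        by blast
      then have "{c..e} \<subseteq> I" using lu by (auto simp: d'_def)
      then show "\<exists>c e. c < e \<and> e - c < d \<and> x \<in> {c..e} \<and> R c e"
        using ce I(1) by (intro exI[of _ c] exI[of _ e]) (auto simp: R_def d'_def)
    next
      fix P assume P: "finite P" "P division_of (\<Union>P)"
        "\<And>K. K \<in> P \<Longrightarrow> Inf K < Sup K \<and> K = {Inf K..Sup K} \<and> R (Inf K) (Sup K)"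
      have "\<forall>K\<in>P. \<exists>I\<in>D. K \<subseteq> I \<and> sg I * (g (Sup K) - g (Inf K)) \<le> - (k * (Sup K - Inf K))"
        using P(3) unfolding R_def by metis
      then obtain J where J: "\<And>K. K \<in> P \<Longrightarrow> J K \<in> D" "\<And>K. K \<in> P \<Longrightarrow> K \<subseteq> J K"
        "\<And>K. K \<in> P \<Longrightarrow> sg (J K) * (g (Sup K) - g (Inf K)) \<le> - (k * (Sup K - Inf K))"
        by metis
      define PI where "PI I = {K \<in> P. J K = I}" for I
      have ex: "\<exists>Q. Q division_of I \<and>
          \<bar>g (Sup I) - g (Inf I)\<bar> + 2 * k * (\<Sum>K\<in>PI I. Sup K - Inf K) \<le> variation_sum g Q" if I: "I \<in> D" for I
      proof -
        define l u where "l = Inf I" and "u = Sup I"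
        have lu: "I = {l..u}" "Inf I = l" "Sup I = u" "l \<le> u"
          unfolding l_def u_def using division_interval[OF D(1) I] by auto
        have "PI I division_of (\<Union>(PI I))"
          using division_of_subset[OF P(2), of "PI I"] by (auto simp: PI_def)
        moreover have "\<Union>(PI I) \<subseteq> {l..u}" using J(2) lu by (auto simp: PI_def)
        moreover have "sg I * (g (Sup K) - g (Inf K)) \<le> - (k * (Sup K - Inf K))" if "K \<in> PI I" for K
          using that J(3)[of K] by (auto simp: PI_def)
        moreover have "sg I * (g u - g l) = \<bar>g u - g l\<bar>" "\<bar>sg I\<bar> = 1"
          using lu by (auto simp: sg_def sgn_if)
        ultimately show ?thesis
          using variation_refine_interval[of l u "PI I" "sg I" g k] lu by auto
      qed
      obtain Q where Q': "\<forall>I\<in>D. Q I division_of I \<and>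
          \<bar>g (Sup I) - g (Inf I)\<bar> + 2 * k * (\<Sum>K\<in>PI I. Sup K - Inf K) \<le> variation_sum g (Q I)"
        using bchoice[OF ballI, OF ex] by (rule exE)
      have Q: "Q I division_of I"
        "\<bar>g (Sup I) - g (Inf I)\<bar> + 2 * k * (\<Sum>K\<in>PI I. Sup K - Inf K) \<le> variation_sum g (Q I)" if "I \<in> D" for I
        using bspec[OF Q' that] by auto
      have "variation_sum g D + 2 * k * (\<Sum>I\<in>D. \<Sum>K\<in>PI I. Sup K - Inf K) \<le> (\<Sum>I\<in>D. variation_sum g (Q I))"
        using sum_mono[OF Q(2), of D "\<lambda>x. x"] by (simp add: sum.distrib sum_distrib_left)
      also have "\<dots> \<le> variation_sum g (\<Union>I\<in>D. Q I)"
        by (rule division_refine(2)[OF D(1) Q(1)])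
      also have "\<dots> \<le> Sup VS" by (rule upV[OF division_refine(1)[OF D(1) Q(1)]])
      also have "\<dots> < variation_sum g D + 2 * k * \<epsilon>" using D(2) by simp
      finally have "2 * k * (\<Sum>I\<in>D. \<Sum>K\<in>PI I. Sup K - Inf K) < 2 * k * \<epsilon>" by simp
      moreover have "(\<Sum>I\<in>D. \<Sum>K\<in>PI I. Sup K - Inf K) = (\<Sum>K\<in>P. Sup K - Inf K)"
        unfolding PI_def by (rule sum.group) (use P(1) D'(1) J(1) in auto)
      ultimately show "(\<Sum>K\<in>P. Sup K - Inf K) \<le> \<epsilon>" using k by simp
    qed
    then obtain T where T: "E - ?N \<subseteq> T" "T \<in> lmeasurable" "measure lebesgue T \<le> \<epsilon>" by blast
    have "finite ?N" using D'(1) by auto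
    then have N: "?N \<in> lmeasurable" "measure lebesgue ?N = 0"
      by (auto intro: negligible_imp_measurable negligible_imp_measure0 negligible_finite)
    show "\<exists>T. E \<subseteq> T \<and> T \<in> lmeasurable \<and> measure lebesgue T \<le> \<epsilon>"
      by (rule exI[of _ "T \<union> ?N"])
        (use T N measure_Un_le[of T lebesgue ?N] in \<open>auto dest: fmeasurableD\<close>)
  qed
qed

text \<open>Non-overlapping intervals in \<open>{a..b}\<close> on which g changes by at least N
  times the length have total length at most B / N, since they extend to a division. Here N can be
  taken arbitrarily large.\<close>

lemma unbounded_slopes_null:
  fixes g :: "real \<Rightarrow> real"
  assumes B: "\<And>D. D division_of {a..b} \<Longrightarrow> variation_sum g D \<le> B" and E: "E \<subseteq> {a<..<b}"
    and *: "\<And>x d N. x \<in> E \<Longrightarrow> 0 < d \<Longrightarrow> \<exists>c e. c < e \<and> e - c < d \<and> x \<in> {c..e} \<and> \<bar>g e - g c\<bar> \<ge> N * (e - c)"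
  shows "negligible E"
  unfolding negligible_outer_le
proof (intro allI impI)
  fix \<epsilon> :: real assume "\<epsilon> > 0"
  define N where "N = (\<bar>B\<bar> + 1) / \<epsilon>"
  have N: "N > 0" "N * \<epsilon> \<ge> B" using \<open>\<epsilon> > 0\<close> by (auto simp: N_def)
  define R where "R c e \<longleftrightarrow> {c..e} \<subseteq> {a..b} \<and> \<bar>g e - g c\<bar> \<ge> N * (e - c)" for c e
  show "\<exists>T. E \<subseteq> T \<and> T \<in> lmeasurable \<and> measure lebesgue T \<le> \<epsilon>"
  proof (rule Vitali_variation_null[where R = R])
    fix x d :: real assume x: "x \<in> E" and d: "0 < d"
    define d' where "d' = min d (min (x - a) (b - x))"
    have "d' > 0" using x E d by (auto simp: d'_def)
    from *[OF x this, of N] obtain c e where ce: "c < e" "e - c < d'" "x \<in> {c..e}" "\<bar>g e - g c\<bar> \<ge> N * (e - c)"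
      by blast
    then show "\<exists>c e. c < e \<and> e - c < d \<and> x \<in> {c..e} \<and> R c e"
      by (intro exI[of _ c] exI[of _ e]) (auto simp: R_def d'_def)
  next
    fix P assume P: "finite P" "P division_of (\<Union>P)"
      "\<And>K. K \<in> P \<Longrightarrow> Inf K < Sup K \<and> K = {Inf K..Sup K} \<and> R (Inf K) (Sup K)"
    have "\<Union>P \<subseteq> {a..b}" using P(3) unfolding R_def by (metis Sup_least)
    then obtain Q where Q: "P \<subseteq> Q" "Q division_of {a..b}"
      using partial_division_extend_interval[OF P(2), of a b] by (auto simp: cbox_interval)
    have "N * (\<Sum>K\<in>P. Sup K - Inf K) \<le> variation_sum g P"
      unfolding sum_distrib_left by (rule sum_mono) (use P(3) in \<open>auto simp: R_def\<close>)
    also have "\<dots> \<le> variation_sum g Q"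
      by (rule sum_mono2) (use Q division_ofD(1)[OF Q(2)] in auto)
    also have "\<dots> \<le> N * \<epsilon>" using B[OF Q(2)] N by simp
    finally show "(\<Sum>K\<in>P. Sup K - Inf K) \<le> \<epsilon>" using N by simp
  qed
qed

text \<open>Where the derivative fails, either the difference quotients are unbounded near x, or
  their lower and upper limits are separated by a rational q with room 1/(n+1) on both sides. In the
  second case g minus q times the identity has steep slopes of both signs around x; its variation is
  still bounded, so \<open>opposite_slopes_null\<close> applies, and there are only countably many
  pairs (q, n).\<close>

lemma bounded_variation_differentiable_ae:
  fixes g :: "real \<Rightarrow> real"
  assumes B: "\<And>D. D division_of {a..b} \<Longrightarrow> variation_sum g D \<le> B"
  shows "negligible {x \<in> {a..b}. \<not> g differentiable (at x)}"
proof (cases "a \<le> b")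
  case ab: True
  define slope where "slope x y = (g y - g x) / (y - x)" for x y
  define U where "U = {x \<in> {a<..<b}. \<forall>d>0. \<forall>N. \<exists>c e. c < e \<and> e - c < d \<and> x \<in> {c..e} \<and> \<bar>g e - g c\<bar> \<ge> N * (e - c)}"
  have U: "negligible U"
    by (rule unbounded_slopes_null[OF B]) (auto simp: U_def)
  define E where "E = (\<lambda>(q :: real, k :: real). {x \<in> {a<..<b}. \<forall>d>0.
     (\<exists>c e. c < e \<and> e - c < d \<and> x \<in> {c..e} \<and> g e - q * e - (g c - q * c) \<ge> k * (e - c)) \<and>
     (\<exists>c e. c < e \<and> e - c < d \<and> x \<in> {c..e} \<and> g e - q * e - (g c - q * c) \<le> - (k * (e - c)))})"
  have E: "negligible (E (q, k))" if "k > 0" for q k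
  proof (rule opposite_slopes_null)
    show "E (q, k) \<subseteq> {a..b}" by (auto simp: E_def)
    show "variation_sum (\<lambda>x. g x - q * x) D \<le> B + \<bar>q\<bar> * (b - a)" if D: "D division_of {a..b}" for D
    proof -
      have "variation_sum (\<lambda>x. g x - q * x) D \<le> (\<Sum>K\<in>D. \<bar>g (Sup K) - g (Inf K)\<bar> + \<bar>q\<bar> * (Sup K - Inf K))"
      proof (rule sum_mono)
        fix K assume "K \<in> D"
        then have "Inf K \<le> Sup K" by (rule division_interval[OF D])
        then have "\<bar>q * (Sup K - Inf K)\<bar> = \<bar>q\<bar> * (Sup K - Inf K)" by (simp add: abs_mult)
        moreover have "g (Sup K) - q * Sup K - (g (Inf K) - q * Inf K) = (g (Sup K) - g (Inf K)) - q * (Sup K - Inf K)"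
          by (simp add: algebra_simps)
        ultimately show "\<bar>g (Sup K) - q * Sup K - (g (Inf K) - q * Inf K)\<bar> \<le> \<bar>g (Sup K) - g (Inf K)\<bar> + \<bar>q\<bar> * (Sup K - Inf K)"
          using abs_triangle_ineq4[of "g (Sup K) - g (Inf K)" "q * (Sup K - Inf K)"] by simp
      qed
      also have "\<dots> = variation_sum g D + \<bar>q\<bar> * (b - a)"
        using division_telescope[OF ab D, of "\<lambda>x. x"] by (simp add: sum.distrib sum_distrib_left[symmetric])
      finally show ?thesis using B[OF D] by simp
    qed
  qed (use that in \<open>auto simp: E_def\<close>)
  have diff: "g differentiable (at x)"
    if x: "x \<in> {a<..<b}" "x \<notin> U" "\<And>q n. q \<in> \<rat> \<Longrightarrow> x \<notin> E (q, inverse (real (Suc n)))" for x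
  proof -
    \<comment> \<open>A difference quotient at x is the slope over an interval with x as an
      endpoint; this links \<open>slope\<close> to the interval conditions in \<open>U\<close> and
      \<open>E\<close>.\<close>
    have ce: "\<exists>c e. c < e \<and> e - c < d \<and> x \<in> {c..e} \<and> g e - q * e - (g c - q * c) = (slope x y - q) * (e - c) \<and>
         g e - g c = slope x y * (e - c)"
      if "y \<noteq> x" "\<bar>y - x\<bar> < d" for y d q
      using that
      by (intro exI[of _ "min x y"] exI[of _ "max x y"])
        (auto simp: slope_def min_def max_def field_simps)
    obtain d N where d: "d > 0"
      and nd: "\<not> (\<exists>c e. c < e \<and> e - c < d \<and> x \<in> {c..e} \<and> \<bar>g e - g c\<bar> \<ge> N * (e - c))"
      using x(1,2) unfolding U_def by blast
    have dN: "\<bar>g e - g c\<bar> < N * (e - c)" if "c < e" "e - c < d" "x \<in> {c..e}" for c e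
      using nd that not_le by blast
    have bound: "\<bar>slope x y\<bar> < N" if y: "y \<noteq> x" "\<bar>y - x\<bar> < d" for y
    proof -
      obtain c e where c: "c < e" "e - c < d" "x \<in> {c..e}" "g e - g c = slope x y * (e - c)"
        using ce[OF y] by blast
      from dN[OF c(1-3)] c(1) show ?thesis unfolding c(4) by (simp add: abs_mult)
    qed
    \<comment> \<open>The eventual lower bounds of the difference quotient: \<open>Sup S\<close> is
      its lower limit, and the only candidate for the derivative.\<close>
    define S where "S = {r. \<forall>\<^sub>F y in at x. r \<le> slope x y}"
    have ev: "\<forall>\<^sub>F y in at x. \<bar>y - x\<bar> < d' \<and> y \<noteq> x" if "d' > 0" for d'
      using that by (auto simp: eventually_at dist_real_def)
    have "- N \<in> S"
      using eventually_mono[OF ev[OF d], of "\<lambda>y. - N \<le> slope x y"] bound unfolding S_def by fastforce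
    moreover have Sle: "r \<le> N" if "r \<in> S" for r
    proof -
      have "\<forall>\<^sub>F y in at x. r \<le> slope x y \<and> \<bar>y - x\<bar> < d \<and> y \<noteq> x"
        using that ev[OF d] by (auto simp: S_def eventually_conj_iff)
      then obtain y where "r \<le> slope x y" "\<bar>y - x\<bar> < d" "y \<noteq> x"
        using eventually_happens'[OF at_neq_bot] by blast
      then show ?thesis using bound[of y] by linarith
    qed
    ultimately have S: "S \<noteq> {}" "bdd_above S" by (auto simp: bdd_above_def)
    have "((\<lambda>y. slope x y) \<longlongrightarrow> Sup S) (at x)"
    proof (rule order_tendstoI)
      fix l assume "l < Sup S"
      then obtain r where "r \<in> S" "l < r" using less_cSup_iff[OF S] by auto
      then show "\<forall>\<^sub>F y in at x. l < slope x y" unfolding S_def by (auto elim: eventually_mono)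
    next
      fix u assume "Sup S < u"
      show "\<forall>\<^sub>F y in at x. slope x y < u"
      proof (rule ccontr)
        assume "\<not> (\<forall>\<^sub>F y in at x. slope x y < u)"
        then have fu: "\<exists>\<^sub>F y in at x. u \<le> slope x y" by (simp add: frequently_def not_le)
        \<comment> \<open>As q0 exceeds the lower limit, slopes below q0 recur arbitrarily near x,
          and so do slopes of at least u; a rational q strictly between the two puts x into a set
          \<open>E\<close>.\<close>
        obtain q0 where q0: "Sup S < q0" "q0 < u" using dense[OF \<open>Sup S < u\<close>] by blast
        then have "q0 \<notin> S" using cSup_upper[OF _ S(2), of q0] by auto
        then have fl: "\<exists>\<^sub>F y in at x. slope x y < q0" by (simp add: S_def frequently_def not_less)
        obtain q where q: "q \<in> \<rat>" "q0 < q" "q < u" using Rats_dense_in_real[OF q0(2)] by blast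
        obtain n where n: "inverse (real (Suc n)) < min (q - q0) (u - q)"
          using reals_Archimedean[of "min (q - q0) (u - q)"] q by auto
        have "x \<in> E (q, inverse (real (Suc n)))"
          unfolding E_def case_prod_conv
        proof (intro CollectI conjI allI impI)
          show "x \<in> {a<..<b}" by (fact x(1))
          fix d' :: real assume "d' > 0"
          obtain y where y: "u \<le> slope x y" "\<bar>y - x\<bar> < d'" "y \<noteq> x"
            using frequently_eventually_frequently[OF fu ev[OF \<open>d' > 0\<close>]] by (auto dest: frequently_ex)
          from ce[OF y(3,2), of q] obtain c e where c: "c < e" "e - c < d'" "x \<in> {c..e}"
            "g e - q * e - (g c - q * c) = (slope x y - q) * (e - c)" by blast
          have "inverse (real (Suc n)) * (e - c) \<le> (slope x y - q) * (e - c)"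
            using c(1) n y(1) by (intro mult_right_mono) auto
          then show "\<exists>c e. c < e \<and> e - c < d' \<and> x \<in> {c..e} \<and> inverse (real (Suc n)) * (e - c) \<le> g e - q * e - (g c - q * c)"
            using c by metis
          obtain y where y: "slope x y < q0" "\<bar>y - x\<bar> < d'" "y \<noteq> x"
            using frequently_eventually_frequently[OF fl ev[OF \<open>d' > 0\<close>]] by (auto dest: frequently_ex)
          from ce[OF y(3,2), of q] obtain c e where c: "c < e" "e - c < d'" "x \<in> {c..e}"
            "g e - q * e - (g c - q * c) = (slope x y - q) * (e - c)" by blast
          have "(slope x y - q) * (e - c) \<le> - inverse (real (Suc n)) * (e - c)"
            using c(1) n y(1) by (intro mult_right_mono) auto
          then show "\<exists>c e. c < e \<and> e - c < d' \<and> x \<in> {c..e} \<and> g e - q * e - (g c - q * c) \<le> - (inverse (real (Suc n)) * (e - c))"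
            using c by (metis mult_minus_left)
        qed
        with x(3)[OF q(1)] show False by blast
      qed
    qed
    then have "(g has_real_derivative Sup S) (at x)"
      by (simp add: has_field_derivative_iff slope_def)
    then show ?thesis by (auto simp: real_differentiable_def)
  qed
  \<comment> \<open>The endpoints are added because differentiability is two-sided and nothing is
    known about g outside \<open>{a..b}\<close>.\<close>
  have "negligible ({a, b} \<union> U \<union> (\<Union>qn\<in>\<rat> \<times> UNIV. E (fst qn, inverse (real (Suc (snd qn))))))"
  proof (intro negligible_Un U negligible_countable_Union)
    show "countable ((\<lambda>qn. E (fst qn, inverse (real (Suc (snd qn))))) ` (\<rat> \<times> UNIV))"
      by (intro countable_image countable_SIGMA countable_rat) auto
  qed (auto intro!: E)
  then show ?thesis
    by (rule negligible_subset) (use diff in force)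
qed simp

section \<open>Absolute continuity: closure properties, derivatives, integration\<close>

text \<open>Comparing the increments of g with those of f, instead of composing functions, covers
  coordinates of vector-valued functions, functions of time and position, and Lipschitz curves
  alike.\<close>

lemma abs_continuous_on_Lipschitz_compose:
  assumes f: "abs_continuous_on a b f"
    and L: "\<And>x y. x \<in> {a..b} \<Longrightarrow> y \<in> {a..b} \<Longrightarrow> norm (g x - g y) \<le> L * norm (f x - f y)"
  shows "abs_continuous_on a b g"
  unfolding abs_continuous_on_def
proof (intro allI impI)
  fix \<epsilon> :: real assume "\<epsilon> > 0"
  define M where "M = \<bar>L\<bar> + 1"
  have M: "M > 0" "L \<le> M" by (auto simp: M_def)
  from \<open>\<epsilon> > 0\<close> M(1) have "\<epsilon> / M > 0" by simp
  with f obtain \<delta> where \<delta>: "\<delta> > 0" "\<And>D S. D division_of S \<Longrightarrow> S \<subseteq> {a..b} \<Longrightarrow> (\<Sum>I\<in>D. Sup I - Inf I) < \<delta> \<Longrightarrow>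
        (\<Sum>I\<in>D. norm (f (Sup I) - f (Inf I))) < \<epsilon> / M"
    unfolding abs_continuous_on_def by metis
  show "\<exists>\<delta>>0. \<forall>D S. D division_of S \<and> S \<subseteq> {a..b} \<and> (\<Sum>I\<in>D. Sup I - Inf I) < \<delta> \<longrightarrow>
        (\<Sum>I\<in>D. norm (g (Sup I) - g (Inf I))) < \<epsilon>"
  proof (intro exI[of _ \<delta>] conjI allI impI \<delta>(1))
    fix D S assume D: "D division_of S \<and> S \<subseteq> {a..b} \<and> (\<Sum>I\<in>D. Sup I - Inf I) < \<delta>"
    have "(\<Sum>I\<in>D. norm (g (Sup I) - g (Inf I))) \<le> (\<Sum>I\<in>D. M * norm (f (Sup I) - f (Inf I)))"
    proof (rule sum_mono)
      fix I assume "I \<in> D"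
      then have *: "I = {Inf I..Sup I}" "Inf I \<le> Sup I" "I \<subseteq> {a..b}"
        using D division_interval[of D S I] by auto
      have "{Inf I..Sup I} \<subseteq> {a..b}" by (subst *(1)[symmetric]) (rule *(3))
      then have "Sup I \<in> {a..b}" "Inf I \<in> {a..b}" using *(2) by auto
      from L[OF this] show "norm (g (Sup I) - g (Inf I)) \<le> M * norm (f (Sup I) - f (Inf I))"
        by (rule order_trans) (use M in \<open>auto intro: mult_right_mono\<close>)
    qed
    also have "\<dots> < \<epsilon>"
      using \<delta>(2)[of D S] D M(1) by (simp add: sum_distrib_left[symmetric] field_simps)
    finally show "(\<Sum>I\<in>D. norm (g (Sup I) - g (Inf I))) < \<epsilon>" .
  qed
qed

lemma abs_continuous_on_Pair:
  assumes f: "abs_continuous_on a b f" and g: "abs_continuous_on a b g"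
  shows "abs_continuous_on a b (\<lambda>t. (f t, g t))"
  unfolding abs_continuous_on_def
proof (intro allI impI)
  fix \<epsilon> :: real assume "\<epsilon> > 0"
  then have e: "\<epsilon> / 2 > 0" by simp
  obtain \<delta>1 where \<delta>1: "\<delta>1 > 0" "\<And>D S. D division_of S \<Longrightarrow> S \<subseteq> {a..b} \<Longrightarrow> (\<Sum>I\<in>D. Sup I - Inf I) < \<delta>1 \<Longrightarrow>
        (\<Sum>I\<in>D. norm (f (Sup I) - f (Inf I))) < \<epsilon> / 2"
    using f[unfolded abs_continuous_on_def, THEN spec, THEN mp, OF e] by blast
  obtain \<delta>2 where \<delta>2: "\<delta>2 > 0" "\<And>D S. D division_of S \<Longrightarrow> S \<subseteq> {a..b} \<Longrightarrow> (\<Sum>I\<in>D. Sup I - Inf I) < \<delta>2 \<Longrightarrow>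
        (\<Sum>I\<in>D. norm (g (Sup I) - g (Inf I))) < \<epsilon> / 2"
    using g[unfolded abs_continuous_on_def, THEN spec, THEN mp, OF e] by blast
  show "\<exists>\<delta>>0. \<forall>D S. D division_of S \<and> S \<subseteq> {a..b} \<and> (\<Sum>I\<in>D. Sup I - Inf I) < \<delta> \<longrightarrow>
        (\<Sum>I\<in>D. norm ((f (Sup I), g (Sup I)) - (f (Inf I), g (Inf I)))) < \<epsilon>"
  proof (intro exI[of _ "min \<delta>1 \<delta>2"] conjI allI impI)
    show "0 < min \<delta>1 \<delta>2" using \<delta>1(1) \<delta>2(1) by simp
    fix D S assume D: "D division_of S \<and> S \<subseteq> {a..b} \<and> (\<Sum>I\<in>D. Sup I - Inf I) < min \<delta>1 \<delta>2"
    have "(\<Sum>I\<in>D. norm ((f (Sup I), g (Sup I)) - (f (Inf I), g (Inf I))))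
        \<le> (\<Sum>I\<in>D. norm (f (Sup I) - f (Inf I)) + norm (g (Sup I) - g (Inf I)))"
      by (intro sum_mono) (simp add: norm_Pair_le)
    also have "\<dots> < \<epsilon>" using \<delta>1(2)[of D S] \<delta>2(2)[of D S] D by (simp add: sum.distrib)
    finally show "(\<Sum>I\<in>D. norm ((f (Sup I), g (Sup I)) - (f (Inf I), g (Inf I)))) < \<epsilon>" .
  qed
qed

lemma abs_continuous_on_id: "abs_continuous_on a b (\<lambda>t::real. t)"
  unfolding abs_continuous_on_def
proof (intro allI impI)
  fix \<epsilon> :: real assume "\<epsilon> > 0"
  show "\<exists>\<delta>>0. \<forall>D S. D division_of S \<and> S \<subseteq> {a..b} \<and> (\<Sum>I\<in>D. Sup I - Inf I) < \<delta> \<longrightarrow>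
        (\<Sum>I\<in>D. norm (Sup I - Inf I)) < \<epsilon>"
  proof (intro exI[of _ \<epsilon>] conjI allI impI \<open>\<epsilon> > 0\<close>)
    fix D S assume D: "D division_of S \<and> S \<subseteq> {a..b} \<and> (\<Sum>I\<in>D. Sup I - Inf I) < \<epsilon>"
    have "(\<Sum>I\<in>D. norm (Sup I - Inf I)) = (\<Sum>I\<in>D. Sup I - Inf I)"
    proof (rule sum.cong[OF refl])
      fix I assume "I \<in> D"
      then show "norm (Sup I - Inf I) = Sup I - Inf I"
        using D division_interval(2)[of D S I] by simp
    qed
    then show "(\<Sum>I\<in>D. norm (Sup I - Inf I)) < \<epsilon>" using D by simp
  qed
qed

lemma abs_continuous_on_Lipschitz:
  fixes g :: "real \<Rightarrow> 'a::real_normed_vector"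
  assumes "\<And>x y. x \<in> {a..b} \<Longrightarrow> y \<in> {a..b} \<Longrightarrow> norm (g x - g y) \<le> L * \<bar>x - y\<bar>"
  shows "abs_continuous_on a b g"
  by (rule abs_continuous_on_Lipschitz_compose[OF abs_continuous_on_id, of _ _ _ L]) (use assms in auto)

text \<open>Absolute continuity bounds the variation by 1 only on intervals shorter than some
  \<delta>; the bisection principle chains these together. Clipping with \<open>max\<close> and
  \<open>min\<close> makes P meaningful for intervals that stick out of
  \<open>{a..b}\<close>.\<close>

lemma abs_continuous_on_real_differentiable_ae:
  fixes f :: "real \<Rightarrow> real"
  assumes f: "abs_continuous_on a b f"
  shows "negligible {x \<in> {a..b}. \<not> f differentiable (at x)}"
proof (cases "a \<le> b")
  case True
  define P where "P c d \<longleftrightarrow> negligible ({x. \<not> f differentiable (at x)} \<inter> {max a c..min b d})" for c d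
  from f obtain \<delta> where \<delta>: "\<delta> > 0" "\<And>D S. D division_of S \<Longrightarrow> S \<subseteq> {a..b} \<Longrightarrow> (\<Sum>I\<in>D. Sup I - Inf I) < \<delta> \<Longrightarrow>
        (\<Sum>I\<in>D. norm (f (Sup I) - f (Inf I))) < 1"
    unfolding abs_continuous_on_def by (metis zero_less_one)
  have "P a b"
    using True
  proof (induction a b rule: Bolzano)
    case (trans c d e)
    then have "negligible ({x. \<not> f differentiable (at x)} \<inter> {max a c..min b d} \<union>
        {x. \<not> f differentiable (at x)} \<inter> {max a d..min b e})"
      unfolding P_def by (intro negligible_Un)
    then show ?case unfolding P_def by (rule negligible_subset) auto
  next
    case (local x)
    show ?case
    proof (intro exI[of _ \<delta>] conjI allI impI \<delta>(1))
      fix c d assume cd: "c \<le> x \<and> x \<le> d \<and> d - c < \<delta>"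
      have "negligible {y \<in> {max a c..min b d}. \<not> f differentiable (at y)}"
      proof (cases "max a c \<le> min b d")
        case True
        show ?thesis
        proof (rule bounded_variation_differentiable_ae)
          fix D assume D: "D division_of {max a c..min b d}"
          have "(\<Sum>I\<in>D. Sup I - Inf I) = min b d - max a c"
            by (rule division_telescope[OF True D])
          then have "variation_sum f D < 1" using \<delta>(2)[OF D] cd by auto
          then show "variation_sum f D \<le> 1" by simp
        qed
      qed simp
      then show "P c d" unfolding P_def by (rule negligible_subset) auto
    qed
  qed
  then show ?thesis unfolding P_def by (rule negligible_subset) auto
qed simp

lemma abs_continuous_on_differentiable_ae:
  fixes f :: "real \<Rightarrow> 'a::euclidean_space"
  assumes f: "abs_continuous_on a b f"
  shows "negligible {x \<in> {a..b}. \<not> f differentiable (at x)}"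
proof -
  have neg: "negligible {x \<in> {a..b}. \<not> (\<lambda>x. f x \<bullet> i) differentiable (at x)}" if i: "i \<in> Basis" for i
  proof (rule abs_continuous_on_real_differentiable_ae)
    show "abs_continuous_on a b (\<lambda>x. f x \<bullet> i)"
    proof (rule abs_continuous_on_Lipschitz_compose[OF f])
      fix x y
      show "norm (f x \<bullet> i - f y \<bullet> i) \<le> 1 * norm (f x - f y)"
        using Basis_le_norm[OF i, of "f x - f y"] by (simp add: inner_diff_left)
    qed
  qed
  have "negligible (\<Union>i\<in>Basis. {x \<in> {a..b}. \<not> (\<lambda>x. f x \<bullet> i) differentiable (at x)})"
  proof (rule negligible_countable_Union)
    show "countable ((\<lambda>i. {x \<in> {a..b}. \<not> (\<lambda>x. f x \<bullet> i) differentiable (at x)}) ` (Basis :: 'a set))"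
      by (simp add: countable_finite)
    show "negligible Z" if "Z \<in> (\<lambda>i. {x \<in> {a..b}. \<not> (\<lambda>x. f x \<bullet> i) differentiable (at x)}) ` (Basis :: 'a set)" for Z
      using that by (elim imageE) (simp only: neg)
  qed
  then show ?thesis
    by (rule negligible_subset) (auto simp: differentiable_componentwise_within[of f])
qed

text \<open>Gauge Riemann sums suit an h that is only integrable. At tags outside N the gauge makes
  the increment of G at most h t + \<epsilon> times the length. At tags in N it confines the
  intervals to an open set of measure below \<delta>, where absolute continuity keeps the sum of all
  increments below \<epsilon>.\<close>

lemma abs_continuous_on_derivative_le_imp:
  fixes G h :: "real \<Rightarrow> real"
  assumes ab: "a \<le> b" and G: "abs_continuous_on a b G" and h: "h integrable_on {a..b}"
    and N: "negligible N"
    and le: "\<And>t. t \<in> {a..b} - N \<Longrightarrow> \<exists>D. (G has_real_derivative D) (at t) \<and> D \<le> h t"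
  shows "G b - G a \<le> integral {a..b} h"
proof (rule field_le_epsilon)
  fix \<epsilon>' :: real assume "\<epsilon>' > 0"
  \<comment> \<open>Three errors have to be absorbed: \<epsilon> * (b - a) from the derivatives, one
    \<epsilon> from the Riemann sum and one from the intervals tagged in N.\<close>
  define \<epsilon> where "\<epsilon> = \<epsilon>' / (b - a + 2)"
  have \<epsilon>: "\<epsilon> > 0" "\<epsilon> * (b - a + 2) = \<epsilon>'" using ab \<open>\<epsilon>' > 0\<close> by (auto simp: \<epsilon>_def)
  \<comment> \<open>Setting h to 0 on N keeps the integral and removes the bad tags from the Riemann
    sum.\<close>
  define h' where "h' t = (if t \<in> N then 0 else h t)" for t
  have hI: "(h' has_integral integral {a..b} h) {a..b}"
    by (rule has_integral_spike[OF N _ integrable_integral[OF h]]) (auto simp: h'_def)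
  obtain \<gamma>1 where g1: "gauge \<gamma>1 \<and> (\<forall>p. p tagged_division_of {a..b} \<and> \<gamma>1 fine p \<longrightarrow>
      norm ((\<Sum>(x,k)\<in>p. measure lborel k *\<^sub>R h' x) - integral {a..b} h) < \<epsilon>)"
    using hI[unfolded has_integral_real, THEN spec, THEN mp, OF \<epsilon>(1)] by (rule exE)
  have \<gamma>1: "gauge \<gamma>1" by (rule conjunct1[OF g1])
  have \<gamma>1_fine: "norm ((\<Sum>(x,k)\<in>p. measure lborel k *\<^sub>R h' x) - integral {a..b} h) < \<epsilon>"
    if "p tagged_division_of {a..b}" "\<gamma>1 fine p" for p
    using conjunct2[OF g1, THEN spec, THEN mp, OF conjI] that .
  from G \<epsilon>(1) obtain \<delta> where \<delta>: "\<delta> > 0" "\<And>D S. D division_of S \<Longrightarrow> S \<subseteq> {a..b} \<Longrightarrow> (\<Sum>I\<in>D. Sup I - Inf I) < \<delta> \<Longrightarrow>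
        (\<Sum>I\<in>D. norm (G (Sup I) - G (Inf I))) < \<epsilon>"
    unfolding abs_continuous_on_def by metis
  have Nm: "N \<in> lmeasurable" "measure lebesgue N = 0"
    using N by (auto intro: negligible_imp_measurable negligible_imp_measure0)
  then have "N \<in> sets lebesgue" by (intro fmeasurableD)
  then obtain U where U: "open U" "N \<subseteq> U" "U - N \<in> lmeasurable" "emeasure lebesgue (U - N) < ennreal \<delta>"
    using sets_lebesgue_outer_open[OF _ \<delta>(1)] by blast
  have Ueq: "(U - N) \<union> N = U" using U(2) by blast
  have Um: "U \<in> lmeasurable" "measure lebesgue U \<le> measure lebesgue (U - N)"
    using fmeasurable.Un[OF U(3) Nm(1)] measure_Un_le[OF fmeasurableD[OF U(3)] fmeasurableD[OF Nm(1)]]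
    unfolding Ueq Nm(2) by simp_all
  have "measure lebesgue (U - N) < \<delta>"
    using U(3,4) \<delta>(1) by (simp add: emeasure_eq_measure2 ennreal_less_iff)
  then have U\<delta>: "measure lebesgue U < \<delta>" using Um(2) by simp
  have "\<exists>r>0. \<forall>y. \<bar>y - t\<bar> < r \<longrightarrow> (t \<le> y \<longrightarrow> G y - G t \<le> (h t + \<epsilon>) * (y - t)) \<and> (y \<le> t \<longrightarrow> G t - G y \<le> (h t + \<epsilon>) * (t - y))"
    if t: "t \<in> {a..b} - N" for t
  proof -
    obtain D where D: "(G has_real_derivative D) (at t)" "D \<le> h t" using le[OF t] by blast
    from D(1)[unfolded has_field_derivative_def has_derivative_at_alt] \<epsilon>(1)
    obtain r where r: "r > 0" "\<And>y. \<bar>y - t\<bar> < r \<Longrightarrow> \<bar>G y - G t - D * (y - t)\<bar> \<le> \<epsilon> * \<bar>y - t\<bar>"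
      by (auto simp: real_norm_def)
    show ?thesis
    proof (intro exI[of _ r] conjI allI impI r(1))
      fix y assume y: "\<bar>y - t\<bar> < r"
      { assume "t \<le> y"
        then have "D * (y - t) \<le> h t * (y - t)" using D(2) by (intro mult_right_mono) auto
        then show "G y - G t \<le> (h t + \<epsilon>) * (y - t)" using r(2)[OF y] \<open>t \<le> y\<close> by (simp add: distrib_right) }
      { assume "y \<le> t"
        then have "D * (t - y) \<le> h t * (t - y)" using D(2) by (intro mult_right_mono) auto
        moreover have "D * (y - t) = - (D * (t - y))" by (simp add: algebra_simps)
        ultimately show "G t - G y \<le> (h t + \<epsilon>) * (t - y)" using r(2)[OF y] \<open>y \<le> t\<close> by (simp add: distrib_right) }
    qed
  qed
  then obtain r where r: "\<And>t. t \<in> {a..b} - N \<Longrightarrow> r t > 0"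
    "\<And>t y. t \<in> {a..b} - N \<Longrightarrow> \<bar>y - t\<bar> < r t \<Longrightarrow> t \<le> y \<Longrightarrow> G y - G t \<le> (h t + \<epsilon>) * (y - t)"
    "\<And>t y. t \<in> {a..b} - N \<Longrightarrow> \<bar>y - t\<bar> < r t \<Longrightarrow> y \<le> t \<Longrightarrow> G t - G y \<le> (h t + \<epsilon>) * (t - y)"
    by metis
  define \<gamma>2 where "\<gamma>2 t = (if t \<in> N then U else if t \<in> {a..b} then ball t (r t) else UNIV)" for t
  have "gauge \<gamma>2" unfolding gauge_def \<gamma>2_def using U r(1) by auto
  then obtain p where p: "p tagged_division_of {a..b}" "(\<lambda>x. \<gamma>1 x \<inter> \<gamma>2 x) fine p"
    using fine_division_exists_real[of "\<lambda>x. \<gamma>1 x \<inter> \<gamma>2 x"] gauge_Int[OF \<gamma>1] by metis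
  then have fine: "\<gamma>1 fine p" "\<gamma>2 fine p" by (auto simp: fine_Int)
  note p' = tagged_division_ofD[OF p(1)]
  have pc: "\<exists>u v. K = {u..v} \<and> u \<le> x \<and> x \<le> v \<and> x \<in> {a..b} \<and> K \<subseteq> \<gamma>2 x" if "(x, K) \<in> p" for x K
    using p'(2,3,4)[OF that] fine(2) that by (fastforce simp: fine_def)
  define pN where "pN = {(x, K) \<in> p. x \<in> N}"
  have "pN \<subseteq> p" by (auto simp: pN_def)
  then have pN: "pN tagged_partial_division_of {a..b}"
    using p(1) tagged_partial_division_subset unfolding tagged_division_of_def by blast
  have dN: "snd ` pN division_of \<Union>(snd ` pN)"
    by (rule partial_division_of_tagged_division[OF pN])
  have sub: "\<Union>(snd ` pN) \<subseteq> {a..b} \<inter> U"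
    using p'(3) fine(2) by (fastforce simp: pN_def fine_def \<gamma>2_def)
  have "(\<Sum>K\<in>snd ` pN. Sup K - Inf K) = (\<Sum>K\<in>snd ` pN. measure lebesgue K)"
  proof (rule sum.cong[OF refl])
    fix K assume "K \<in> snd ` pN"
    then have "K = {Inf K..Sup K}" "Inf K \<le> Sup K" using division_interval[OF dN] by auto
    then show "Sup K - Inf K = measure lebesgue K" by (metis measure_lborel_Icc measure_completion sets_lborel borel_closed closed_atLeastAtMost)
  qed
  also have "\<dots> = measure lebesgue (\<Union>(snd ` pN))"
    using content_division[OF dN] by simp
  also have "\<dots> \<le> measure lebesgue U"
    using sub Um(1) dN by (intro measure_mono_fmeasurable) (auto intro: fmeasurableD lmeasurable_division)
  finally have len: "(\<Sum>K\<in>snd ` pN. Sup K - Inf K) < \<delta>" using U\<delta> by simp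
  \<comment> \<open>Passing from tags to the underlying division needs a summand that vanishes on
    all boxes without interior, the empty one included, where \<open>Sup\<close> and
    \<open>Inf\<close> carry no information; hence the case distinction.\<close>
  have "(\<Sum>(x, K)\<in>pN. G (Sup K) - G (Inf K)) \<le> (\<Sum>(x, K)\<in>pN. if K = {} then 0 else \<bar>G (Sup K) - G (Inf K)\<bar>)"
    using pc by (intro sum_mono) (fastforce simp: pN_def)
  also have "\<dots> = (\<Sum>K\<in>snd ` pN. if K = {} then 0 else \<bar>G (Sup K) - G (Inf K)\<bar>)"
  proof (rule sum.over_tagged_division_lemma[OF tagged_partial_division_of_Union_self[OF pN]])
    fix u v :: real assume "box u v = {}"
    then have "v \<le> u" by simp
    then show "(if cbox u v = {} then 0 else \<bar>G (Sup (cbox u v)) - G (Inf (cbox u v))\<bar>) = 0"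
      by (cases "u = v") auto
  qed
  also have "\<dots> \<le> variation_sum G (snd ` pN)"
    by (intro sum_mono) auto
  also have "\<dots> < \<epsilon>" using \<delta>(2)[OF dN _ len] sub by auto
  finally have 1: "(\<Sum>(x, K)\<in>pN. G (Sup K) - G (Inf K)) \<le> \<epsilon>" by simp
  have 2: "(\<Sum>(x, K)\<in>p - pN. G (Sup K) - G (Inf K)) \<le> (\<Sum>(x, K)\<in>p - pN. measure lborel K *\<^sub>R h' x + \<epsilon> * measure lborel K)"
  proof (rule sum_mono, clarify)
    fix x K assume xK: "(x, K) \<in> p" "(x, K) \<notin> pN"
    then have x: "x \<notin> N" by (auto simp: pN_def)
    obtain u v where uv: "K = {u..v}" "u \<le> x" "x \<le> v" "x \<in> {a..b}" "K \<subseteq> \<gamma>2 x" using pc[OF xK(1)] by blast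
    then have "\<bar>x - t\<bar> < r x" if "t \<in> {u..v}" for t
      using x that by (auto simp: \<gamma>2_def subset_iff dist_real_def)
    from this[of u] this[of v] uv(2,3) have "\<bar>u - x\<bar> < r x" "\<bar>v - x\<bar> < r x" by auto
    then have "G v - G x \<le> (h x + \<epsilon>) * (v - x)" "G x - G u \<le> (h x + \<epsilon>) * (x - u)"
      using r(2,3)[of x] uv x by auto
    then have "G v - G u \<le> (h x + \<epsilon>) * (v - u)" by (simp add: algebra_simps)
    then show "G (Sup K) - G (Inf K) \<le> measure lborel K *\<^sub>R h' x + \<epsilon> * measure lborel K"
      using uv x by (simp add: h'_def algebra_simps)
  qed
  have 3: "(\<Sum>(x, K)\<in>p - pN. measure lborel K *\<^sub>R h' x + \<epsilon> * measure lborel K) \<le> (\<Sum>(x, K)\<in>p. measure lborel K *\<^sub>R h' x + \<epsilon> * measure lborel K)"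
    by (rule sum_mono2) (use p'(1) \<epsilon>(1) in \<open>auto simp: pN_def h'_def\<close>)
  have "(\<Sum>(x, K)\<in>p. measure lborel K *\<^sub>R h' x + \<epsilon> * measure lborel K) = (\<Sum>(x, K)\<in>p. measure lborel K *\<^sub>R h' x) + \<epsilon> * (\<Sum>(x, K)\<in>p. measure lborel K)"
    by (simp add: sum.distrib sum_distrib_left case_prod_unfold)
  also have "(\<Sum>(x, K)\<in>p. measure lborel K) = b - a"
    using additive_content_tagged_division[of p a b] p(1) ab by simp
  also have "(\<Sum>(x, K)\<in>p. measure lborel K *\<^sub>R h' x) \<le> integral {a..b} h + \<epsilon>"
    using \<gamma>1_fine[OF p(1) fine(1)] by (simp add: abs_less_iff)
  finally have 4: "(\<Sum>(x, K)\<in>p. measure lborel K *\<^sub>R h' x + \<epsilon> * measure lborel K) \<le> integral {a..b} h + \<epsilon> + \<epsilon> * (b - a)"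
    by simp
  have "G b - G a = (\<Sum>(x, K)\<in>p. G (Sup K) - G (Inf K))"
    by (rule additive_tagged_division_1[OF ab p(1), symmetric])
  also have "\<dots> = (\<Sum>(x, K)\<in>p - pN. G (Sup K) - G (Inf K)) + (\<Sum>(x, K)\<in>pN. G (Sup K) - G (Inf K))"
    by (rule sum.subset_diff[OF \<open>pN \<subseteq> p\<close> p'(1)])
  also have "\<dots> \<le> integral {a..b} h + \<epsilon> * (b - a + 2)"
    using 1 2 3 4 by (simp add: algebra_simps)
  finally show "G b - G a \<le> integral {a..b} h + \<epsilon>'" using \<epsilon>(2) by simp
qed

section \<open>Coordinates on a closed manifold\<close>

text \<open>The gradient for the Euclidean inner product of the coordinate space. For a function
  read in a chart it is the coordinate vector of the differential, as \<open>differential_eq\<close>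
  says.\<close>

definition grad :: "('e::euclidean_space \<Rightarrow> real) \<Rightarrow> 'e \<Rightarrow> 'e" where
  "grad f y = (\<Sum>b\<in>Basis. frechet_derivative f (at y) b *\<^sub>R b)"

lemma grad_eq:
  assumes "(f has_derivative D) (at y)"
  shows "D h = grad f y \<bullet> h"
proof -
  interpret bounded_linear D using assms by (rule has_derivative_bounded_linear)
  have "D h = D (\<Sum>b\<in>Basis. (h \<bullet> b) *\<^sub>R b)" by (simp add: euclidean_representation)
  also have "\<dots> = grad f y \<bullet> h"
    by (simp add: sum scaleR grad_def frechet_derivative_at[OF assms, symmetric] inner_sum_left inner_sum_right inner_commute mult.commute)
  finally show ?thesis .
qed

lemma grad_unique:
  assumes "(f has_derivative (\<lambda>h. q \<bullet> h)) (at y)"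
  shows "grad f y = q"
  using grad_eq[OF assms] by (metis inner_commute vector_eq_ldot)

lemma has_derivative_grad:
  assumes "f differentiable (at y)"
  shows "(f has_derivative (\<lambda>h. grad f y \<bullet> h)) (at y)"
proof -
  obtain D where D: "(f has_derivative D) (at y)" using assms by (auto simp: differentiable_def)
  with grad_eq[OF D] show ?thesis by (metis (no_types, lifting) ext)
qed

lemma Cn_on_grad: "Cn_on (Suc n) S f \<Longrightarrow> open S \<Longrightarrow> Cn_on n S (grad f)"
  unfolding grad_def[abs_def] by (intro Cn_on_sum Cn_on_scaleR) auto

lemma continuous_on_grad: "Cn_on 1 S f \<Longrightarrow> open S \<Longrightarrow> continuous_on S (grad f)"
  using Cn_on_grad[of 0 S f] by simp

locale manifold =
  fixes A :: "('m::t2_space, 'e::euclidean_space) chart set"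
  assumes manifold: "closed_manifold A"
begin

abbreviation crange :: "('m, 'e) chart \<Rightarrow> 'e set" where
  "crange c \<equiv> cmap c ` cdom c"

abbreviation transition :: "('m, 'e) chart \<Rightarrow> ('m, 'e) chart \<Rightarrow> 'e \<Rightarrow> 'e" where
  "transition c d \<equiv> cmap d \<circ> cinv c"

abbreviation Dtrans :: "('m, 'e) chart \<Rightarrow> ('m, 'e) chart \<Rightarrow> 'm \<Rightarrow> 'e \<Rightarrow> 'e" where
  "Dtrans c d x \<equiv> frechet_derivative (transition c d) (at (cmap c x))"

lemma compact_UNIV: "compact (UNIV :: 'm set)"
  using manifold by (simp add: closed_manifold_def)

lemma chart_homeomorphism: "c \<in> A \<Longrightarrow> homeomorphism (cdom c) (crange c) (cmap c) (cinv c)"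
  and open_cdom: "c \<in> A \<Longrightarrow> open (cdom c)"
  and open_crange: "c \<in> A \<Longrightarrow> open (crange c)"
  and transition_C_on: "c \<in> A \<Longrightarrow> d \<in> A \<Longrightarrow> C_on \<infinity> (cmap c ` (cdom c \<inter> cdom d)) (transition c d)"
  using manifold by (auto simp: closed_manifold_def smooth_atlas_def)

lemma ex_chart: "\<exists>c\<in>A. x \<in> cdom c"
  using manifold by (auto simp: closed_manifold_def smooth_atlas_def)

lemma cinv_cmap: "c \<in> A \<Longrightarrow> x \<in> cdom c \<Longrightarrow> cinv c (cmap c x) = x"
  using chart_homeomorphism by (simp add: homeomorphism_def)

lemma cmap_cinv: "c \<in> A \<Longrightarrow> y \<in> crange c \<Longrightarrow> cmap c (cinv c y) = y"
  by (auto simp: cinv_cmap)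

lemma cinv_in: "c \<in> A \<Longrightarrow> y \<in> crange c \<Longrightarrow> cinv c y \<in> cdom c"
  by (auto simp: cinv_cmap)

lemma continuous_on_cinv: "c \<in> A \<Longrightarrow> continuous_on (crange c) (cinv c)"
  and continuous_on_cmap: "c \<in> A \<Longrightarrow> continuous_on (cdom c) (cmap c)"
  using chart_homeomorphism by (auto simp: homeomorphism_def)

lemma open_cmap_image:
  assumes "c \<in> A" "open W"
  shows "open (cmap c ` (cdom c \<inter> W))"
proof -
  have "openin (top_of_set (crange c)) (cmap c ` (cdom c \<inter> W))"
    by (rule homeomorphism_imp_open_map[OF chart_homeomorphism[OF assms(1)]])
      (use assms(2) in \<open>auto simp: openin_open\<close>)
  then show ?thesis using open_crange[OF assms(1)] by (simp add: openin_open_eq)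
qed

lemma transition_Cn_on: "c \<in> A \<Longrightarrow> d \<in> A \<Longrightarrow> Cn_on n (cmap c ` (cdom c \<inter> cdom d)) (transition c d)"
  using transition_C_on by (simp add: C_on_infinity)

lemma transition_has_derivative:
  assumes "c \<in> A" "d \<in> A" "x \<in> cdom c" "x \<in> cdom d"
  shows "(transition c d has_derivative Dtrans c d x) (at (cmap c x))"
  by (rule Cn_on_has_derivative[OF transition_Cn_on[OF assms(1,2), of 1]]) (use assms in auto)

lemma Dtrans_linear:
  assumes "c \<in> A" "d \<in> A" "x \<in> cdom c" "x \<in> cdom d"
  shows "bounded_linear (Dtrans c d x)"
  using transition_has_derivative[OF assms] by (rule has_derivative_bounded_linear)

text \<open>The chain rule on the common part of three charts; it makes the coordinates produced by
  \<open>tangent_of\<close> consistent from chart to chart.\<close>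

lemma Dtrans_cocycle:
  assumes c: "c \<in> A" "x \<in> cdom c" and d: "d \<in> A" "x \<in> cdom d" and e: "e \<in> A" "x \<in> cdom e"
  shows "Dtrans d e x (Dtrans c d x v) = Dtrans c e x v"
proof -
  have dx: "transition c d (cmap c x) = cmap d x" using c by (simp add: cinv_cmap)
  have "(transition d e has_derivative Dtrans d e x) (at (transition c d (cmap c x)))"
    unfolding dx by (rule transition_has_derivative) (use d e in auto)
  from has_derivative_compose[OF transition_has_derivative[OF c(1) d(1) c(2) d(2)] this]
  have "((\<lambda>y. transition d e (transition c d y)) has_derivative (\<lambda>v. Dtrans d e x (Dtrans c d x v))) (at (cmap c x))" .
  then have "(transition c e has_derivative (\<lambda>v. Dtrans d e x (Dtrans c d x v))) (at (cmap c x))"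
  proof (rule has_derivative_transform_within_open[where s = "cmap c ` (cdom c \<inter> (cdom d \<inter> cdom e))"])
    show "open (cmap c ` (cdom c \<inter> (cdom d \<inter> cdom e)))"
      using c d e by (intro open_cmap_image open_Int open_cdom)
  qed (use c d e in \<open>auto simp: cinv_cmap\<close>)
  from frechet_derivative_at[OF this] show ?thesis by metis
qed

lemma Dtrans_same:
  assumes "c \<in> A" "x \<in> cdom c"
  shows "Dtrans c c x v = v"
proof -
  have "((\<lambda>y. y) has_derivative (\<lambda>v. v)) (at (cmap c x))" by simp
  then have "(transition c c has_derivative (\<lambda>v. v)) (at (cmap c x))"
    by (rule has_derivative_transform_within_open[where s = "crange c"])
      (use assms in \<open>auto simp: open_crange cinv_cmap\<close>)
  from frechet_derivative_at[OF this] show ?thesis by metis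
qed

lemma tangent_of_apply: "d \<in> A \<Longrightarrow> x \<in> cdom d \<Longrightarrow> tangent_of A c x v d = Dtrans c d x v"
  by (simp add: tangent_of_def)

lemma tangent_of_in:
  assumes "c \<in> A" "x \<in> cdom c"
  shows "tangent_of A c x v \<in> tangent_space A x"
  using assms by (auto simp: tangent_space_def tangent_of_def Dtrans_cocycle)

lemma tangent_of_same: "c \<in> A \<Longrightarrow> x \<in> cdom c \<Longrightarrow> tangent_of A c x v c = v"
  by (simp add: tangent_of_apply Dtrans_same)

lemma tangent_space_eq:
  assumes "c \<in> A" "x \<in> cdom c" "v \<in> tangent_space A x"
  shows "tangent_of A c x (v c) = v"
proof
  fix d
  show "tangent_of A c x (v c) d = v d"
  proof (cases "d \<in> A \<and> x \<in> cdom d")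
    case True
    then have "v d = Dtrans c d x (v c)" using assms unfolding tangent_space_def by blast
    with True show ?thesis by (simp add: tangent_of_def)
  next
    case False
    then have "v d = 0" using assms(3) unfolding tangent_space_def by blast
    with False show ?thesis by (auto simp: tangent_of_def)
  qed
qed

lemma tangent_of_linear:
  assumes "c \<in> A" "x \<in> cdom c"
  shows "tangent_of A c x (a *\<^sub>R v + b *\<^sub>R w) = (\<lambda>d. a *\<^sub>R tangent_of A c x v d + b *\<^sub>R tangent_of A c x w d)"
proof
  fix d
  show "tangent_of A c x (a *\<^sub>R v + b *\<^sub>R w) d = a *\<^sub>R tangent_of A c x v d + b *\<^sub>R tangent_of A c x w d"
  proof (cases "d \<in> A \<and> x \<in> cdom d")
    case True
    then interpret bounded_linear "Dtrans c d x" using Dtrans_linear assms by blast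
    show ?thesis using True by (simp add: tangent_of_def add scaleR)
  qed (auto simp: tangent_of_def)
qed

lemma cotangent_of_tangent_of:
  assumes "c \<in> A" "x \<in> cdom c"
  shows "cotangent_of A c x q (tangent_of A c x v) = q \<bullet> v"
  using assms by (simp add: cotangent_of_def tangent_of_in tangent_of_same)

lemma tangent_space_lin:
  assumes "v \<in> tangent_space A x" "w \<in> tangent_space A x"
  shows "(\<lambda>c. a *\<^sub>R v c + b *\<^sub>R w c) \<in> tangent_space A x"
proof -
  obtain c where c: "c \<in> A" "x \<in> cdom c" using ex_chart by blast
  have "(\<lambda>d. a *\<^sub>R v d + b *\<^sub>R w d) = tangent_of A c x (a *\<^sub>R v c + b *\<^sub>R w c)"
    using assms by (simp add: tangent_of_linear c tangent_space_eq)
  then show ?thesis by (simp add: tangent_of_in c)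
qed

lemma cotangent_of_in: "cotangent_of A c x q \<in> cotangent_space A x"
  by (auto simp: cotangent_space_def cotangent_of_def tangent_space_lin inner_add_right)

lemma cotangent_eqI:
  assumes "c \<in> A" "x \<in> cdom c" "\<And>v. v \<notin> tangent_space A x \<Longrightarrow> p v = 0"
    and "\<And>e. p (tangent_of A c x e) = q \<bullet> e"
  shows "p = cotangent_of A c x q"
proof
  fix v show "p v = cotangent_of A c x q v"
    using assms(3)[of v] assms(4)[of "v c"] tangent_space_eq[OF assms(1,2), of v]
    by (auto simp: cotangent_of_def)
qed

lemma cotangent_space_eq:
  assumes c: "c \<in> A" "x \<in> cdom c" and p: "p \<in> cotangent_space A x"
  shows "p = cotangent_of A c x (\<Sum>b\<in>Basis. p (tangent_of A c x b) *\<^sub>R b)"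
proof (rule cotangent_eqI[OF c])
  show "v \<notin> tangent_space A x \<Longrightarrow> p v = 0" for v using p by (simp add: cotangent_space_def)
  define f where "f e = p (tangent_of A c x e)" for e
  have "linear f"
  proof (rule linearI)
    fix v w a
    show "f (v + w) = f v + f w"
      using p tangent_of_in[OF c, of v] tangent_of_in[OF c, of w] tangent_of_linear[OF c, of 1 v 1 w]
      unfolding cotangent_space_def f_def by (force dest: spec[of _ "1::real"])
    show "f (a *\<^sub>R v) = a *\<^sub>R f v"
      using p tangent_of_in[OF c, of v] tangent_of_linear[OF c, of a v 0 v]
      unfolding cotangent_space_def f_def by (force dest: spec[of _ "0::real"])
  qed
  then interpret linear f .
  fix e
  have "f e = f (\<Sum>b\<in>Basis. (e \<bullet> b) *\<^sub>R b)" by (simp add: euclidean_representation)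
  also have "\<dots> = (\<Sum>b\<in>Basis. f b *\<^sub>R b) \<bullet> e"
    by (simp add: sum scale inner_sum_left inner_sum_right inner_commute mult.commute)
  finally show "p (tangent_of A c x e) = (\<Sum>b\<in>Basis. p (tangent_of A c x b) *\<^sub>R b) \<bullet> e"
    by (simp add: f_def)
qed

lemma cotangent_space_range:
  assumes c: "c \<in> A" "x \<in> cdom c"
  shows "cotangent_space A x = range (cotangent_of A c x)"
  using cotangent_space_eq[OF c] cotangent_of_in by blast

lemma cotangent_of_add: "cotangent_of A c x (q + r) v = cotangent_of A c x q v + cotangent_of A c x r v"
  and cotangent_of_scaleR: "cotangent_of A c x (s *\<^sub>R q) v = s * cotangent_of A c x q v"
  by (simp_all add: cotangent_of_def inner_add_left)

lemma cotangent_of_nonzero: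
  assumes "c \<in> A" "x \<in> cdom c" "q \<noteq> 0"
  shows "cotangent_of A c x q \<noteq> (\<lambda>v. 0)"
  using cotangent_of_tangent_of[OF assms(1,2), of q q] assms(3) by (metis inner_eq_zero_iff)

lemma chart_at: "chart_at A x \<in> A" "x \<in> cdom (chart_at A x)"
  unfolding chart_at_def using someI_ex[of "\<lambda>c. c \<in> A \<and> x \<in> cdom c"] ex_chart by blast+

lemma C_fun_Cn_on: "f \<in> C_fun A 1 \<Longrightarrow> c \<in> A \<Longrightarrow> Cn_on 1 (crange c) (f \<circ> cinv c)"
  by (auto simp: C_fun_def C_on_1)

lemma C_fun_infinity: "f \<in> C_fun A \<infinity> \<longleftrightarrow> (\<forall>c\<in>A. \<forall>n. Cn_on n (crange c) (f \<circ> cinv c))"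
  by (auto simp: C_fun_def C_on_infinity)

lemma C_fun_infinity_imp_1: "f \<in> C_fun A \<infinity> \<Longrightarrow> f \<in> C_fun A 1"
  by (auto simp: C_fun_def C_on_1 C_on_infinity simp del: Cn_on.simps)

lemma continuous_on_C_fun:
  assumes f: "f \<in> C_fun A 1"
  shows "continuous_on UNIV f"
proof (rule continuous_at_imp_continuous_on, rule ballI)
  fix x
  obtain c where c: "c \<in> A" "x \<in> cdom c" using ex_chart by blast
  have "continuous_on (cdom c) (\<lambda>x. (f \<circ> cinv c) (cmap c x))"
    using Cn_on_continuous[OF C_fun_Cn_on[OF f c(1)]] continuous_on_cmap[OF c(1)]
    by (rule continuous_on_compose2) auto
  then have "continuous_on (cdom c) f"
    by (rule continuous_on_eq) (use c in \<open>simp add: cinv_cmap\<close>)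
  then show "isCont f x" using c open_cdom[OF c(1)] by (simp add: continuous_on_eq_continuous_at)
qed

text \<open>\<open>differential\<close> is computed in the chart \<open>chart_at A x\<close>, about
  which nothing else is known; the chain rule through the transition map moves it to any chart
  around x.\<close>

lemma differential_eq:
  assumes f: "f \<in> C_fun A 1" and c: "c \<in> A" "x \<in> cdom c"
  shows "differential A f x = cotangent_of A c x (grad (f \<circ> cinv c) (cmap c x))"
proof (rule cotangent_eqI[OF c])
  show "v \<notin> tangent_space A x \<Longrightarrow> differential A f x v = 0" for v
    by (simp add: differential_def Let_def)
  fix e
  let ?d = "chart_at A x"
  note d = chart_at[of x]
  have fd: "(f \<circ> cinv a has_derivative frechet_derivative (f \<circ> cinv a) (at (cmap a x))) (at (cmap a x))"
    if "a \<in> A" "x \<in> cdom a" for a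
    by (rule Cn_on_has_derivative[OF C_fun_Cn_on[OF f that(1)]]) (use that in auto)
  have "(f \<circ> cinv ?d has_derivative frechet_derivative (f \<circ> cinv ?d) (at (cmap ?d x))) (at (transition c ?d (cmap c x)))"
    using fd[OF d] c by (simp add: cinv_cmap)
  from has_derivative_compose[OF transition_has_derivative[OF c(1) d(1) c(2) d(2)] this]
  have "((\<lambda>y. (f \<circ> cinv ?d) (transition c ?d y)) has_derivative
      (\<lambda>v. frechet_derivative (f \<circ> cinv ?d) (at (cmap ?d x)) (Dtrans c ?d x v))) (at (cmap c x))" .
  then have "(f \<circ> cinv c has_derivative
      (\<lambda>v. frechet_derivative (f \<circ> cinv ?d) (at (cmap ?d x)) (Dtrans c ?d x v))) (at (cmap c x))"
    by (rule has_derivative_transform_within_open[where s = "cmap c ` (cdom c \<inter> cdom ?d)"])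
      (use c d in \<open>auto simp: cinv_cmap open_cmap_image open_cdom\<close>)
  from grad_eq[OF this] show "differential A f x (tangent_of A c x e) = grad (f \<circ> cinv c) (cmap c x) \<bullet> e"
    using tangent_of_in[OF c] tangent_of_apply[OF d] by (simp add: differential_def Let_def)
qed

definition extend :: "('m, 'e) chart \<Rightarrow> ('e \<Rightarrow> real) \<Rightarrow> 'm \<Rightarrow> real" where
  "extend c F x = (if x \<in> cdom c then F (cmap c x) else 0)"

text \<open>A point either lies in the domain of c, where F is composed with a transition map, or
  off the image of K, where the function vanishes. That image is compact, hence closed in a
  Hausdorff space, so both descriptions hold on open sets.\<close>

lemma extend_Cn_on:
  assumes c: "c \<in> A" and K: "compact K" "K \<subseteq> crange c" and F: "Cn_on n (crange c) F"
    and F0: "\<And>y. y \<in> crange c \<Longrightarrow> y \<notin> K \<Longrightarrow> F y = 0" and d: "d \<in> A"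
  shows "Cn_on n (crange d) (extend c F \<circ> cinv d)"
proof (rule Cn_on_local)
  fix z assume z: "z \<in> crange d"
  show "\<exists>T. open T \<and> z \<in> T \<and> Cn_on n T (extend c F \<circ> cinv d)"
  proof (cases "cinv d z \<in> cdom c")
    case True
    let ?T = "cmap d ` (cdom d \<inter> cdom c)"
    have T: "open ?T" using open_cmap_image[OF d open_cdom[OF c]] .
    have "Cn_on n ?T (\<lambda>z. F (transition d c z))"
      by (rule Cn_on_compose[OF T open_crange[OF c] _ F transition_Cn_on[OF d c]])
        (use d in \<open>auto simp: cinv_cmap\<close>)
    then have "Cn_on n ?T (extend c F \<circ> cinv d)"
      by (rule Cn_on_cong_imp[OF T, rotated]) (use d in \<open>auto simp: extend_def cinv_cmap\<close>)
    moreover have "z \<in> ?T" using True z d cinv_in cmap_cinv by (metis IntI imageI)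
    ultimately show ?thesis using T by blast
  next
    case False
    let ?S = "cinv c ` K"
    let ?T = "cmap d ` (cdom d \<inter> - ?S)"
    have "compact ?S"
      using K continuous_on_cinv[OF c] by (intro compact_continuous_image) (auto intro: continuous_on_subset)
    then have T: "open ?T" by (intro open_cmap_image[OF d]) (simp add: compact_imp_closed open_Compl)
    have "Cn_on n ?T (\<lambda>z. 0)" by simp
    then have "Cn_on n ?T (extend c F \<circ> cinv d)"
    proof (rule Cn_on_cong_imp[OF T, rotated])
      fix w assume "w \<in> ?T"
      then obtain x where x: "x \<in> cdom d" "x \<notin> ?S" "w = cmap d x" by auto
      have "cmap c x \<notin> K" if "x \<in> cdom c" using x(2) cinv_cmap[OF c that] by (metis imageI)
      then show "0 = (extend c F \<circ> cinv d) w"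
        using x d F0 by (auto simp: extend_def cinv_cmap)
    qed
    moreover have "z \<in> ?T"
    proof -
      have "cinv d z \<notin> ?S" using False K(2) cinv_in[OF c] by auto
      then show ?thesis using z d cinv_in cmap_cinv by (metis ComplI IntI imageI)
    qed
    ultimately show ?thesis using T by blast
  qed
qed

text \<open>As the curve stays in the domain of c near t, its coordinates in any other chart around
  the point are there a transition map applied to those in c, and the chain rule applies.\<close>

lemma velocity_eq:
  assumes c: "c \<in> A" "\<gamma> t \<in> cdom c" and ev: "\<forall>\<^sub>F s in nhds t. \<gamma> s \<in> cdom c"
    and D: "((cmap c \<circ> \<gamma>) has_vector_derivative e) (at t)"
  shows "velocity A \<gamma> t = tangent_of A c (\<gamma> t) e"
proof
  fix d
  show "velocity A \<gamma> t d = tangent_of A c (\<gamma> t) e d"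
  proof (cases "d \<in> A \<and> \<gamma> t \<in> cdom d")
    case True
    then have d: "d \<in> A" "\<gamma> t \<in> cdom d" by auto
    obtain S where S: "open S" "t \<in> S" "\<And>s. s \<in> S \<Longrightarrow> \<gamma> s \<in> cdom c"
      using ev by (auto simp: eventually_nhds)
    have "((\<lambda>s. transition c d ((cmap c \<circ> \<gamma>) s)) has_derivative (\<lambda>h. Dtrans c d (\<gamma> t) (h *\<^sub>R e))) (at t)"
    proof (rule has_derivative_compose[of "cmap c \<circ> \<gamma>" "\<lambda>h. h *\<^sub>R e" t UNIV "transition c d" "Dtrans c d (\<gamma> t)"])
      show "((cmap c \<circ> \<gamma>) has_derivative (\<lambda>h. h *\<^sub>R e)) (at t)"
        using D by (simp add: has_vector_derivative_def)
      show "(transition c d has_derivative Dtrans c d (\<gamma> t)) (at ((cmap c \<circ> \<gamma>) t))"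
        using transition_has_derivative[OF c(1) d(1) c(2) d(2)] by (simp only: comp_apply[of "cmap c" \<gamma>])
    qed
    then have "((cmap d \<circ> \<gamma>) has_derivative (\<lambda>h. Dtrans c d (\<gamma> t) (h *\<^sub>R e))) (at t)"
      by (rule has_derivative_transform_within_open[OF _ S(1,2)]) (use S(3) c in \<open>simp add: cinv_cmap\<close>)
    then have "((cmap d \<circ> \<gamma>) has_vector_derivative Dtrans c d (\<gamma> t) e) (at t)"
      using Dtrans_linear[OF c(1) d(1) c(2) d(2)] by (simp add: has_vector_derivative_def linear_cmul bounded_linear.linear)
    then show ?thesis
      using d by (simp add: velocity_def tangent_of_def vector_derivative_at)
  qed (auto simp: velocity_def tangent_of_def)
qed

end

section \<open>Tonelli Hamiltonians in a chart\<close>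

text \<open>Since P is monotone in the constant, the largest constant over a finite subcover serves
  everywhere.\<close>

lemma compact_uniform_bound:
  fixes P :: "real \<Rightarrow> 'a::topological_space \<Rightarrow> bool"
  assumes K: "compact K" and mono: "\<And>C D y. P C y \<Longrightarrow> C \<le> D \<Longrightarrow> P D y"
    and loc: "\<And>y. y \<in> K \<Longrightarrow> \<exists>X C. open X \<and> y \<in> X \<and> (\<forall>z\<in>X \<inter> K. P C z)"
  shows "\<exists>C. \<forall>y\<in>K. P C y"
proof -
  obtain X C where X: "\<And>y. y \<in> K \<Longrightarrow> open (X y)" "\<And>y. y \<in> K \<Longrightarrow> y \<in> X y"
    "\<And>y z. y \<in> K \<Longrightarrow> z \<in> X y \<inter> K \<Longrightarrow> P (C y) z"
    using loc by metis
  obtain F where F: "F \<subseteq> K" "finite F" "K \<subseteq> (\<Union>y\<in>F. X y)"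
    using compactE_image[OF K, of K X] X by blast
  show ?thesis
  proof (intro exI ballI)
    fix z assume z: "z \<in> K"
    then obtain y where y: "y \<in> F" "z \<in> X y" using F by blast
    then have "P (C y) z" using X F z by blast
    moreover have "C y \<le> Max (C ` F)" using y F by auto
    ultimately show "P (Max (C ` F)) z" by (rule mono)
  qed
qed

lemma Cn_on_real_DERIV:
  fixes h :: "real \<Rightarrow> real"
  assumes "Cn_on 2 UNIV h"
  shows "(h has_real_derivative deriv h s) (at s)" "(deriv h has_real_derivative deriv (deriv h) s) (at s)"
proof -
  have C: "Cn_on (Suc (Suc 0)) UNIV h" using assms by (simp add: numeral_2_eq_2 del: Cn_on.simps)
  have d: "h field_differentiable (at x)" for x
  proof -
    have "h differentiable (at x)" using C by simp
    then show ?thesis by (simp add: real_differentiable_def field_differentiable_def)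
  qed
  then show D: "(h has_real_derivative deriv h s) (at s)" for s
    by (simp add: field_differentiable_derivI)
  have eq: "(\<lambda>x. frechet_derivative h (at x) 1) = deriv h"
  proof
    fix x
    have "(h has_derivative (\<lambda>v. deriv h x * v)) (at x)"
      using D by (simp add: has_field_derivative_def)
    from frechet_derivative_at[OF this] show "frechet_derivative h (at x) 1 = deriv h x"
      by (metis mult.right_neutral)
  qed
  have "Cn_on (Suc 0) UNIV (\<lambda>x. frechet_derivative h (at x) 1)" using C by simp
  then have "deriv h differentiable (at s)" unfolding eq by simp
  then show "(deriv h has_real_derivative deriv (deriv h) s) (at s)"
    by (metis DERIV_imp_deriv real_differentiable_def)
qed

locale hamiltonian = manifold A for A :: "('m::t2_space, 'e::euclidean_space) chart set" +
  fixes g :: "'m \<Rightarrow> ('m, 'e) tangent \<Rightarrow> ('m, 'e) tangent \<Rightarrow> real"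
    and H :: "'m \<Rightarrow> ('m, 'e) cotangent \<Rightarrow> real" and k :: enat and lam :: real
  assumes metric: "riemannian_metric A g" and k: "k \<ge> 2" and H_C: "C_cotangent_bundle A k H"
    and tonelli: "tonelli A g H" and lam: "lam > 0"
begin

definition Hc :: "('m, 'e) chart \<Rightarrow> 'e \<Rightarrow> 'e \<Rightarrow> real" where
  "Hc c y q = H (cinv c y) (cotangent_of A c (cinv c y) q)"

definition Lc :: "('m, 'e) chart \<Rightarrow> 'e \<Rightarrow> 'e \<Rightarrow> real" where
  "Lc c y v = (SUP q. q \<bullet> v - Hc c y q)"

lemma H_eq_Hc: "c \<in> A \<Longrightarrow> x \<in> cdom c \<Longrightarrow> H x (cotangent_of A c x q) = Hc c (cmap c x) q"
  by (simp add: Hc_def cinv_cmap)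

lemma Hc_Cn_on: "c \<in> A \<Longrightarrow> Cn_on 2 (crange c \<times> UNIV) (\<lambda>(y, q). Hc c y q)"
  using H_C k unfolding C_cotangent_bundle_def C_on_def Hc_def[abs_def] by (simp add: numeral_eq_enat del: Cn_on.simps)

lemma continuous_on_Hc: "c \<in> A \<Longrightarrow> continuous_on (crange c \<times> UNIV) (\<lambda>(y, q). Hc c y q)"
  using Cn_on_continuous[OF Hc_Cn_on] .

lemma continuous_on_Hc':
  "c \<in> A \<Longrightarrow> K \<subseteq> crange c \<Longrightarrow> continuous_on (K \<times> Q) (\<lambda>z. Hc c (fst z) (snd z))"
  using continuous_on_subset[OF continuous_on_Hc, of c "K \<times> Q"] by (auto simp: case_prod_unfold)

lemma Hc_affine_Cn_on:
  assumes c: "c \<in> A" "y \<in> crange c"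
  shows "Cn_on 2 UNIV (\<lambda>s::real. Hc c y (q + s *\<^sub>R r))"
proof -
  have "Cn_on 2 UNIV (\<lambda>s::real. (\<lambda>(y, q). Hc c y q) (y, q + s *\<^sub>R r))"
  proof (rule Cn_on_compose[OF open_UNIV _ _ Hc_Cn_on[OF c(1)]])
    show "open (crange c \<times> (UNIV :: 'e set))" by (intro open_Times open_crange c open_UNIV)
    have "Cn_on 2 UNIV (\<lambda>s::real. (y, q) + s *\<^sub>R (0, r))"
      by (intro Cn_on_add Cn_on_scaleR) (auto simp del: Cn_on.simps)
    then show "Cn_on 2 UNIV (\<lambda>s::real. (y, q + s *\<^sub>R r))" by (simp del: Cn_on.simps)
  qed (use c in auto)
  then show ?thesis by (simp del: Cn_on.simps)
qed

text \<open>Along a line the second derivative of \<open>Hc\<close> is the fibre Hessian in the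
  direction of the line, which the Tonelli condition makes positive.\<close>

lemma convex_Hc:
  assumes c: "c \<in> A" "y \<in> crange c"
  shows "convex_on UNIV (Hc c y)"
proof (rule convex_onI)
  fix t :: real and q p :: 'e assume t: "0 < t" "t < 1"
  show "Hc c y ((1 - t) *\<^sub>R q + t *\<^sub>R p) \<le> (1 - t) * Hc c y q + t * Hc c y p"
  proof (cases "p = q")
    case True
    then show ?thesis by (simp add: scaleR_left_diff_distrib algebra_simps)
  next
    case False
    define r where "r = p - q"
    define h where "h s = Hc c y (q + s *\<^sub>R r)" for s :: real
    have C: "Cn_on 2 UNIV h" unfolding h_def[abs_def] by (rule Hc_affine_Cn_on[OF c])
    have hess: "deriv (deriv h) s0 > 0" for s0
    proof -
      let ?x = "cinv c y"
      have x: "?x \<in> cdom c" by (rule cinv_in[OF c])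
      have "cotangent_of A c ?x r \<noteq> (\<lambda>v. 0)"
        using False x by (intro cotangent_of_nonzero c) (auto simp: r_def)
      then have "fiber_hessian H ?x (cotangent_of A c ?x (q + s0 *\<^sub>R r)) (cotangent_of A c ?x r) (cotangent_of A c ?x r) > 0"
        using tonelli cotangent_of_in unfolding tonelli_def by blast
      moreover have "H ?x (\<lambda>v. cotangent_of A c ?x (q + s0 *\<^sub>R r) v + s * cotangent_of A c ?x r v + t * cotangent_of A c ?x r v)
          = h (s0 + s + t)" for s t
        by (simp add: h_def Hc_def cotangent_of_add[symmetric] cotangent_of_scaleR[symmetric] algebra_simps)
      ultimately have "deriv (\<lambda>s. deriv (\<lambda>t. h (s0 + s + t)) 0) 0 > 0"
        by (simp add: fiber_hessian_def)
      \<comment> \<open>\<open>fiber_hessian\<close> differentiates twice at 0; the shifts move both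
        derivatives to s0.\<close>
      then show ?thesis
        by (simp add: deriv_shift_0[of h "s0 + s" for s, unfolded o_def, symmetric]
            deriv_shift_0[of "deriv h" s0, unfolded o_def, symmetric])
    qed
    have "convex_on UNIV h"
      by (rule f''_ge0_imp_convex[OF convex_UNIV Cn_on_real_DERIV[OF C]]) (simp add: hess less_imp_le)
    from convex_onD[OF this, of t 0 1] t have "h t \<le> (1 - t) * h 0 + t * h 1" by simp
    moreover have "q + t *\<^sub>R r = (1 - t) *\<^sub>R q + t *\<^sub>R p" by (simp add: r_def algebra_simps)
    ultimately show ?thesis by (simp add: h_def r_def)
  qed
qed simp

text \<open>In coordinates the metric is a positive definite form B, bounded by some M. The vector
  of Euclidean length m = 1 / sqrt M in the direction of q satisfies B e e <= 1 and pairs with q to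
  m times the norm of q. The minimum of B on the unit sphere shows that the supremum in
  \<open>conorm\<close> is over a bounded set, without which a real supremum says nothing.\<close>

lemma conorm_ge:
  assumes c: "c \<in> A" "x \<in> cdom c"
  shows "\<exists>m>0. \<forall>q. m * norm q \<le> conorm A g x (cotangent_of A c x q)"
proof -
  define B where "B e f = g x (tangent_of A c x e) (tangent_of A c x f)" for e f
  have T: "tangent_of A c x e \<in> tangent_space A x" for e by (rule tangent_of_in[OF c])
  have gx: "g x v w = g x w v" "g x (\<lambda>c. a *\<^sub>R v c + b *\<^sub>R w c) z = a * g x v z + b * g x w z"
    "v \<noteq> (\<lambda>c. 0) \<Longrightarrow> g x v v > 0"
    if "v \<in> tangent_space A x" "w \<in> tangent_space A x" "z \<in> tangent_space A x" for v w z a b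
    using metric that unfolding riemannian_metric_def by blast+
  have sym: "B e f = B f e" for e f unfolding B_def by (rule gx(1)[OF T T T])
  have lin: "B (a *\<^sub>R e + b *\<^sub>R f) z = a * B e z + b * B f z" for a b e f z
    unfolding B_def by (simp add: tangent_of_linear[OF c] gx(2)[OF T T T])
  have l1: "linear (\<lambda>e. B e z)" for z
    using lin[of 1 _ 1] lin[of _ _ 0 0] by (intro linearI) auto
  have eqz: "B z = (\<lambda>e. B e z)" for z by (rule ext) (rule sym)
  have "linear (B z)" for z by (subst eqz) (rule l1)
  with l1 have "bilinear B" unfolding bilinear_def by blast
  then interpret B: bounded_bilinear B by (simp add: bilinear_conv_bounded_bilinear)
  have pos: "B e e > 0" if "e \<noteq> 0" for e
  proof -
    have "tangent_of A c x e \<noteq> (\<lambda>d. 0)" using tangent_of_same[OF c, of e] that by metis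
    then show ?thesis unfolding B_def by (rule gx(3)[OF T T T])
  qed
  obtain M where M: "M > 0" "\<And>e f. norm (B e f) \<le> norm e * norm f * M"
    using B.pos_bounded by blast
  have cont: "continuous_on (sphere 0 1) (\<lambda>e. B e e)" by (intro B.continuous_on continuous_on_id)
  have ne: "sphere (0::'e) 1 \<noteq> {}" by simp
  obtain e0 where e0: "e0 \<in> sphere 0 1" "\<forall>e\<in>sphere 0 1. B e0 e0 \<le> B e e"
    using continuous_attains_inf[OF compact_sphere ne cont] by (rule bexE)
  have \<mu>: "B e0 e0 > 0" using e0(1) by (intro pos) auto
  have hom: "B (a *\<^sub>R e) (a *\<^sub>R e) = a\<^sup>2 * B e e" for a e
    by (simp add: B.scaleR_left B.scaleR_right power2_eq_square)
  have low: "B e0 e0 * (norm e)\<^sup>2 \<le> B e e" for e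
  proof (cases "e = 0")
    case False
    then have "B e0 e0 \<le> B ((1 / norm e) *\<^sub>R e) ((1 / norm e) *\<^sub>R e)" by (intro e0(2)[rule_format]) auto
    then show ?thesis unfolding hom using False by (simp add: field_simps)
  qed (simp add: B.zero_left)
  define m where "m = 1 / sqrt M"
  have m: "m > 0" "m\<^sup>2 * M = 1" using M(1) by (auto simp: m_def power_divide)
  show ?thesis
  proof (intro exI[of _ m] conjI allI m(1))
    fix q :: 'e
    let ?S = "{v \<in> tangent_space A x. g x v v \<le> 1}"
    show "m * norm q \<le> conorm A g x (cotangent_of A c x q)"
    proof (cases "q = 0")
      case True
      then show ?thesis
      proof -
        have "tangent_of A c x 0 \<in> ?S"
          using T[of 0] B.zero_left[of 0] by (simp add: B_def)
        then have ne: "?S \<noteq> {}" by blast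
        have "conorm A g x (cotangent_of A c x q) = (SUP v \<in> ?S. 0)"
          unfolding conorm_def by (rule SUP_cong) (simp_all add: True cotangent_of_def)
        then show ?thesis using ne True by simp
      qed
    next
      case False
      let ?e = "(m / norm q) *\<^sub>R q"
      have ne: "norm ?e = m" using False m by simp
      have "norm (B ?e ?e) \<le> m * m * M" using M(2)[of ?e ?e] unfolding ne .
      then have "B ?e ?e \<le> 1" using m(2) by (simp add: power2_eq_square)
      then have mem: "tangent_of A c x ?e \<in> ?S" using T by (simp add: B_def)
      have bdd: "bdd_above (cotangent_of A c x q ` ?S)"
      proof (rule bdd_aboveI2)
        fix v assume v: "v \<in> ?S"
        then have v': "v = tangent_of A c x (v c)" using tangent_space_eq[OF c] by simp
        have "B (v c) (v c) \<le> 1" using v unfolding B_def v'[symmetric] by simp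
        then have "(norm (v c))\<^sup>2 \<le> 1 / B e0 e0" using low[of "v c"] \<mu> by (simp add: field_simps)
        then have n: "norm (v c) \<le> sqrt (1 / B e0 e0)" by (rule real_le_rsqrt)
        have "cotangent_of A c x q v = q \<bullet> v c" using v by (simp add: cotangent_of_def)
        also have "\<dots> \<le> norm q * norm (v c)" by (rule norm_cauchy_schwarz)
        also have "\<dots> \<le> norm q * sqrt (1 / B e0 e0)" using n by (rule mult_left_mono) simp
        finally show "cotangent_of A c x q v \<le> norm q * sqrt (1 / B e0 e0)" .
      qed
      have "m * norm q = cotangent_of A c x q (tangent_of A c x ?e)"
        using False by (simp add: cotangent_of_tangent_of[OF c] dot_square_norm power2_eq_square)
      also have "\<dots> \<le> conorm A g x (cotangent_of A c x q)"
        unfolding conorm_def by (rule cSUP_upper[OF mem bdd])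
      finally show ?thesis .
    qed
  qed
qed

lemma Hc_superlinear_pointwise:
  assumes c: "c \<in> A" "y \<in> crange c" and N: "N > 0"
  shows "\<exists>R>0. \<forall>q. norm q \<ge> R \<longrightarrow> N * norm q \<le> Hc c y q"
proof -
  let ?x = "cinv c y"
  have x: "?x \<in> cdom c" by (rule cinv_in[OF c])
  obtain m where m: "m > 0" "\<And>q. m * norm q \<le> conorm A g ?x (cotangent_of A c ?x q)"
    using conorm_ge[OF c(1) x] by blast
  have "filterlim (\<lambda>p. H ?x p / conorm A g ?x p) at_top
        (inf (filtercomap (conorm A g ?x) at_top) (principal (cotangent_space A ?x)))"
    using tonelli by (simp add: tonelli_def)
  then have "eventually (\<lambda>p. N / m \<le> H ?x p / conorm A g ?x p)
      (inf (filtercomap (conorm A g ?x) at_top) (principal (cotangent_space A ?x)))"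
    by (simp add: filterlim_at_top)
  then obtain R where R: "\<And>p. p \<in> cotangent_space A ?x \<Longrightarrow> conorm A g ?x p \<ge> R \<Longrightarrow> N / m \<le> H ?x p / conorm A g ?x p"
    by (auto simp: eventually_inf_principal eventually_filtercomap eventually_at_top_linorder)
  define R' where "R' = max R 1 / m"
  have "R' > 0" using m by (simp add: R'_def)
  moreover have "N * norm q \<le> Hc c y q" if q: "norm q \<ge> R'" for q
  proof -
    let ?p = "cotangent_of A c ?x q"
    have "max R 1 \<le> m * norm q" using q m(1) by (simp add: R'_def field_simps)
    then have co: "max R 1 \<le> conorm A g ?x ?p" using m(2)[of q] by linarith
    then have "N / m \<le> H ?x ?p / conorm A g ?x ?p" by (intro R cotangent_of_in) simp
    then have "N / m * conorm A g ?x ?p \<le> Hc c y q" using co by (simp add: Hc_def field_simps)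
    moreover have "N / m * (m * norm q) \<le> N / m * conorm A g ?x ?p"
      using m N by (intro mult_left_mono) auto
    ultimately show ?thesis using m by simp
  qed
  ultimately show ?thesis by blast
qed

text \<open>The growth condition is given fibre by fibre. At y0 the function is large on a sphere of
  radius r; continuity keeps it large on that sphere for nearby y, and convexity along rays from the
  origin propagates the growth beyond the sphere. Compactness of K then yields one constant.\<close>

lemma Hc_superlinear:
  assumes c: "c \<in> A" and K: "compact K" "K \<subseteq> crange c"
  shows "\<exists>C. \<forall>y\<in>K. \<forall>q. N * norm q - C \<le> Hc c y q"
proof (rule compact_uniform_bound[OF K(1)])
  show "\<And>C D y. \<forall>q. N * norm q - C \<le> Hc c y q \<Longrightarrow> C \<le> D \<Longrightarrow> \<forall>q. N * norm q - D \<le> Hc c y q"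
    by (meson diff_left_mono order_trans)
  fix y0 assume "y0 \<in> K"
  then have y0: "y0 \<in> crange c" using K by auto
  \<comment> \<open>N may be negative; the comparison beyond the sphere needs a nonnegative
    slope.\<close>
  define N' where "N' = max N 0"
  have "N' + 1 > 0" by (simp add: N'_def)
  then obtain R where R: "R > 0" "\<And>q. norm q \<ge> R \<Longrightarrow> (N' + 1) * norm q \<le> Hc c y0 q"
    using Hc_superlinear_pointwise[OF c y0] by blast
  \<comment> \<open>The summand 2 pays for two unit errors made in replacing y0 by y, one at the
    point on the sphere and one at the origin.\<close>
  define r where "r = max R (Hc c y0 0 + 2)"
  have r: "r > 0" "r \<ge> R" "r \<ge> Hc c y0 0 + 2" using R by (auto simp: r_def)
  have cont: "continuous_on (crange c \<times> cball 0 r) (\<lambda>z. Hc c (fst z) (snd z))"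
    by (rule continuous_on_Hc'[OF c]) simp
  obtain X where X: "y0 \<in> X" "open X"
    "\<forall>y\<in>X \<inter> crange c. \<forall>q\<in>cball 0 r. dist (Hc c (fst (y, q)) (snd (y, q))) (Hc c (fst (y0, q)) (snd (y0, q))) \<le> 1"
    using continuous_on_prod_compactE[OF cont compact_cball y0 zero_less_one] by blast
  then have near: "\<bar>Hc c y q - Hc c y0 q\<bar> \<le> 1" if "y \<in> X" "y \<in> crange c" "norm q \<le> r" for y q
    using that by (auto simp: dist_real_def)
  have "continuous_on (cball 0 r) (\<lambda>q. Hc c y0 q)"
  proof -
    have "continuous_on (cball 0 r) (\<lambda>q. (y0, q))"
      by (rule continuous_on_Pair[OF continuous_on_const continuous_on_id])
    from continuous_on_compose2[OF continuous_on_Hc'[OF c, of "{y0}" "UNIV"] this] y0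
    show ?thesis by (simp add: image_subset_iff)
  qed
  from continuous_attains_inf[OF compact_cball _ this] r(1)
  have "\<exists>q0\<in>cball 0 r. \<forall>q\<in>cball 0 r. Hc c y0 q0 \<le> Hc c y0 q" by simp
  then obtain q0 where "\<forall>q\<in>cball 0 r. Hc c y0 q0 \<le> Hc c y0 q" by (rule bexE)
  then have q0: "\<And>q. norm q \<le> r \<Longrightarrow> Hc c y0 q0 \<le> Hc c y0 q" by simp
  have "\<forall>q. N * norm q - (N' * r + \<bar>Hc c y0 q0\<bar> + 1) \<le> Hc c y q" if y: "y \<in> X \<inter> K" for y
  proof
    fix q :: 'e
    have y': "y \<in> X" "y \<in> crange c" using y K by auto
    have N': "N * norm q \<le> N' * norm q" "0 \<le> N'" by (auto simp: N'_def intro: mult_right_mono)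
    show "N * norm q - (N' * r + \<bar>Hc c y0 q0\<bar> + 1) \<le> Hc c y q"
    proof (cases "norm q \<le> r")
      case True
      have "N' * norm q \<le> N' * r" using True N'(2) by (intro mult_left_mono)
      moreover have "Hc c y0 q0 - 1 \<le> Hc c y q" using near[OF y' True] q0[OF True] by linarith
      ultimately show ?thesis using N' by linarith
    next
      case False
      define \<theta> where "\<theta> = r / norm q"
      have \<theta>: "0 < \<theta>" "\<theta> < 1" "\<theta> * norm q = r"
      proof -
        have q: "r < norm q" "0 < norm q" using False r(1) by linarith+
        show "0 < \<theta>" unfolding \<theta>_def by (rule divide_pos_pos[OF r(1) q(2)])
        show "\<theta> < 1" unfolding \<theta>_def using q by (simp only: divide_less_eq_1_pos)
        show "\<theta> * norm q = r" unfolding \<theta>_def using q(2) by simp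
      qed
      have nq: "norm (\<theta> *\<^sub>R q) = r" using \<theta> by simp
      have 0: "\<bar>Hc c y 0 - Hc c y0 0\<bar> \<le> 1" by (rule near[OF y']) (use r in simp)
      have "(N' + 1) * r \<le> Hc c y0 (\<theta> *\<^sub>R q)" using R(2)[of "\<theta> *\<^sub>R q"] nq r by simp
      also have "\<dots> \<le> Hc c y (\<theta> *\<^sub>R q) + 1" using near[OF y', of "\<theta> *\<^sub>R q"] nq by simp
      also have "Hc c y (\<theta> *\<^sub>R q) \<le> (1 - \<theta>) * Hc c y 0 + \<theta> * Hc c y q"
        using convex_onD[OF convex_Hc[OF c y'(2)], of \<theta> 0 q] \<theta> by simp
      finally have "N' * r \<le> \<theta> * (Hc c y q - Hc c y 0)"
        using r(3) 0 by (simp add: algebra_simps)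
      then have "\<theta> * (N' * norm q) \<le> \<theta> * (Hc c y q - Hc c y 0)"
        using \<theta>(3) by (simp add: mult.left_commute)
      then have "N' * norm q \<le> Hc c y q - Hc c y 0" using \<theta>(1) by simp
      moreover have "Hc c y 0 \<ge> Hc c y0 q0 - 1" using 0 q0[of 0] r(1) by simp
      moreover have "N' * r \<ge> 0" using N' r by simp
      ultimately show ?thesis using N'(1) by linarith
    qed
  qed
  then show "\<exists>X C. open X \<and> y0 \<in> X \<and> (\<forall>z\<in>X \<inter> K. \<forall>q. N * norm q - C \<le> Hc c z q)"
    using X by blast
qed

lemma Hc_coercive:
  assumes c: "c \<in> A" and K: "compact K" "K \<subseteq> crange c"
  shows "\<exists>R. \<forall>y\<in>K. \<forall>q. Hc c y q \<le> B \<longrightarrow> norm q \<le> R"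
proof -
  obtain C where C: "\<And>y q. y \<in> K \<Longrightarrow> 1 * norm q - C \<le> Hc c y q" using Hc_superlinear[OF assms, of 1] by blast
  have "norm q \<le> B + C" if "y \<in> K" "Hc c y q \<le> B" for y q using C[OF that(1), of q] that(2) by simp
  then show ?thesis by blast
qed

lemma inner_minus_Hc_le:
  assumes "\<And>q. N * norm q - C \<le> Hc c y q" "norm v \<le> N"
  shows "q \<bullet> v - Hc c y q \<le> C"
proof -
  have "q \<bullet> v \<le> norm q * norm v" by (rule norm_cauchy_schwarz)
  also have "\<dots> \<le> norm q * N" using assms(2) by (intro mult_left_mono) auto
  finally show ?thesis using assms(1)[of q] by (simp add: mult.commute)
qed

lemma bdd_above_Lc:
  assumes c: "c \<in> A" "y \<in> crange c"
  shows "bdd_above (range (\<lambda>q. q \<bullet> v - Hc c y q))"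
proof -
  obtain C where "\<And>q. norm v * norm q - C \<le> Hc c y q"
    using Hc_superlinear[OF c(1), of "{y}" "norm v"] c(2) by auto
  from inner_minus_Hc_le[OF this order_refl] show ?thesis by (rule bdd_aboveI2)
qed

lemma Fenchel:
  assumes c: "c \<in> A" "y \<in> crange c"
  shows "q \<bullet> v \<le> Lc c y v + Hc c y q"
  using cSUP_upper[OF UNIV_I bdd_above_Lc[OF c], of q v] by (simp add: Lc_def)

lemma Lc_le:
  assumes c: "c \<in> A" and K: "compact K" "K \<subseteq> crange c"
  shows "\<exists>C. \<forall>y\<in>K. \<forall>v. norm v \<le> N \<longrightarrow> Lc c y v \<le> C"
proof -
  obtain C where "\<And>y q. y \<in> K \<Longrightarrow> N * norm q - C \<le> Hc c y q" using Hc_superlinear[OF assms, of N] by blast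
  then have "\<forall>y\<in>K. \<forall>v. norm v \<le> N \<longrightarrow> Lc c y v \<le> C"
    unfolding Lc_def by (auto intro!: cSUP_least inner_minus_Hc_le)
  then show ?thesis by blast
qed

text \<open>The velocity is the fibre derivative of the Hamiltonian at q. By convexity the graph
  lies above its tangent plane there, so q attains the supremum defining \<open>Lc\<close>.\<close>

lemma Fenchel_equality:
  assumes c: "c \<in> A" "y \<in> crange c"
  shows "\<exists>v. Lc c y v = q \<bullet> v - Hc c y q"
proof -
  have "(\<lambda>z. Hc c (fst z) (snd z)) differentiable (at (y, q))"
  proof -
    have "Cn_on 1 (crange c \<times> UNIV) (\<lambda>(y, q). Hc c y q)" by (rule Cn_on_mono[OF Hc_Cn_on[OF c(1)]]) simp
    then have "(\<lambda>(y, q). Hc c y q) differentiable (at (y, q))"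
      by (rule differentiableI[OF Cn_on_has_derivative]) (use c(2) in auto)
    then show ?thesis by (simp add: case_prod_unfold)
  qed
  then obtain D where D: "((\<lambda>z. Hc c (fst z) (snd z)) has_derivative D) (at (y, q))"
    by (auto simp: differentiable_def)
  have "((\<lambda>q. (y, q)) has_derivative (\<lambda>h. (0, h))) (at q)" by (intro has_derivative_Pair has_derivative_const has_derivative_ident)
  from has_derivative_compose[OF this D] have HD: "(Hc c y has_derivative (\<lambda>h. D (0, h))) (at q)" by simp
  define v where "v = grad (Hc c y) q"
  have Dv: "(Hc c y has_derivative (\<lambda>h. v \<bullet> h)) (at q)"
    unfolding v_def by (rule has_derivative_grad) (use HD in \<open>auto simp: differentiable_def\<close>)
  have tan: "Hc c y p \<ge> Hc c y q + v \<bullet> (p - q)" for p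
  proof -
    define h where "h s = Hc c y (q + s *\<^sub>R (p - q))" for s :: real
    have "convex_on UNIV h"
    proof (rule convex_onI)
      fix t a b :: real assume "0 < t" "t < 1"
      moreover have "q + ((1 - t) *\<^sub>R a + t *\<^sub>R b) *\<^sub>R (p - q) = (1 - t) *\<^sub>R (q + a *\<^sub>R (p - q)) + t *\<^sub>R (q + b *\<^sub>R (p - q))"
        by (simp add: algebra_simps)
      ultimately show "h ((1 - t) *\<^sub>R a + t *\<^sub>R b) \<le> (1 - t) * h a + t * h b"
        unfolding h_def using convex_onD[OF convex_Hc[OF c], of t "q + a *\<^sub>R (p - q)" "q + b *\<^sub>R (p - q)"] by simp
    qed simp
    moreover have "(h has_derivative (\<lambda>s. v \<bullet> (s *\<^sub>R (p - q)))) (at 0)"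
      unfolding h_def
      by (rule has_derivative_compose[of "\<lambda>s. q + s *\<^sub>R (p - q)" _ 0 UNIV "Hc c y"])
        (auto intro!: derivative_eq_intros Dv)
    then have "(h has_real_derivative v \<bullet> (p - q)) (at 0)"
      by (simp add: has_field_derivative_def mult.commute[of _ "v \<bullet> (p - q)"])
    ultimately have "h 1 - h 0 \<ge> v \<bullet> (p - q) * (1 - 0)"
      by (intro convex_on_imp_above_tangent[of UNIV]) auto
    then show ?thesis by (simp add: h_def)
  qed
  have "Lc c y v \<le> q \<bullet> v - Hc c y q"
    unfolding Lc_def
  proof (rule cSUP_least)
    fix p show "p \<bullet> v - Hc c y p \<le> q \<bullet> v - Hc c y q"
      using tan[of p] by (simp add: inner_diff_right inner_commute)
  qed simp
  moreover have "q \<bullet> v - Hc c y q \<le> Lc c y v" using Fenchel[OF c, of q v] by simp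
  ultimately show ?thesis by (intro exI[of _ v]) simp
qed

lemma Hc_bounded:
  assumes c: "c \<in> A" and K: "compact K" "K \<subseteq> crange c"
  shows "\<exists>M. \<forall>y\<in>K. \<forall>q. norm q \<le> R \<longrightarrow> \<bar>Hc c y q\<bar> \<le> M"
proof -
  have "compact ((\<lambda>z. Hc c (fst z) (snd z)) ` (K \<times> cball 0 R))"
    by (intro compact_continuous_image continuous_on_Hc' compact_Times compact_cball assms)
  from compact_imp_bounded[OF this]
  obtain M where M: "\<forall>w\<in>(\<lambda>z. Hc c (fst z) (snd z)) ` (K \<times> cball 0 R). norm w \<le> M"
    unfolding bounded_iff by (rule exE)
  have "\<bar>Hc c y q\<bar> \<le> M" if "y \<in> K" "norm q \<le> R" for y q
    using bspec[OF M imageI, of "(y, q)"] that by simp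
  then show ?thesis by blast
qed

text \<open>Moving q by one unit towards v raises the pairing by the length of v, while the
  Hamiltonian stays bounded on the larger ball; Fenchel's inequality at the new point bounds
  v.\<close>

lemma Fenchel_equality_bounded:
  assumes c: "c \<in> A" and K: "compact K" "K \<subseteq> crange c"
  shows "\<exists>N. \<forall>y\<in>K. \<forall>q v. norm q \<le> R \<longrightarrow> Lc c y v = q \<bullet> v - Hc c y q \<longrightarrow> norm v \<le> N"
proof -
  obtain M where M: "\<And>y q. y \<in> K \<Longrightarrow> norm q \<le> R + 1 \<Longrightarrow> \<bar>Hc c y q\<bar> \<le> M"
    using Hc_bounded[OF assms] by blast
  have "norm v \<le> 2 * \<bar>M\<bar>" if y: "y \<in> K" and q: "norm q \<le> R" and eq: "Lc c y v = q \<bullet> v - Hc c y q" for y q v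
  proof (cases "v = 0")
    case False
    let ?q = "q + (1 / norm v) *\<^sub>R v"
    have "norm ?q \<le> R + 1"
      using norm_triangle_ineq[of q "(1 / norm v) *\<^sub>R v"] q False by simp
    then have "\<bar>Hc c y ?q\<bar> \<le> M" "\<bar>Hc c y q\<bar> \<le> M" using M[OF y] q by auto
    moreover have "?q \<bullet> v = q \<bullet> v + norm v"
      using False by (simp add: inner_add_left dot_square_norm power2_eq_square)
    moreover have "?q \<bullet> v \<le> Lc c y v + Hc c y ?q" using y K by (intro Fenchel c) auto
    ultimately show ?thesis using eq by linarith
  qed simp
  then show ?thesis by blast
qed

text \<open>Covectors outside a ball cannot compete in the supremum: growth with slope N + 1 pushes
  them below what the zero covector gives at y. Inside the ball the uniform continuity of the
  Hamiltonian decides.\<close>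

lemma Lc_uniformly_continuous:
  assumes c: "c \<in> A" and K: "compact K" "K \<subseteq> crange c" and \<epsilon>: "\<epsilon> > 0"
  shows "\<exists>\<eta>>0. \<forall>y\<in>K. \<forall>z\<in>K. dist y z < \<eta> \<longrightarrow> (\<forall>v. norm v \<le> N \<longrightarrow> Lc c z v \<le> Lc c y v + \<epsilon>)"
proof -
  obtain C where C: "\<And>y q. y \<in> K \<Longrightarrow> (N + 1) * norm q - C \<le> Hc c y q"
    using Hc_superlinear[OF c K] by blast
  obtain M where M: "\<And>y q. y \<in> K \<Longrightarrow> norm q \<le> 0 \<Longrightarrow> \<bar>Hc c y q\<bar> \<le> M"
    using Hc_bounded[OF c K] by blast
  define R where "R = C + \<bar>M\<bar>"
  have "uniformly_continuous_on (K \<times> cball 0 R) (\<lambda>z. Hc c (fst z) (snd z))"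
    by (intro compact_uniformly_continuous continuous_on_Hc' compact_Times compact_cball c K)
  then obtain \<eta> where \<eta>: "\<eta> > 0" "\<And>y q z p. y \<in> K \<Longrightarrow> norm q \<le> R \<Longrightarrow> z \<in> K \<Longrightarrow> norm p \<le> R \<Longrightarrow>
      dist (z, p) (y, q) < \<eta> \<Longrightarrow> dist (Hc c z p) (Hc c y q) < \<epsilon>"
    using \<epsilon> unfolding uniformly_continuous_on_def by fastforce
  have "Lc c z v \<le> Lc c y v + \<epsilon>" if y: "y \<in> K" "z \<in> K" "dist y z < \<eta>" and v: "norm v \<le> N" for y z v
    unfolding Lc_def[of c z]
  proof (rule cSUP_least)
    fix q
    have ry: "y \<in> crange c" using y K by auto
    show "q \<bullet> v - Hc c z q \<le> Lc c y v + \<epsilon>"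
    proof (cases "norm q \<le> R")
      case True
      have "dist (z, q) (y, q) < \<eta>" using y(3) by (simp add: dist_Pair_Pair dist_commute)
      from \<eta>(2)[OF y(1) True y(2) True this] have "Hc c y q \<le> Hc c z q + \<epsilon>" by (simp add: dist_real_def)
      then show ?thesis using Fenchel[OF c ry, of q v] by simp
    next
      case False
      have "q \<bullet> v \<le> norm q * norm v" by (rule norm_cauchy_schwarz)
      also have "\<dots> \<le> norm q * N" using v by (intro mult_left_mono) auto
      finally have "q \<bullet> v - Hc c z q \<le> C - norm q" using C[OF y(2), of q] by (simp add: algebra_simps)
      also have "\<dots> \<le> - \<bar>M\<bar>" using False by (simp add: R_def)
      also have "\<dots> \<le> Lc c y v"
        using Fenchel[OF c ry, of 0 v] M[OF y(1), of 0] by simp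
      finally show ?thesis using \<epsilon> by simp
    qed
  qed simp
  then show ?thesis using \<eta>(1) by blast
qed

lemma lagrangian_eq:
  assumes c: "c \<in> A" "x \<in> cdom c"
  shows "lagrangian A H x (tangent_of A c x e) = Lc c (cmap c x) e"
proof -
  have "lagrangian A H x (tangent_of A c x e) = (SUP q. cotangent_of A c x q (tangent_of A c x e) - H x (cotangent_of A c x q))"
    unfolding lagrangian_def cotangent_space_range[OF c] by (simp add: image_image)
  also have "\<dots> = Lc c (cmap c x) e"
    unfolding Lc_def by (simp add: cotangent_of_tangent_of[OF c] H_eq_Hc[OF c])
  finally show ?thesis .
qed

end

section \<open>Smoothing subsolutions in a chart\<close>

text \<open>The substitution w = y - z exchanges two forms of a convolution: one is visibly smooth
  in y, the other is visibly an average of translates of F. Both integrands vanish off bounded sets,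
  so the two boxes stand for the whole space.\<close>

lemma integral_convolution_flip:
  fixes \<rho> F :: "'e::euclidean_space \<Rightarrow> real"
  assumes \<rho>: "continuous_on UNIV \<rho>" "\<And>w. w \<notin> cbox p q \<Longrightarrow> \<rho> w = 0"
    and F: "continuous_on UNIV F" "\<And>z. z \<notin> cbox a b \<Longrightarrow> F z = 0"
  shows "integral (cbox a b) (\<lambda>z. \<rho> (y - z) * F z) = integral (cbox p q) (\<lambda>w. \<rho> w * F (y - w))"
proof -
  let ?f = "\<lambda>z. \<rho> (y - z) * F z" and ?h = "\<lambda>w. \<rho> w * F (y - w)"
  let ?T = "(\<lambda>x. (1 / (-1)) *\<^sub>R x + - ((1 / (-1)) *\<^sub>R y)) ` cbox a b"
  have "?f integrable_on cbox a b"
    by (intro integrable_continuous continuous_intros continuous_on_compose2[OF \<rho>(1)] continuous_on_subset[OF F(1)]) auto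
  then have "(?f has_integral integral (cbox a b) ?f) (cbox a b)" by (rule integrable_integral)
  from has_integral_affinity[OF this, of "-1" y]
  have 1: "(?h has_integral integral (cbox a b) ?f) ?T" by simp
  have "?h w = 0" if "w \<notin> ?T" for w
  proof -
    have "y - w \<notin> cbox a b"
    proof
      assume "y - w \<in> cbox a b"
      then have "w \<in> ?T" by (intro image_eqI[of _ _ "y - w"]) auto
      with that show False by blast
    qed
    then show ?thesis by (simp add: F(2))
  qed
  from has_integral_on_superset[OF 1 this]
  have "(?h has_integral integral (cbox a b) ?f) UNIV" by simp
  moreover have "(\<lambda>w. if w \<in> cbox p q then ?h w else 0) = ?h" using \<rho>(2) by auto
  ultimately have "(?h has_integral integral (cbox a b) ?f) (cbox p q)"
    using has_integral_restrict_UNIV[of "cbox p q" ?h] by simp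
  then show ?thesis by (simp add: integral_unique)
qed

text \<open>W is the convolution with a normalised bump of radius \<eta>. Its properties are phrased
  as inheritance of one-sided bounds by averages, which can be used where F is controlled only near
  y. The last one, on increments, carries the integrated viscosity inequality over to W.\<close>

lemma mollifier:
  fixes F :: "'e::euclidean_space \<Rightarrow> real"
  assumes F: "continuous_on UNIV F" "\<And>z. z \<notin> cbox a b \<Longrightarrow> F z = 0" and \<eta>: "\<eta> > 0"
  obtains W where "\<And>n. Cn_on n UNIV W"
    "\<And>y M. (\<And>z. dist z y < \<eta> \<Longrightarrow> F z \<le> M) \<Longrightarrow> W y \<le> M"
    "\<And>y M. (\<And>z. dist z y < \<eta> \<Longrightarrow> M \<le> F z) \<Longrightarrow> M \<le> W y"
    "\<And>y h M. (\<And>z. dist z y < \<eta> \<Longrightarrow> F (z + h) - F z \<le> M) \<Longrightarrow> W (y + h) - W y \<le> M"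
proof -
  define \<beta> :: "'e \<Rightarrow> real" where "\<beta> = bump 0 (\<eta> / 2)"
  have \<beta>0: "\<beta> w = 0" if "norm w \<ge> \<eta>" for w using bump_eq_0[of "\<eta> / 2" w 0] that \<eta> by (simp add: \<beta>_def)
  have \<beta>1: "\<beta> 0 = 1" using bump_eq_1[of "\<eta> / 2" 0 0] \<eta> by (simp add: \<beta>_def)
  have C\<beta>: "Cn_on n UNIV \<beta>" for n unfolding \<beta>_def by (rule Cn_on_bump)
  have c\<beta>: "continuous_on S \<beta>" for S using Cn_on_continuous[OF C\<beta>] continuous_on_subset by blast
  obtain p :: 'e where p: "cball 0 \<eta> \<subseteq> box (-p) p"
    using bounded_subset_box_symmetric[OF bounded_cball] by blast
  then have pc: "cball 0 \<eta> \<subseteq> cbox (-p) p" using box_subset_cbox by blast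
  have \<beta>p: "\<beta> w = 0" if "w \<notin> cbox (-p) p" for w
  proof -
    have "w \<notin> cball 0 \<eta>" using pc that by blast
    then show ?thesis by (intro \<beta>0) simp
  qed
  define J where "J = integral (cbox (-p) p) \<beta>"
  have int\<beta>: "\<beta> integrable_on cbox (-p) p" by (rule integrable_continuous[OF c\<beta>])
  have pos: "\<beta> w \<ge> 0" for w by (simp add: \<beta>_def bump_nonneg)
  have "J \<noteq> 0"
  proof
    assume "J = 0"
    then have "(\<beta> has_integral 0) (cbox (-p) p)" using integrable_integral[OF int\<beta>] by (simp add: J_def)
    moreover have 0: "0 \<in> box (-p) p" using p \<eta> by (auto simp: subset_iff)
    then have "box (-p) p \<noteq> {}" "0 \<in> cbox (-p) p" using box_subset_cbox by blast+
    ultimately have "\<beta> 0 = 0" using has_integral_0_cbox_imp_0[OF c\<beta> pos] by blast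
    then show False using \<beta>1 by simp
  qed
  moreover have "J \<ge> 0" unfolding J_def by (rule integral_nonneg[OF int\<beta> pos])
  ultimately have J: "J > 0" by simp
  define \<rho> where "\<rho> w = \<beta> w * inverse J" for w
  have C\<rho>: "Cn_on n UNIV \<rho>" for n unfolding \<rho>_def[abs_def] by (intro Cn_on_mult C\<beta> Cn_on_const open_UNIV)
  have c\<rho>: "continuous_on S \<rho>" for S unfolding \<rho>_def by (intro continuous_intros c\<beta>)
  have \<rho>pos: "\<rho> w \<ge> 0" for w using pos[of w] J by (simp add: \<rho>_def)
  have \<rho>0: "\<rho> w = 0" if "norm w \<ge> \<eta>" for w using \<beta>0[OF that] by (simp add: \<rho>_def)
  have \<rho>p: "\<rho> w = 0" if "w \<notin> cbox (-p) p" for w using \<beta>p[OF that] by (simp add: \<rho>_def)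
  have int\<rho>: "((\<lambda>w. \<rho> w * M) has_integral M) (cbox (-p) p)" for M
  proof -
    have "((\<lambda>w. \<beta> w * (inverse J * M)) has_integral (J * (inverse J * M))) (cbox (-p) p)"
      unfolding J_def by (intro has_integral_mult_left integrable_integral int\<beta>)
    moreover have "J * (inverse J * M) = M" using J by simp
    ultimately show ?thesis by (simp add: \<rho>_def mult.assoc)
  qed
  define W where "W y = integral (cbox a b) (\<lambda>z. \<rho> (y - z) * F z)" for y
  have W: "((\<lambda>w. \<rho> w * F (y - w)) has_integral W y) (cbox (-p) p)" for y
  proof -
    have flip: "W y = integral (cbox (-p) p) (\<lambda>w. \<rho> w * F (y - w))"
      unfolding W_def by (rule integral_convolution_flip[OF c\<rho> \<rho>p F])
    show ?thesis unfolding flip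
    by (intro integrable_integral integrable_continuous continuous_intros c\<rho> continuous_on_compose2[OF F(1)]) auto
  qed
  \<comment> \<open>The weight vanishes at distance \<eta> and beyond, so values of F have to be
    compared only within that distance.\<close>
  have le: "\<rho> w * s \<le> \<rho> w * t" if "norm w < \<eta> \<Longrightarrow> s \<le> t" for w s t
    using \<rho>0[of w] that \<rho>pos[of w] by (cases "norm w < \<eta>") (auto intro: mult_left_mono)
  show thesis
  proof
    show "Cn_on n UNIV W" for n
      unfolding W_def[abs_def] by (intro Cn_on_convolution C\<rho> continuous_on_subset[OF F(1)]) auto
    fix y M
    show "W y \<le> M" if "\<And>z. dist z y < \<eta> \<Longrightarrow> F z \<le> M"
      by (rule has_integral_le[OF W int\<rho>]) (intro le that, simp add: dist_norm)
    show "M \<le> W y" if "\<And>z. dist z y < \<eta> \<Longrightarrow> M \<le> F z"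
      by (rule has_integral_le[OF int\<rho> W]) (intro le that, simp add: dist_norm)
    fix h
    show "W (y + h) - W y \<le> M" if *: "\<And>z. dist z y < \<eta> \<Longrightarrow> F (z + h) - F z \<le> M"
    proof (rule has_integral_le[OF has_integral_diff[OF W W] int\<rho>])
      fix w
      have "\<rho> w * (F (y + h - w) - F (y - w)) \<le> \<rho> w * M"
        using *[of "y - w"] by (intro le) (simp add: dist_norm algebra_simps)
      then show "\<rho> w * F (y + h - w) - \<rho> w * F (y - w) \<le> \<rho> w * M" by (simp add: right_diff_distrib)
    qed
  qed
qed

lemma grad_inner_le:
  assumes W: "W differentiable (at y)" and le: "\<forall>\<^sub>F t in at_right 0. W (y + t *\<^sub>R v) - W y \<le> t * m"
  shows "grad W y \<bullet> v \<le> m"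
proof -
  have "((\<lambda>t. W (y + t *\<^sub>R v)) has_derivative (\<lambda>t. grad W y \<bullet> (t *\<^sub>R v))) (at (0::real))"
    by (rule has_derivative_compose[of "\<lambda>t. y + t *\<^sub>R v" _ 0 UNIV W])
      (auto intro!: derivative_eq_intros has_derivative_grad W)
  then have "((\<lambda>t. W (y + t *\<^sub>R v)) has_real_derivative grad W y \<bullet> v) (at 0)"
    by (simp add: has_field_derivative_def mult.commute[of _ "grad W y \<bullet> v"])
  then have "((\<lambda>t. (W (y + t *\<^sub>R v) - W y) / t) \<longlongrightarrow> grad W y \<bullet> v) (at 0)"
    by (simp add: has_field_derivative_iff)
  then have "((\<lambda>t. (W (y + t *\<^sub>R v) - W y) / t) \<longlongrightarrow> grad W y \<bullet> v) (at_right 0)"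
    by (simp add: filterlim_at_split)
  moreover have "\<forall>\<^sub>F t in at_right 0. (W (y + t *\<^sub>R v) - W y) / t \<le> m"
    using le eventually_at_right_less[of "0::real"]
    by eventually_elim (simp add: field_simps)
  ultimately show ?thesis by (rule tendsto_upperbound) simp
qed

section \<open>Viscosity inequalities in coordinates\<close>

text \<open>A viscosity inequality says nothing at a point that no test function touches. On the
  boundary sphere the paraboloid has height 2 * \<bar>M\<bar> + 1, more than U can vary, so the
  maximum of the difference is interior.\<close>

lemma continuous_touching_above:
  fixes U :: "'e::euclidean_space \<Rightarrow> real"
  assumes U: "continuous_on (cball a r) U" and r: "r > 0"
  obtains y K where "y \<in> ball a r" "\<forall>\<^sub>F z in nhds y. U z - K * ((z - a) \<bullet> (z - a)) \<le> U y - K * ((y - a) \<bullet> (y - a))"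
proof -
  from compact_imp_bounded[OF compact_continuous_image[OF U compact_cball]]
  obtain M where "\<forall>w\<in>U ` cball a r. norm w \<le> M" unfolding bounded_iff by (rule exE)
  then have M: "\<bar>U z\<bar> \<le> M" if "z \<in> cball a r" for z using that by auto
  define K where "K = (2 * \<bar>M\<bar> + 1) / r\<^sup>2"
  have cont: "continuous_on (cball a r) (\<lambda>z. U z - K * ((z - a) \<bullet> (z - a)))" by (intro continuous_intros U)
  have ne: "cball a r \<noteq> {}" using r by simp
  obtain y where y: "y \<in> cball a r" "\<forall>z\<in>cball a r. U z - K * ((z - a) \<bullet> (z - a)) \<le> U y - K * ((y - a) \<bullet> (y - a))"
    using continuous_attains_sup[OF compact_cball ne cont] by (rule bexE)
  have "norm (y - a) \<noteq> r"
  proof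
    assume "norm (y - a) = r"
    then have "K * ((y - a) \<bullet> (y - a)) = 2 * \<bar>M\<bar> + 1" using r by (simp add: K_def dot_square_norm)
    moreover have "U a \<le> U y - K * ((y - a) \<bullet> (y - a))" using bspec[OF y(2), of a] r by simp
    moreover have "\<bar>U a\<bar> \<le> M" "\<bar>U y\<bar> \<le> M" using M y(1) r by auto
    ultimately show False by linarith
  qed
  then have yb: "y \<in> ball a r" using y(1) by (auto simp: dist_norm norm_minus_commute)
  then have "\<forall>\<^sub>F z in nhds y. z \<in> ball a r" by (intro eventually_nhds_in_open) auto
  then have "\<forall>\<^sub>F z in nhds y. U z - K * ((z - a) \<bullet> (z - a)) \<le> U y - K * ((y - a) \<bullet> (y - a))"
    by (rule eventually_mono) (use y(2) in auto)
  then show ?thesis using that yb by blast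
qed

(* A viscosity inequality DU.v <= m is integrated along v: a failure of the conclusion gives a
   function theta of slope > m such that U - theta has an interior maximum on the segment, and
   penalising the distance to the segment turns it into a local maximum in the ball. *)
lemma viscosity_directional:
  fixes U :: "'e::euclidean_space \<Rightarrow> real"
  assumes U: "continuous_on (ball y0 R) U"
    and visc: "\<And>y \<Phi>. y \<in> ball y0 R \<Longrightarrow> Cn_on 1 UNIV \<Phi> \<Longrightarrow>
      (\<forall>\<^sub>F z in nhds y. U z - \<Phi> z \<le> U y - \<Phi> y) \<Longrightarrow> grad \<Phi> y \<bullet> v \<le> m"
    and a: "a \<in> ball y0 R" and at: "a + t *\<^sub>R v \<in> ball y0 R" and t: "t \<ge> 0"
  shows "U (a + t *\<^sub>R v) \<le> U a + t * m"
proof (cases "v = 0 \<or> t = 0")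
  case True
  \<comment> \<open>For v = 0 the viscosity inequality reads 0 <= m at any touching point, and one
    exists.\<close>
  have "0 \<le> m" if "v = 0"
  proof -
    obtain r where r: "r > 0" "cball a r \<subseteq> ball y0 R"
      using a open_ball[of y0 R] unfolding open_contains_cball by blast
    obtain y K where y: "y \<in> ball a r"
      "\<forall>\<^sub>F z in nhds y. U z - K * ((z - a) \<bullet> (z - a)) \<le> U y - K * ((y - a) \<bullet> (y - a))"
      using continuous_touching_above[OF continuous_on_subset[OF U r(2)] r(1)] by blast
    have "y \<in> ball y0 R" using y(1) r(2) ball_subset_cball by blast
    moreover have "Cn_on 1 UNIV (\<lambda>z. K * ((z - a) \<bullet> (z - a)))"
      by (intro Cn_on_mult Cn_on_inner Cn_on_diff Cn_on_const Cn_on_id open_UNIV)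
    ultimately have "grad (\<lambda>z. K * ((z - a) \<bullet> (z - a))) y \<bullet> v \<le> m"
      by (rule visc[OF _ _ y(2)])
    then show ?thesis using that by simp
  qed
  with True t show ?thesis by auto
next
  case False
  then have t: "t > 0" and v: "v \<noteq> 0" "v \<bullet> v > 0" using t by auto
  show ?thesis
  proof (rule ccontr)
    assume "\<not> ?thesis"
    then have "m < (U (a + t *\<^sub>R v) - U a) / t" using t by (simp add: field_simps)
    then obtain m' where m': "m < m'" "m' < (U (a + t *\<^sub>R v) - U a) / t" using dense by blast
    define r where "r = (R - max (dist y0 a) (dist y0 (a + t *\<^sub>R v))) / 2"
    have r: "r > 0" "dist y0 a + r < R" "dist y0 (a + t *\<^sub>R v) + r < R" using a at by (auto simp: r_def max_def field_simps)
    have seg: "a + s *\<^sub>R v \<in> ball y0 (R - r)" if "0 \<le> s" "s \<le> t" for s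
    proof -
      have "(1 - s / t) *\<^sub>R a + (s / t) *\<^sub>R (a + t *\<^sub>R v) \<in> ball y0 (R - r)"
        using convexD[OF convex_ball, of a y0 "R - r" "a + t *\<^sub>R v" "1 - s / t" "s / t"] r that t
        by (auto simp: dist_commute)
      moreover have "(1 - s / t) *\<^sub>R a + (s / t) *\<^sub>R (a + t *\<^sub>R v) = a + s *\<^sub>R v"
        using t by (simp add: algebra_simps)
      ultimately show ?thesis by simp
    qed
    define h where "h s = U (a + s *\<^sub>R v) - m' * s" for s
    have ch: "continuous_on {0..t} h"
      unfolding h_def
      by (intro continuous_intros continuous_on_compose2[OF U]) (use seg r in \<open>fastforce simp: ball_def\<close>)
    have h0t: "h 0 < h t" using m'(2) t by (simp add: h_def field_simps)
    have "\<exists>s1. 0 < s1 \<and> s1 < t \<and> h 0 < h s1"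
    proof -
      have "(h \<longlongrightarrow> h t) (at t within {0..t})" using ch t by (simp add: continuous_on_def)
      then have "\<forall>\<^sub>F s in at t within {0..t}. h 0 < h s" using h0t by (rule order_tendstoD)
      then have "\<forall>\<^sub>F s in at_left t. h 0 < h s" using t by (simp add: at_within_Icc_at_left)
      moreover have "\<forall>\<^sub>F s in at_left t. s \<in> {0<..<t}" by (rule eventually_at_left_real[OF t])
      ultimately have "\<forall>\<^sub>F s in at_left t. h 0 < h s \<and> s \<in> {0<..<t}" by (rule eventually_conj)
      then show ?thesis by (auto dest!: eventually_happens)
    qed
    then obtain s1 where s1: "0 < s1" "s1 < t" "h 0 < h s1" by blast
    \<comment> \<open>The maximum of \<open>h\<close> may sit at the endpoint t. A multiple of
      \<open>flat 0 (s - s1)\<close> is zero up to s1, lowers the value at t below that at s1, and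
      can only increase the slope of \<open>\<theta>\<close>; the maximum of \<open>G\<close> is
      then strictly inside.\<close>
    have "flat 0 (t - s1) > 0" using s1 by (simp add: flat_def)
    then obtain K where K: "h t - h s1 < K * flat 0 (t - s1)" "K \<ge> 0"
    proof -
      assume *: "0 < flat 0 (t - s1)" and th: "\<And>K. h t - h s1 < K * flat 0 (t - s1) \<Longrightarrow> 0 \<le> K \<Longrightarrow> thesis"
      show thesis by (rule th[of "(\<bar>h t - h s1\<bar> + 1) / flat 0 (t - s1)"]) (use * in auto)
    qed
    define \<theta> where "\<theta> s = m' * s + K * flat 0 (s - s1)" for s
    have \<theta>: "(\<theta> has_real_derivative m' + K * flat 2 (s - s1)) (at s)" for s
    proof -
      have "((\<lambda>s. flat 0 (s - s1)) has_real_derivative flat 2 (s - s1) * 1) (at s)"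
        using flat_has_derivative[of 0 "s - s1"] by (intro DERIV_chain2[of "flat 0"]) (auto intro!: derivative_eq_intros simp: numeral_2_eq_2)
      then show ?thesis unfolding \<theta>_def by (auto intro!: derivative_eq_intros)
    qed
    have \<theta>': "m' + K * flat 2 (s - s1) > m" for s
    proof -
      have "K * flat 2 (s - s1) \<ge> 0" using K(2) by (simp add: flat_def)
      then show ?thesis using m'(1) by linarith
    qed
    have Cn\<theta>: "Cn_on 1 UNIV \<theta>"
      unfolding \<theta>_def[abs_def]
      by (intro Cn_on_add Cn_on_mult Cn_on_compose[OF _ _ _ Cn_on_flat] Cn_on_diff Cn_on_const Cn_on_id open_UNIV) auto
    define G where "G s = U (a + s *\<^sub>R v) - \<theta> s" for s
    have G: "G 0 < G s1" "G t < G s1"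
      using s1 K by (auto simp: G_def \<theta>_def h_def flat_def)
    \<comment> \<open>Coordinates adapted to the segment: \<open>\<sigma>\<close> is the parameter
      along v, \<open>w\<close> the component orthogonal to v, and \<open>Q\<close> below the solid
      cylinder of radius r around the segment.\<close>
    define \<sigma> where "\<sigma> y = (y - a) \<bullet> v / (v \<bullet> v)" for y
    define w where "w y = y - a - \<sigma> y *\<^sub>R v" for y
    have dec: "y = a + \<sigma> y *\<^sub>R v + w y" for y by (simp add: w_def)
    have wv: "w y \<bullet> v = 0" for y using v by (simp add: w_def \<sigma>_def inner_diff_left)
    have \<sigma>_eq: "\<sigma> (a + s *\<^sub>R v) = s" "w (a + s *\<^sub>R v) = 0" for s using v by (auto simp: \<sigma>_def w_def)
    have c\<sigma>: "continuous_on S \<sigma>" and cw: "continuous_on S w" for S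
    proof -
      show c\<sigma>: "continuous_on S \<sigma>" unfolding \<sigma>_def using v by (intro continuous_intros) auto
      show "continuous_on S w" unfolding w_def by (intro continuous_intros c\<sigma>)
    qed
    define Q where "Q = {y. \<sigma> y \<in> {0..t} \<and> w y \<in> cball 0 r}"
    have Qball: "Q \<subseteq> ball y0 R"
    proof
      fix y assume y: "y \<in> Q"
      then have "a + \<sigma> y *\<^sub>R v \<in> ball y0 (R - r)" by (intro seg) (auto simp: Q_def)
      moreover have "dist (a + \<sigma> y *\<^sub>R v) y \<le> r"
        using y by (subst (2) dec[of y]) (simp add: Q_def dist_norm)
      ultimately show "y \<in> ball y0 R" using dist_triangle[of y0 y "a + \<sigma> y *\<^sub>R v"] by simp
    qed
    have "closed Q"
      unfolding Q_def Collect_conj_eq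
      by (intro closed_Int closed_vimage[of _ \<sigma>, unfolded vimage_def] closed_vimage[of _ w, unfolded vimage_def] c\<sigma> cw) auto
    then have Q: "compact Q" using Qball bounded_subset[OF bounded_ball] by (auto simp: compact_eq_bounded_closed)
    have cU: "continuous_on Q U" by (rule continuous_on_subset[OF U Qball])
    have c\<theta>: "continuous_on Q (\<lambda>y. \<theta> (\<sigma> y))"
      by (rule continuous_on_compose2[OF Cn_on_continuous[OF Cn\<theta>] c\<sigma>]) auto
    \<comment> \<open>The maximum over \<open>Q\<close> will have axial parameter
      \<open>\<sigma> y\<close> with \<open>G (\<sigma> y)\<close> greater than
      \<open>G s1 - \<gamma>\<close>, provided U varies by less than \<open>\<gamma>\<close> between
      the maximum point and its projection to the axis; this excludes both ends of the
      cylinder.\<close>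
    define \<gamma> where "\<gamma> = min (G s1 - G 0) (G s1 - G t)"
    have \<gamma>: "\<gamma> > 0" using G by (simp add: \<gamma>_def)
    obtain \<delta> where \<delta>: "\<delta> > 0" "\<And>y z. y \<in> Q \<Longrightarrow> z \<in> Q \<Longrightarrow> dist z y < \<delta> \<Longrightarrow> dist (U z) (U y) < \<gamma>"
      using compact_uniformly_continuous[OF cU Q] \<gamma> unfolding uniformly_continuous_on_def by blast
    have "continuous_on Q (\<lambda>y. U y - \<theta> (\<sigma> y) - G s1)" by (intro continuous_intros cU c\<theta>)
    from compact_imp_bounded[OF compact_continuous_image[OF this Q]]
    obtain M where "\<forall>z\<in>(\<lambda>y. U y - \<theta> (\<sigma> y) - G s1) ` Q. norm z \<le> M" unfolding bounded_iff by (rule exE)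
    then have M: "U y - \<theta> (\<sigma> y) - G s1 \<le> M" if "y \<in> Q" for y using that by force
    define d where "d = min \<delta> r"
    have d: "d > 0" using \<delta>(1) r(1) by (simp add: d_def)
    \<comment> \<open>The penalty is so strong that a point of \<open>Q\<close> at distance d or
      more from the axis loses to \<open>a + s1 *\<^sub>R v\<close>.\<close>
    define N where "N = (\<bar>M\<bar> + 1) / d\<^sup>2"
    have N: "N > 0" "M < N * d\<^sup>2" using d by (auto simp: N_def)
    define \<Phi> where "\<Phi> y = \<theta> (\<sigma> y) + N * (w y \<bullet> w y)" for y
    have "continuous_on Q (\<lambda>y. U y - \<Phi> y)" unfolding \<Phi>_def by (intro continuous_intros cU c\<theta> cw)
    moreover have "a + s1 *\<^sub>R v \<in> Q" using s1 r \<sigma>_eq by (simp add: Q_def)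
    then have "Q \<noteq> {}" by blast
    ultimately obtain y where y: "y \<in> Q" "\<forall>z\<in>Q. U z - \<Phi> z \<le> U y - \<Phi> y"
      using continuous_attains_sup[OF Q] by blast
    have yG: "G s1 \<le> U y - \<theta> (\<sigma> y) - N * (w y \<bullet> w y)"
      using y(2)[rule_format, OF \<open>a + s1 *\<^sub>R v \<in> Q\<close>] by (simp add: \<Phi>_def \<sigma>_eq G_def algebra_simps)
    have "N * (norm (w y))\<^sup>2 < N * d\<^sup>2" using yG M[OF y(1)] N(2) by (simp add: dot_square_norm)
    then have "(norm (w y))\<^sup>2 < d\<^sup>2" using N(1) by simp
    then have wd: "norm (w y) < d" using d by (simp add: power_less_imp_less_base)
    have s: "0 \<le> \<sigma> y" "\<sigma> y \<le> t" using y(1) by (auto simp: Q_def)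
    have "a + \<sigma> y *\<^sub>R v \<in> Q" using s r(1) \<sigma>_eq by (simp add: Q_def)
    moreover have "dist y (a + \<sigma> y *\<^sub>R v) < \<delta>" using wd by (simp add: dist_norm w_def d_def algebra_simps)
    ultimately have "dist (U y) (U (a + \<sigma> y *\<^sub>R v)) < \<gamma>" using \<delta>(2) y(1) by blast
    then have "U y - \<theta> (\<sigma> y) < G (\<sigma> y) + \<gamma>" by (simp add: G_def dist_real_def)
    moreover have "N * (w y \<bullet> w y) \<ge> 0" using N(1) by simp
    ultimately have "G s1 < G (\<sigma> y) + \<gamma>" using yG by linarith
    then have "\<sigma> y \<noteq> 0" "\<sigma> y \<noteq> t" by (auto simp: \<gamma>_def)
    then have s': "\<sigma> y \<in> {0<..<t}" using s by auto
    let ?O = "\<sigma> -` {0<..<t} \<inter> w -` ball 0 r"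
    have "open ?O" by (intro open_Int open_vimage c\<sigma> cw) auto
    moreover have "y \<in> ?O" using s' wd by (simp add: d_def)
    ultimately have "\<forall>\<^sub>F z in nhds y. z \<in> ?O" by (rule eventually_nhds_in_open)
    then have ev: "\<forall>\<^sub>F z in nhds y. U z - \<Phi> z \<le> U y - \<Phi> y"
      by (rule eventually_mono) (use y(2) in \<open>auto simp: Q_def\<close>)
    have d\<sigma>: "(\<sigma> has_derivative (\<lambda>h. h \<bullet> v / (v \<bullet> v))) (at y)"
      unfolding \<sigma>_def using v by (auto intro!: derivative_eq_intros)
    have dw: "(w has_derivative (\<lambda>h. h - (h \<bullet> v / (v \<bullet> v)) *\<^sub>R v)) (at y)"
      unfolding w_def by (auto intro!: derivative_eq_intros d\<sigma>)
    have "((\<lambda>y. \<theta> (\<sigma> y)) has_derivative (\<lambda>h. (m' + K * flat 2 (\<sigma> y - s1)) * (h \<bullet> v / (v \<bullet> v)))) (at y)"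
      by (rule has_derivative_compose[OF d\<sigma>, of \<theta> "\<lambda>h. (m' + K * flat 2 (\<sigma> y - s1)) * h"])
        (use \<theta>[of "\<sigma> y"] in \<open>simp add: has_field_derivative_def\<close>)
    moreover have "((\<lambda>y. N * (w y \<bullet> w y)) has_derivative (\<lambda>h. N * (w y \<bullet> (h - (h \<bullet> v / (v \<bullet> v)) *\<^sub>R v) + (h - (h \<bullet> v / (v \<bullet> v)) *\<^sub>R v) \<bullet> w y))) (at y)"
      by (intro has_derivative_mult_right has_derivative_inner dw)
    ultimately have d\<Phi>: "(\<Phi> has_derivative (\<lambda>h. (m' + K * flat 2 (\<sigma> y - s1)) * (h \<bullet> v / (v \<bullet> v))
        + N * (w y \<bullet> (h - (h \<bullet> v / (v \<bullet> v)) *\<^sub>R v) + (h - (h \<bullet> v / (v \<bullet> v)) *\<^sub>R v) \<bullet> w y))) (at y)"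
      unfolding \<Phi>_def by (rule has_derivative_add)
    have C\<sigma>: "Cn_on 1 UNIV \<sigma>"
      unfolding \<sigma>_def[abs_def] divide_inverse
      by (intro Cn_on_mult Cn_on_inner Cn_on_diff Cn_on_const Cn_on_id open_UNIV)
    have Cw: "Cn_on 1 UNIV w"
      unfolding w_def[abs_def] by (intro Cn_on_diff Cn_on_scaleR C\<sigma> Cn_on_const Cn_on_id open_UNIV)
    have "Cn_on 1 UNIV \<Phi>"
      unfolding \<Phi>_def[abs_def]
      by (intro Cn_on_add Cn_on_mult Cn_on_inner Cw Cn_on_const Cn_on_compose[OF _ _ _ Cn\<theta> C\<sigma>] open_UNIV) auto
    from visc[OF _ this ev] y(1) Qball have "grad \<Phi> y \<bullet> v \<le> m" by blast
    \<comment> \<open>The penalty depends on \<open>w\<close> alone, which is constant along v, so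
      only the slope of \<open>\<theta>\<close> remains, and that exceeds m.\<close>
    moreover have "grad \<Phi> y \<bullet> v = m' + K * flat 2 (\<sigma> y - s1)"
      using grad_eq[OF d\<Phi>, of v] v by simp
    ultimately show False using \<theta>'[of "\<sigma> y"] by simp
  qed
qed

context hamiltonian
begin

text \<open>A test function given in coordinates is multiplied by a bump and extended by zero to the
  manifold. Near y the bump is 1, so the local maximum and the gradient are unaffected.\<close>

lemma viscosity_subsolution_chart:
  assumes u: "viscosity_subsolution A H lam u" and c: "c \<in> A" "y \<in> crange c"
    and \<Phi>: "Cn_on 1 UNIV \<Phi>" and max: "\<forall>\<^sub>F z in nhds y. u (cinv c z) - \<Phi> z \<le> u (cinv c y) - \<Phi> y"
  shows "lam * u (cinv c y) + Hc c y (grad \<Phi> y) \<le> 0"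
proof -
  let ?x = "cinv c y"
  have x: "?x \<in> cdom c" "cmap c ?x = y" using c by (simp_all add: cinv_in cmap_cinv)
  obtain r0 where r0: "r0 > 0" "cball y r0 \<subseteq> crange c" using open_contains_cball open_crange[OF c(1)] c(2) by blast
  define r where "r = r0 / 2"
  have r: "r > 0" "cball y (2 * r) \<subseteq> crange c" using r0 by (auto simp: r_def)
  define F where "F z = bump y r z * \<Phi> z" for z
  have CF: "Cn_on 1 S F" for S
    using Cn_on_mult[OF open_UNIV Cn_on_bump \<Phi>] Cn_on_subset unfolding F_def[abs_def] by blast
  have F0: "F z = 0" if "z \<notin> cball y (2 * r)" for z
    using bump_eq_0[OF r(1), of z y] that by (simp add: F_def dist_norm norm_minus_commute)
  have F1: "F z = \<Phi> z" if "z \<in> ball y r" for z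
    using bump_eq_1[OF r(1), of z y] that by (simp add: F_def dist_norm norm_minus_commute)
  let ?f = "extend c F"
  have f: "?f \<in> C_fun A 1"
    unfolding C_fun_def C_on_1 using extend_Cn_on[OF c(1) compact_cball r(2) CF F0] by blast
  have fF: "(?f \<circ> cinv c) z = \<Phi> z" if "z \<in> ball y r" for z
  proof -
    have "z \<in> crange c" using that r by (auto simp: subset_iff)
    then show ?thesis using c F1[OF that] by (simp add: extend_def cinv_in cmap_cinv)
  qed
  have "grad (?f \<circ> cinv c) y = grad \<Phi> y"
  proof (rule grad_unique)
    have "(\<Phi> has_derivative (\<lambda>h. grad \<Phi> y \<bullet> h)) (at y)"
      by (rule has_derivative_grad) (use \<Phi> in simp)
    then show "((?f \<circ> cinv c) has_derivative (\<lambda>h. grad \<Phi> y \<bullet> h)) (at y)"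
      by (rule has_derivative_transform_within_open[where s = "ball y r"]) (use fF r in auto)
  qed
  then have df: "differential A ?f ?x = cotangent_of A c ?x (grad \<Phi> y)"
    using differential_eq[OF f c(1) x(1)] x(2) by simp
  obtain X where X: "open X" "y \<in> X" "\<And>z. z \<in> X \<Longrightarrow> u (cinv c z) - \<Phi> z \<le> u ?x - \<Phi> y"
    using max by (auto simp: eventually_nhds)
  have op: "open (cmap c -` (X \<inter> ball y r) \<inter> cdom c)"
    using continuous_on_cmap[OF c(1)] X(1) continuous_on_open_vimage[OF open_cdom[OF c(1)]] by blast
  have "\<forall>\<^sub>F x' in nhds ?x. x' \<in> cmap c -` (X \<inter> ball y r) \<inter> cdom c"
    by (rule eventually_nhds_in_open[OF op]) (use x X r in auto)
  then have "\<forall>\<^sub>F x' in nhds ?x. u x' - ?f x' \<le> u ?x - ?f ?x"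
  proof (rule eventually_mono)
    fix x' assume x': "x' \<in> cmap c -` (X \<inter> ball y r) \<inter> cdom c"
    then show "u x' - ?f x' \<le> u ?x - ?f ?x"
      using X(3)[of "cmap c x'"] x F1 r(1) by (simp add: extend_def cinv_cmap c(1))
  qed
  then have "lam * u ?x + H ?x (differential A ?f ?x) \<le> 0"
    using u f unfolding viscosity_subsolution_def by blast
  then show ?thesis unfolding df using H_eq_Hc[OF c(1) x(1)] x(2) by simp
qed

lemma continuous_on_chart:
  "continuous_on UNIV u \<Longrightarrow> c \<in> A \<Longrightarrow> K \<subseteq> crange c \<Longrightarrow> continuous_on K (\<lambda>y. u (cinv c y))"
  by (rule continuous_on_compose2[OF _ continuous_on_subset[OF continuous_on_cinv]]) auto

(* By duality the equation says that DU.v <= L(.,v) - lam U for each fixed v, which is linear in DU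
   and hence preserved by averaging over translates, up to the modulus of continuity of L(.,v).
   Equality in Fenchel's inequality for some bounded v turns this back into an inequality for H. *)
lemma local_smooth_approximation:
  assumes u: "viscosity_subsolution A H lam u" and c: "c \<in> A" and R: "R > 0" "cball y0 (4 * R) \<subseteq> crange c"
    and \<epsilon>: "\<epsilon> > 0"
  obtains W where "\<And>n. Cn_on n UNIV W" "\<And>y. y \<in> cball y0 R \<Longrightarrow> \<bar>W y - u (cinv c y)\<bar> \<le> \<epsilon>"
    "\<And>y. y \<in> cball y0 R \<Longrightarrow> lam * W y + Hc c y (grad W y) \<le> \<epsilon>"
proof -
  define U where "U y = u (cinv c y)" for y
  have cu: "continuous_on UNIV u" using u by (simp add: viscosity_subsolution_def)
  have cU: "continuous_on S U" if "S \<subseteq> crange c" for S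
    unfolding U_def by (rule continuous_on_chart[OF cu c that])
  \<comment> \<open>The cut-off turns U into a compactly supported function on the whole coordinate
    space and agrees with it on the ball of radius 2 * R, where the averages are taken.\<close>
  define F where "F y = bump y0 (2 * R) y * U y" for y
  have F0: "F y = 0" if "y \<notin> ball y0 (4 * R)" for y
    using bump_eq_0[of "2 * R" y y0] that R(1) by (simp add: F_def dist_norm norm_minus_commute)
  have FU: "F y = U y" if "y \<in> cball y0 (2 * R)" for y
    using bump_eq_1[of "2 * R" y y0] that R(1) by (simp add: F_def dist_norm norm_minus_commute)
  obtain b :: 'e where b: "cball y0 (4 * R) \<subseteq> cbox (-b) b"
    using bounded_subset_cbox_symmetric[OF bounded_cball] by blast
  have Fb: "F z = 0" if "z \<notin> cbox (-b) b" for z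
    using b that ball_subset_cball[of y0 "4 * R"] by (intro F0) blast
  have cF: "continuous_on UNIV F"
  proof -
    have "continuous_on (crange c) F"
      unfolding F_def by (intro continuous_intros cU Cn_on_continuous[OF Cn_on_bump]) auto
    moreover have "continuous_on (- cball y0 (4 * R)) F"
      by (rule continuous_on_eq[OF continuous_on_const[of _ 0]])
        (use F0 ball_subset_cball[of y0 "4 * R"] in fastforce)
    ultimately have "continuous_on (crange c \<union> - cball y0 (4 * R)) F"
      by (intro continuous_on_open_Un open_crange c open_Compl closed_cball)
    moreover have "crange c \<union> - cball y0 (4 * R) = UNIV" using R(2) by blast
    ultimately show ?thesis by simp
  qed
  define K where "K = cball y0 (2 * R)"
  have K: "compact K" "K \<subseteq> crange c" using R by (auto simp: K_def subset_iff)
  have ucU: "uniformly_continuous_on K U" by (rule compact_uniformly_continuous[OF cU[OF K(2)] K(1)])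
  have close: "\<exists>\<eta>0>0. 2 * \<eta>0 \<le> R \<and> (\<forall>y\<in>K. \<forall>z\<in>K. dist z y < 2 * \<eta>0 \<longrightarrow> \<bar>U z - U y\<bar> < e)" if "e > 0" for e
  proof -
    obtain d where d: "d > 0" "\<And>y z. y \<in> K \<Longrightarrow> z \<in> K \<Longrightarrow> dist z y < d \<Longrightarrow> dist (U z) (U y) < e"
      using ucU \<open>e > 0\<close> unfolding uniformly_continuous_on_def by blast
    show ?thesis
      by (rule exI[of _ "min d R / 2"]) (use d R(1) in \<open>auto simp: dist_real_def\<close>)
  qed
  \<comment> \<open>Naming these properties keeps the radius open until \<open>stage\<close> has
    been applied twice. Velocities of length at most 1 bound the gradient of W by P; that bound
    determines N, the size of the velocities giving equality in Fenchel's inequality, and the second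
    application admits velocities up to N.\<close>
  define good where "good W \<eta> \<longleftrightarrow>
      (\<forall>y M. (\<forall>z. dist z y < \<eta> \<longrightarrow> F z \<le> M) \<longrightarrow> W y \<le> M) \<and>
      (\<forall>y M. (\<forall>z. dist z y < \<eta> \<longrightarrow> M \<le> F z) \<longrightarrow> M \<le> W y) \<and>
      (\<forall>y h M. (\<forall>z. dist z y < \<eta> \<longrightarrow> F (z + h) - F z \<le> M) \<longrightarrow> W (y + h) - W y \<le> M)" for W \<eta>
  have goodD: "(\<And>z. dist z y < \<eta> \<Longrightarrow> F z \<le> M) \<Longrightarrow> W y \<le> M"
      "(\<And>z. dist z y < \<eta> \<Longrightarrow> M \<le> F z) \<Longrightarrow> M \<le> W y"
      "(\<And>z. dist z y < \<eta> \<Longrightarrow> F (z + h) - F z \<le> M) \<Longrightarrow> W (y + h) - W y \<le> M" if "good W \<eta>" for W \<eta> y M h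
    using that unfolding good_def by blast+
  have stage0: "\<bar>W y - U y\<bar> \<le> e" if W: "good W \<eta>" and y: "y \<in> cball y0 R" and \<eta>: "\<eta> \<le> R"
      and e: "\<forall>y\<in>K. \<forall>z\<in>K. dist z y < \<eta> \<longrightarrow> \<bar>U z - U y\<bar> < e" for W \<eta> y e
  proof -
    have "F z = U z" "\<bar>U z - U y\<bar> < e" if "dist z y < \<eta>" for z
    proof -
      have "z \<in> K" using that y \<eta> dist_triangle[of y0 z y] by (simp add: K_def dist_commute)
      moreover have "y \<in> K" using y R(1) by (simp add: K_def)
      ultimately show "F z = U z" "\<bar>U z - U y\<bar> < e" using e that FU by (auto simp: K_def)
    qed
    then have "W y \<le> U y + e" "U y - e \<le> W y"
      by (intro goodD(1)[OF W] goodD(2)[OF W]; fastforce)+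
    then show ?thesis by linarith
  qed
  have stage: "\<exists>\<eta>0>0. \<forall>\<eta> W y v. 0 < \<eta> \<longrightarrow> \<eta> \<le> \<eta>0 \<longrightarrow> good W \<eta> \<longrightarrow> Cn_on 1 UNIV W \<longrightarrow> y \<in> cball y0 R \<longrightarrow> norm v \<le> N \<longrightarrow>
      \<bar>W y - U y\<bar> \<le> e \<and> grad W y \<bullet> v \<le> Lc c y v - lam * W y + e" if e: "e > 0" for N e
  proof -
    \<comment> \<open>The budget e is spent in quarters: one on the modulus of continuity of
      \<open>Lc\<close>, one on replacing \<open>lam * U z\<close> by \<open>lam * U y\<close>, one
      on replacing \<open>lam * U y\<close> by \<open>lam * W y\<close>.\<close>
    define e1 where "e1 = min e (e / (4 * lam))"
    have e1: "e1 > 0" "e1 \<le> e" "lam * e1 \<le> e / 4" using e lam by (auto simp: e1_def min_def field_simps)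
    obtain \<eta>1 where \<eta>1: "\<eta>1 > 0" "2 * \<eta>1 \<le> R" "\<forall>y\<in>K. \<forall>z\<in>K. dist z y < 2 * \<eta>1 \<longrightarrow> \<bar>U z - U y\<bar> < e1"
      using close[OF e1(1)] by blast
    have "e / 4 > 0" using e by simp
    then obtain \<eta>2 where \<eta>2: "\<eta>2 > 0" "\<forall>y\<in>K. \<forall>z\<in>K. dist y z < \<eta>2 \<longrightarrow> (\<forall>v. norm v \<le> N \<longrightarrow> Lc c z v \<le> Lc c y v + e / 4)"
      using Lc_uniformly_continuous[OF c K] by blast
    \<comment> \<open>Averaging uses points within \<eta> of y, with \<eta> at most
      \<open>\<eta>0\<close>, and increments shorter than \<open>\<eta>0\<close>, so everything
      happens in the ball of radius 2 * \<open>\<eta>0\<close>.\<close>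
    define \<eta>0 where "\<eta>0 = min \<eta>1 (\<eta>2 / 2)"
    have \<eta>0: "\<eta>0 > 0" "2 * \<eta>0 \<le> R" "2 * \<eta>0 \<le> 2 * \<eta>1" "2 * \<eta>0 \<le> \<eta>2" using \<eta>1 \<eta>2 by (auto simp: \<eta>0_def)
    show ?thesis
    proof (intro exI[of _ \<eta>0] conjI allI impI \<eta>0(1))
      fix \<eta> W y and v :: 'e assume *: "0 < \<eta>" "\<eta> \<le> \<eta>0" "good W \<eta>" "Cn_on 1 UNIV W" "y \<in> cball y0 R" "norm v \<le> N"
      have We1: "\<bar>W y - U y\<bar> \<le> e1"
        by (rule stage0[OF *(3,5)]) (use * \<eta>0 \<eta>1 in auto)
      then show "\<bar>W y - U y\<bar> \<le> e" using e1 by simp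
      have yK: "y \<in> K" using *(5) R(1) by (simp add: K_def)
      have BK: "z \<in> K" if "z \<in> ball y (2 * \<eta>0)" for z
        using that *(5) \<eta>0(2) dist_triangle[of y0 z y] by (simp add: K_def dist_commute)
      define m where "m = Lc c y v - lam * U y + e / 2"
      have dir: "U (a + t *\<^sub>R v) \<le> U a + t * m"
        if "a \<in> ball y (2 * \<eta>0)" "a + t *\<^sub>R v \<in> ball y (2 * \<eta>0)" "t \<ge> 0" for a t
      proof (rule viscosity_directional[OF cU _ that])
        show "ball y (2 * \<eta>0) \<subseteq> crange c" using BK K(2) by blast
        fix z \<Phi> assume z: "z \<in> ball y (2 * \<eta>0)" and \<Phi>: "Cn_on 1 UNIV \<Phi>" and ev: "\<forall>\<^sub>F z' in nhds z. U z' - \<Phi> z' \<le> U z - \<Phi> z"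
        have zc: "z \<in> crange c" using BK[OF z] K(2) by blast
        have "lam * U z + Hc c z (grad \<Phi> z) \<le> 0"
          using viscosity_subsolution_chart[OF u c zc \<Phi>] ev by (simp add: U_def)
        moreover have "grad \<Phi> z \<bullet> v \<le> Lc c z v + Hc c z (grad \<Phi> z)" by (rule Fenchel[OF c zc])
        moreover have "Lc c z v \<le> Lc c y v + e / 4"
          using \<eta>2(2) yK BK[OF z] *(6) z \<eta>0(4) by auto
        moreover have "lam * U y - lam * U z \<le> e / 4"
        proof -
          have "\<bar>U z - U y\<bar> < e1" using \<eta>1(3) yK BK[OF z] z \<eta>0(3) by (auto simp: dist_commute)
          then have "lam * (U y - U z) \<le> lam * e1" using lam by (intro mult_left_mono) auto
          then show ?thesis using e1(3) by (simp add: right_diff_distrib)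
        qed
        ultimately show "grad \<Phi> z \<bullet> v \<le> m" unfolding m_def by linarith
      qed
      have "grad W y \<bullet> v \<le> m"
      proof (rule grad_inner_le)
        show "W differentiable (at y)" using *(4) by simp
        have "((\<lambda>t. norm (t *\<^sub>R v)) \<longlongrightarrow> norm ((0::real) *\<^sub>R v)) (at_right 0)" by (intro tendsto_intros)
        then have "((\<lambda>t::real. norm (t *\<^sub>R v)) \<longlongrightarrow> 0) (at_right 0)" by simp
        then have "\<forall>\<^sub>F t::real in at_right 0. norm (t *\<^sub>R v) < \<eta>0" using \<eta>0(1) by (rule order_tendstoD)
        then show "\<forall>\<^sub>F t in at_right 0. W (y + t *\<^sub>R v) - W y \<le> t * m"
          using eventually_at_right_less[of "0::real"]
        proof eventually_elim
          case (elim t)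
          show ?case
          proof (rule goodD(3)[OF *(3)])
            fix z assume z: "dist z y < \<eta>"
            then have 1: "z \<in> ball y (2 * \<eta>0)" using *(2) \<eta>0(1) by (simp add: dist_commute)
            have "dist (z + t *\<^sub>R v) z < \<eta>0" using elim(1) by (simp add: dist_norm)
            then have 2: "z + t *\<^sub>R v \<in> ball y (2 * \<eta>0)"
              using z *(2) dist_triangle[of y "z + t *\<^sub>R v" z] by (simp add: dist_commute)
            show "F (z + t *\<^sub>R v) - F z \<le> t * m"
              using dir[OF 1 2] elim(2) FU[of z] FU[of "z + t *\<^sub>R v"] BK[OF 1] BK[OF 2] by (simp add: K_def)
          qed
        qed
      qed
      moreover have "lam * W y \<le> lam * U y + e / 4"
      proof -
        have "lam * (W y - U y) \<le> lam * e1" using lam We1 by (intro mult_left_mono) auto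
        then show ?thesis using e1(3) by (simp add: right_diff_distrib)
      qed
      ultimately show "grad W y \<bullet> v \<le> Lc c y v - lam * W y + e" using e unfolding m_def by linarith
    qed
  qed
  obtain C where C: "\<And>y v. y \<in> K \<Longrightarrow> norm v \<le> 1 \<Longrightarrow> Lc c y v \<le> C" using Lc_le[OF c K] by blast
  from compact_imp_bounded[OF compact_continuous_image[OF cU[OF K(2)] K(1)]]
  obtain M where "\<forall>w\<in>U ` K. norm w \<le> M" unfolding bounded_iff by (rule exE)
  then have M: "\<bar>U y\<bar> \<le> M" if "y \<in> K" for y using that by auto
  define P where "P = C + lam * (M + \<epsilon>) + \<epsilon>"
  obtain N where N: "\<And>y q v. y \<in> K \<Longrightarrow> norm q \<le> \<bar>P\<bar> \<Longrightarrow> Lc c y v = q \<bullet> v - Hc c y q \<Longrightarrow> norm v \<le> N"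
    using Fenchel_equality_bounded[OF c K] by metis
  obtain \<eta>1 where \<eta>1: "\<eta>1 > 0" "\<And>\<eta> W y v. 0 < \<eta> \<Longrightarrow> \<eta> \<le> \<eta>1 \<Longrightarrow> good W \<eta> \<Longrightarrow> Cn_on 1 UNIV W \<Longrightarrow> y \<in> cball y0 R \<Longrightarrow> norm v \<le> 1 \<Longrightarrow>
      \<bar>W y - U y\<bar> \<le> \<epsilon> \<and> grad W y \<bullet> v \<le> Lc c y v - lam * W y + \<epsilon>"
    using stage[OF \<epsilon>, of 1] by blast
  obtain \<eta>2 where \<eta>2: "\<eta>2 > 0" "\<And>\<eta> W y v. 0 < \<eta> \<Longrightarrow> \<eta> \<le> \<eta>2 \<Longrightarrow> good W \<eta> \<Longrightarrow> Cn_on 1 UNIV W \<Longrightarrow> y \<in> cball y0 R \<Longrightarrow> norm v \<le> N \<Longrightarrow>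
      \<bar>W y - U y\<bar> \<le> \<epsilon> \<and> grad W y \<bullet> v \<le> Lc c y v - lam * W y + \<epsilon>"
    using stage[OF \<epsilon>, of N] by blast
  define \<eta> where "\<eta> = min \<eta>1 \<eta>2"
  have \<eta>: "0 < \<eta>" "\<eta> \<le> \<eta>1" "\<eta> \<le> \<eta>2" using \<eta>1(1) \<eta>2(1) by (auto simp: \<eta>_def)
  obtain W where CW: "\<And>n. Cn_on n UNIV W" and "\<And>y M. (\<And>z. dist z y < \<eta> \<Longrightarrow> F z \<le> M) \<Longrightarrow> W y \<le> M"
    "\<And>y M. (\<And>z. dist z y < \<eta> \<Longrightarrow> M \<le> F z) \<Longrightarrow> M \<le> W y"
    "\<And>y h M. (\<And>z. dist z y < \<eta> \<Longrightarrow> F (z + h) - F z \<le> M) \<Longrightarrow> W (y + h) - W y \<le> M"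
    using mollifier[OF cF Fb \<eta>(1)] by metis
  then have gW: "good W \<eta>" unfolding good_def by blast
  show thesis
  proof (rule that[of W, OF CW])
    fix y assume y: "y \<in> cball y0 R"
    then have yK: "y \<in> K" using R(1) by (simp add: K_def)
    then have yc: "y \<in> crange c" using K(2) by blast
    have We: "\<bar>W y - U y\<bar> \<le> \<epsilon>" using \<eta>1(2)[OF \<eta>(1,2) gW CW y, of 0] by simp
    then show "\<bar>W y - u (cinv c y)\<bar> \<le> \<epsilon>" by (simp add: U_def)
    have "norm (grad W y) \<le> P"
    \<comment> \<open>A zero gradient has no direction to normalise; the velocity 0 then shows that
      P is nonnegative.\<close>
    proof (cases "grad W y = 0")
      case True
      have "grad W y \<bullet> 0 \<le> Lc c y 0 - lam * W y + \<epsilon>" using \<eta>1(2)[OF \<eta>(1,2) gW CW y, of 0] by simp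
      moreover have "Lc c y 0 \<le> C" by (rule C[OF yK]) simp
      moreover have "lam * (- W y) \<le> lam * (M + \<epsilon>)" using We M[OF yK] lam by (intro mult_left_mono) linarith+
      ultimately show ?thesis using True by (simp add: P_def)
    next
      case False
      let ?v = "(1 / norm (grad W y)) *\<^sub>R grad W y"
      have nv: "norm ?v \<le> 1" using False by simp
      have "grad W y \<bullet> ?v = norm (grad W y)" using False by (simp add: dot_square_norm power2_eq_square)
      moreover have "grad W y \<bullet> ?v \<le> Lc c y ?v - lam * W y + \<epsilon>" using \<eta>1(2)[OF \<eta>(1,2) gW CW y nv] by simp
      moreover have "Lc c y ?v \<le> C" by (rule C[OF yK nv])
      moreover have "lam * (- W y) \<le> lam * (M + \<epsilon>)" using We M[OF yK] lam by (intro mult_left_mono) linarith+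
      ultimately show ?thesis by (simp add: P_def)
    qed
    then have nP: "norm (grad W y) \<le> \<bar>P\<bar>" by simp
    obtain v where v: "Lc c y v = grad W y \<bullet> v - Hc c y (grad W y)" using Fenchel_equality[OF c yc] by blast
    have "norm v \<le> N" by (rule N[OF yK nP v])
    then have "grad W y \<bullet> v \<le> Lc c y v - lam * W y + \<epsilon>" using \<eta>2(2)[OF \<eta>(1,3) gW CW y] by simp
    then show "lam * W y + Hc c y (grad W y) \<le> \<epsilon>" using v by simp
  qed
qed

end

section \<open>Global smooth approximation\<close>

context manifold
begin

section \<open>Smooth functions and partitions of unity on the manifold\<close>

lemma C_fun_infinity_sum:
  "(\<And>i. i \<in> I \<Longrightarrow> f i \<in> C_fun A \<infinity>) \<Longrightarrow> (\<lambda>x. \<Sum>i\<in>I. f i x) \<in> C_fun A \<infinity>"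
  unfolding C_fun_infinity o_def by (auto intro!: Cn_on_sum open_crange simp del: Cn_on.simps)

lemma C_fun_infinity_divide:
  "f \<in> C_fun A \<infinity> \<Longrightarrow> h \<in> C_fun A \<infinity> \<Longrightarrow> (\<And>x. h x \<noteq> 0) \<Longrightarrow> (\<lambda>x. f x / h x) \<in> C_fun A \<infinity>"
  unfolding C_fun_infinity o_def by (auto intro!: Cn_on_divide open_crange simp del: Cn_on.simps)

lemma C_fun_infinity_diff_const:
  "f \<in> C_fun A \<infinity> \<Longrightarrow> (\<lambda>x. f x - k) \<in> C_fun A \<infinity>"
  unfolding C_fun_infinity o_def by (auto intro!: Cn_on_diff open_crange simp del: Cn_on.simps)

lemma differential_diff_const:
  assumes f: "f \<in> C_fun A \<infinity>"
  shows "differential A (\<lambda>x. f x - k) x = differential A f x"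
proof -
  obtain c where c: "c \<in> A" "x \<in> cdom c" using ex_chart by blast
  have f1: "f \<in> C_fun A 1" "(\<lambda>x. f x - k) \<in> C_fun A 1"
    using f C_fun_infinity_diff_const[OF f] by (auto intro: C_fun_infinity_imp_1)
  have "((f \<circ> cinv c) has_derivative (\<lambda>h. grad (f \<circ> cinv c) (cmap c x) \<bullet> h)) (at (cmap c x))"
    by (rule has_derivative_grad) (use C_fun_Cn_on[OF f1(1) c(1)] c(2) in auto)
  then have "(((\<lambda>x. f x - k) \<circ> cinv c) has_derivative (\<lambda>h. grad (f \<circ> cinv c) (cmap c x) \<bullet> h)) (at (cmap c x))"
    unfolding o_def by (rule has_derivative_eq_rhs[OF has_derivative_diff[OF _ has_derivative_const]]) simp
  from grad_unique[OF this] show ?thesis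
    using differential_eq[OF f1(1) c] differential_eq[OF f1(2) c] by simp
qed

lemma open_chart_preimage: "c \<in> A \<Longrightarrow> open X \<Longrightarrow> open {x \<in> cdom c. cmap c x \<in> X}"
  using continuous_on_cmap[of c] continuous_on_open_vimage[OF open_cdom, of c "cmap c"]
  by (auto simp: vimage_def Int_def conj_commute)

lemma closed_chart_preimage:
  assumes "c \<in> A" "compact K" "K \<subseteq> crange c"
  shows "closed {x \<in> cdom c. cmap c x \<in> K}"
proof -
  have "{x \<in> cdom c. cmap c x \<in> K} = cinv c ` K"
  proof (intro set_eqI iffI)
    fix x assume "x \<in> {x \<in> cdom c. cmap c x \<in> K}"
    then show "x \<in> cinv c ` K" using cinv_cmap[OF assms(1), of x] by (metis (mono_tags, lifting) imageI mem_Collect_eq)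
  next
    fix x assume "x \<in> cinv c ` K"
    then obtain z where "z \<in> K" "x = cinv c z" by blast
    then show "x \<in> {x \<in> cdom c. cmap c x \<in> K}"
      using assms(3) cinv_in[OF assms(1), of z] cmap_cinv[OF assms(1), of z] by auto
  qed
  moreover have "compact (cinv c ` K)"
    using assms by (intro compact_continuous_image continuous_on_subset[OF continuous_on_cinv])
  ultimately show ?thesis by (simp add: compact_imp_closed)
qed

text \<open>Bumps in finitely many charts are divided by their sum; the indices are points of the
  manifold. A bump of radius r lives in the ball of radius 2 * r, which becomes the radius in the
  statement. The fourfold ball is the room that \<open>local_smooth_approximation\<close> requires,
  hence 8 * r at the start.\<close>

lemma partition_of_unity:
  obtains F :: "'m set" and c y r \<theta> where "finite F"
    "\<And>i. i \<in> F \<Longrightarrow> c i \<in> A" "\<And>i. i \<in> F \<Longrightarrow> r i > 0" "\<And>i. i \<in> F \<Longrightarrow> cball (y i) (4 * r i) \<subseteq> crange (c i)"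
    "\<And>i. i \<in> F \<Longrightarrow> \<theta> i \<in> C_fun A \<infinity>" "\<And>i x. i \<in> F \<Longrightarrow> \<theta> i x \<ge> 0" "\<And>x. (\<Sum>i\<in>F. \<theta> i x) = (1 :: real)"
    "\<And>i x. i \<in> F \<Longrightarrow> \<not> (x \<in> cdom (c i) \<and> cmap (c i) x \<in> cball (y i) (r i)) \<Longrightarrow> \<theta> i x = 0"
proof -
  have "\<exists>c r. c \<in> A \<and> x \<in> cdom c \<and> r > 0 \<and> cball (cmap c x) (8 * r) \<subseteq> crange c" for x
  proof -
    obtain c where c: "c \<in> A" "x \<in> cdom c" using ex_chart by blast
    then obtain r where "r > 0" "cball (cmap c x) r \<subseteq> crange c"
      using open_contains_cball open_crange by (metis imageI)
    with c show ?thesis by (intro exI[of _ c] exI[of _ "r / 8"]) auto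
  qed
  then obtain c r where c: "\<And>x. c x \<in> A" "\<And>x. x \<in> cdom (c x)" and r: "\<And>x. r x > 0"
    "\<And>x. cball (cmap (c x) x) (8 * r x) \<subseteq> crange (c x)"
    by metis
  define y where "y x = cmap (c x) x" for x
  define \<beta> where "\<beta> i = extend (c i) (bump (y i) (r i))" for i
  have K: "cball (y i) (2 * r i) \<subseteq> crange (c i)" for i
    using r(2)[of i] r(1)[of i] by (auto simp: y_def subset_iff)
  have \<beta>C: "\<beta> i \<in> C_fun A \<infinity>" for i
    unfolding C_fun_infinity \<beta>_def
  proof (intro ballI allI extend_Cn_on[OF c(1) compact_cball K Cn_on_bump])
    fix z assume "z \<notin> cball (y i) (2 * r i)"
    then show "bump (y i) (r i) z = 0" using r(1)[of i] by (intro bump_eq_0) (auto simp: dist_norm norm_minus_commute)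
  qed
  have \<beta>pos: "\<beta> i x \<ge> 0" for i x by (simp add: \<beta>_def extend_def bump_nonneg)
  have \<beta>0: "\<beta> i x = 0" if "\<not> (x \<in> cdom (c i) \<and> cmap (c i) x \<in> cball (y i) (2 * r i))" for i x
    using that r(1)[of i] by (auto simp: \<beta>_def extend_def dist_norm norm_minus_commute intro!: bump_eq_0)
  define N where "N i = {x \<in> cdom (c i). cmap (c i) x \<in> ball (y i) (r i)}" for i
  have oN: "open (N i)" for i unfolding N_def by (rule open_chart_preimage[OF c(1) open_ball])
  have "i \<in> N i" for i using c(2) r(1) by (simp add: N_def y_def)
  then have cov: "UNIV \<subseteq> (\<Union>i\<in>UNIV. N i)" by blast
  obtain F where F: "F \<subseteq> UNIV" "finite F" "UNIV \<subseteq> (\<Union>i\<in>F. N i)"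
    by (rule compactE_image[OF compact_UNIV oN cov])
  have \<beta>1: "\<beta> i x = 1" if "x \<in> N i" for i x
    using that r(1)[of i] by (auto simp: N_def \<beta>_def extend_def dist_norm norm_minus_commute intro!: bump_eq_1)
  have \<sigma>: "(\<Sum>i\<in>F. \<beta> i x) > 0" for x
  proof -
    obtain i where "i \<in> F" "x \<in> N i" using F(3) by blast
    then show ?thesis using F(2) \<beta>pos \<beta>1[of x i] by (intro sum_pos2[of F i]) auto
  qed
  define \<theta> where "\<theta> i x = \<beta> i x / (\<Sum>i\<in>F. \<beta> i x)" for i x
  show thesis
  proof (rule that[of F c "\<lambda>i. 2 * r i" y \<theta>])
    show "\<theta> i \<in> C_fun A \<infinity>" for i
      unfolding \<theta>_def using \<sigma> by (intro C_fun_infinity_divide C_fun_infinity_sum \<beta>C) (metis less_irrefl)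
    show "(\<Sum>i\<in>F. \<theta> i x) = 1" for x
      using \<sigma>[of x] by (simp add: \<theta>_def sum_divide_distrib[symmetric])
    show "\<theta> i x \<ge> 0" for i x using \<beta>pos[of i x] \<sigma>[of x] by (simp add: \<theta>_def)
    show "\<theta> i x = 0" if "\<not> (x \<in> cdom (c i) \<and> cmap (c i) x \<in> cball (y i) (2 * r i))" for i x
      using \<beta>0[OF that] by (simp add: \<theta>_def)
    show "cball (y i) (4 * (2 * r i)) \<subseteq> crange (c i)" for i using r(2)[of i] by (simp add: y_def)
  qed (use F c r in auto)
qed

text \<open>Approximations made in different charts have to be combined in a single one; pulling W
  back by the transition map leaves its covector at x unchanged.\<close>

lemma cotangent_of_change_chart:
  assumes c: "c \<in> A" "x \<in> cdom c" and d: "d \<in> A" "x \<in> cdom d"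
    and W: "W differentiable (at (cmap d x))"
  shows "((\<lambda>z. W (transition c d z)) has_derivative (\<lambda>h. grad (\<lambda>z. W (transition c d z)) (cmap c x) \<bullet> h)) (at (cmap c x))"
    and "cotangent_of A d x (grad W (cmap d x)) = cotangent_of A c x (grad (\<lambda>z. W (transition c d z)) (cmap c x))"
proof -
  have "(W has_derivative (\<lambda>h. grad W (cmap d x) \<bullet> h)) (at (transition c d (cmap c x)))"
    using has_derivative_grad[OF W] c by (simp add: cinv_cmap)
  from has_derivative_compose[OF transition_has_derivative[OF c(1) d(1) c(2) d(2)] this]
  have D: "((\<lambda>z. W (transition c d z)) has_derivative (\<lambda>h. grad W (cmap d x) \<bullet> Dtrans c d x h)) (at (cmap c x))" .
  then show "((\<lambda>z. W (transition c d z)) has_derivative (\<lambda>h. grad (\<lambda>z. W (transition c d z)) (cmap c x) \<bullet> h)) (at (cmap c x))"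
    by (intro has_derivative_grad) (auto simp: differentiable_def)
  show "cotangent_of A d x (grad W (cmap d x)) = cotangent_of A c x (grad (\<lambda>z. W (transition c d z)) (cmap c x))"
  proof (rule cotangent_eqI[OF c])
    show "cotangent_of A d x (grad W (cmap d x)) v = 0" if "v \<notin> tangent_space A x" for v
      using that by (simp add: cotangent_of_def)
    show "cotangent_of A d x (grad W (cmap d x)) (tangent_of A c x e) = grad (\<lambda>z. W (transition c d z)) (cmap c x) \<bullet> e" for e
      using grad_eq[OF D, of e] tangent_of_in[OF c, of e] tangent_of_apply[OF d, of c e]
      by (simp add: cotangent_of_def)
  qed
qed

end

context hamiltonian
begin

(* The differential of w = sum theta_i W_i is the convex combination sum theta_i dW_i, to which
   convexity of H applies, plus sum (W_i - u) d(theta_i), which is small since sum d(theta_i) = 0. *)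
lemma global_smooth_approximation:
  assumes u: "viscosity_subsolution A H lam u" and \<epsilon>: "\<epsilon> > 0"
  shows "\<exists>w\<in>C_fun A \<infinity>. (\<forall>x. \<bar>w x - u x\<bar> \<le> \<epsilon>) \<and> (\<forall>x. lam * w x + H x (differential A w x) \<le> 0)"
proof -
  obtain F :: "'m set" and c y r \<theta> where F: "finite F"
    and c: "\<And>i. i \<in> F \<Longrightarrow> c i \<in> A" and r: "\<And>i. i \<in> F \<Longrightarrow> r i > 0" "\<And>i. i \<in> F \<Longrightarrow> cball (y i) (4 * r i) \<subseteq> crange (c i)"
    and \<theta>: "\<And>i. i \<in> F \<Longrightarrow> \<theta> i \<in> C_fun A \<infinity>" "\<And>i x. i \<in> F \<Longrightarrow> \<theta> i x \<ge> 0" "\<And>x. (\<Sum>i\<in>F. \<theta> i x) = (1 :: real)"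
    and \<theta>0: "\<And>i x. i \<in> F \<Longrightarrow> \<not> (x \<in> cdom (c i) \<and> cmap (c i) x \<in> cball (y i) (r i)) \<Longrightarrow> \<theta> i x = 0"
    by (rule partition_of_unity) (rule that; assumption)
  define K where "K i = cball (y i) (r i)" for i
  define S where "S i = {x \<in> cdom (c i). cmap (c i) x \<in> K i}" for i
  have K: "compact (K i)" "K i \<subseteq> crange (c i)" if "i \<in> F" for i
    using r(1)[OF that] r(2)[OF that] by (auto simp: K_def subset_iff)
  have \<theta>S: "\<theta> i x = 0" if "i \<in> F" "x \<notin> S i" for i x using \<theta>0[OF that(1)] that(2) by (auto simp: S_def K_def)
  have cover: "\<exists>j\<in>F. x \<in> S j" for x
  proof (rule ccontr)
    assume "\<not> (\<exists>j\<in>F. x \<in> S j)"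
    then have "(\<Sum>i\<in>F. \<theta> i x) = 0" using \<theta>S by (intro sum.neutral) auto
    with \<theta>(3)[of x] show False by simp
  qed
  have Sx: "x \<in> cdom (c i)" "cmap (c i) x \<in> K i" if "x \<in> S i" for i x using that by (auto simp: S_def)
  have clS: "closed (S i)" if "i \<in> F" for i
    unfolding S_def by (rule closed_chart_preimage[OF c[OF that] K[OF that]])
  have cu: "continuous_on UNIV u" using u by (simp add: viscosity_subsolution_def)
  from compact_imp_bounded[OF compact_continuous_image[OF cu compact_UNIV]]
  obtain M where "\<forall>v\<in>range u. norm v \<le> M" unfolding bounded_iff by (rule exE)
  then have M: "\<bar>u x\<bar> \<le> M" for x by auto
  \<comment> \<open>The accuracy \<delta> will be dictated by constants belonging to each chart, so
    the facts below hold for every family W of given accuracy, and W is chosen only at the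
    end.\<close>
  define approx where "approx \<delta> W \<longleftrightarrow> (\<forall>i\<in>F. (\<forall>n. Cn_on n UNIV (W i)) \<and>
      (\<forall>z\<in>K i. \<bar>W i z - u (cinv (c i) z)\<bar> \<le> \<delta> \<and> lam * W i z + Hc (c i) z (grad (W i) z) \<le> \<delta>))" for \<delta> and W :: "'m \<Rightarrow> 'e \<Rightarrow> real"
  define w where "w W x = (\<Sum>i\<in>F. extend (c i) (\<lambda>z. \<theta> i (cinv (c i) z) * W i z) x)" for W x
  have w_eq: "w W x = (\<Sum>i\<in>{i\<in>F. x \<in> S i}. \<theta> i x * W i (cmap (c i) x))" for W x
  proof -
    have "w W x = (\<Sum>i\<in>F. if x \<in> S i then \<theta> i x * W i (cmap (c i) x) else 0)"
      unfolding w_def by (rule sum.cong) (auto simp: extend_def cinv_cmap c \<theta>S Sx)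
    then show ?thesis using F by (simp add: sum.inter_filter)
  qed
  have wC: "w W \<in> C_fun A \<infinity>" if W: "approx \<delta> W" for W \<delta>
    unfolding w_def
  proof (rule C_fun_infinity_sum)
    fix i assume i: "i \<in> F"
    show "extend (c i) (\<lambda>z. \<theta> i (cinv (c i) z) * W i z) \<in> C_fun A \<infinity>"
      unfolding C_fun_infinity
    proof (intro ballI allI extend_Cn_on[OF c[OF i] K[OF i]])
      fix n
      have "Cn_on n (crange (c i)) (W i)" using W i Cn_on_subset unfolding approx_def by blast
      moreover have "Cn_on n (crange (c i)) (\<lambda>z. \<theta> i (cinv (c i) z))"
        using \<theta>(1)[OF i] c[OF i] unfolding C_fun_infinity o_def by blast
      ultimately show "Cn_on n (crange (c i)) (\<lambda>z. \<theta> i (cinv (c i) z) * W i z)"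
        by (intro Cn_on_mult open_crange c i)
    next
      fix z assume z: "z \<in> crange (c i)" "z \<notin> K i"
      then have "cinv (c i) z \<notin> S i" using c[OF i] by (auto simp: S_def cmap_cinv)
      then show "\<theta> i (cinv (c i) z) * W i z = 0" using \<theta>S[OF i] by simp
    qed
  qed
  have w_close: "\<bar>w W x - u x\<bar> \<le> \<delta>" if W: "approx \<delta> W" for W \<delta> x
  proof -
    let ?I = "{i\<in>F. x \<in> S i}"
    have s1: "(\<Sum>i\<in>?I. \<theta> i x) = 1"
      using \<theta>(3)[of x] F \<theta>S by (subst (asm) sum.mono_neutral_right[of F ?I]) auto
    have "w W x - u x = (\<Sum>i\<in>?I. \<theta> i x * (W i (cmap (c i) x) - u x))"
      by (simp add: w_eq right_diff_distrib sum_subtractf sum_distrib_right[symmetric] s1)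
    also have "\<bar>\<dots>\<bar> \<le> (\<Sum>i\<in>?I. \<theta> i x * \<delta>)"
    proof (rule order_trans[OF sum_abs], rule sum_mono)
      fix i assume i: "i \<in> ?I"
      have "\<bar>W i (cmap (c i) x) - u x\<bar> \<le> \<delta>"
        using W i Sx[of x i] c[of i] unfolding approx_def by (auto simp: cinv_cmap dest!: bspec)
      then show "\<bar>\<theta> i x * (W i (cmap (c i) x) - u x)\<bar> \<le> \<theta> i x * \<delta>"
        using \<theta>(2)[of i x] i by (simp add: abs_mult mult_left_mono)
    qed
    also have "\<dots> = \<delta>" by (simp add: sum_distrib_right[symmetric] s1)
    finally show ?thesis .
  qed
  have claim: "\<exists>\<delta>>0. \<forall>W. approx \<delta> W \<longrightarrow> (\<forall>x\<in>S j. lam * w W x + H x (differential A (w W) x) \<le> e)"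
    if e: "e > 0" and j: "j \<in> F" for e j
  proof -
    note cj = c[OF j] and Kj = K[OF j]
    define T where "T i = \<theta> i \<circ> cinv (c j)" for i
    have TC: "Cn_on 1 (crange (c j)) (T i)" if "i \<in> F" for i
      using C_fun_Cn_on[OF C_fun_infinity_imp_1[OF \<theta>(1)[OF that]] cj] by (simp add: T_def del: Cn_on.simps)
    have "\<exists>D. \<forall>z\<in>K j. norm (grad (T i) z) \<le> D" if "i \<in> F" for i
    proof -
      have "continuous_on (K j) (grad (T i))"
        by (rule continuous_on_subset[OF continuous_on_grad[OF TC[OF that] open_crange[OF cj]] Kj(2)])
      from compact_imp_bounded[OF compact_continuous_image[OF this Kj(1)]] show ?thesis
        by (auto simp: bounded_iff)
    qed
    then obtain D' where D': "\<And>i z. i \<in> F \<Longrightarrow> z \<in> K j \<Longrightarrow> norm (grad (T i) z) \<le> D' i" by metis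
    define D where "D = (\<Sum>i\<in>F. \<bar>D' i\<bar>)"
    have D: "D \<ge> 0" "\<And>z. z \<in> K j \<Longrightarrow> (\<Sum>i\<in>F. norm (grad (T i) z)) \<le> D"
      unfolding D_def using D' by (auto intro!: sum_nonneg sum_mono intro: order_trans[OF _ abs_ge_self])
    \<comment> \<open>An upper bound for \<open>Hc\<close> at the gradients pulled back to the chart
      of j, since \<delta> is at most 1 and the values of W are at least - (M + 1). Coercivity then
      bounds these gradients by R.\<close>
    define B where "B = 1 + lam * (M + 1)"
    obtain R where R: "\<And>z q. z \<in> K j \<Longrightarrow> Hc (c j) z q \<le> B \<Longrightarrow> norm q \<le> R"
      using Hc_coercive[OF cj Kj] by blast
    \<comment> \<open>One unit more than the bound for the convex combination \<open>p\<close>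
      leaves room for the error \<open>\<rho>\<close>, which is shorter than 1.\<close>
    define R' where "R' = \<bar>R\<bar> + 1"
    have "uniformly_continuous_on (K j \<times> cball 0 R') (\<lambda>z. Hc (c j) (fst z) (snd z))"
      by (intro compact_uniformly_continuous continuous_on_Hc' compact_Times compact_cball cj Kj)
    moreover have "e / 2 > 0" using e by simp
    ultimately obtain d where d: "d > 0" "\<forall>a\<in>K j \<times> cball 0 R'. \<forall>b\<in>K j \<times> cball 0 R'. dist b a < d \<longrightarrow>
        dist (Hc (c j) (fst b) (snd b)) (Hc (c j) (fst a) (snd a)) < e / 2"
      unfolding uniformly_continuous_on_def by blast
    define d' where "d' = min d 1"
    define \<delta> where "\<delta> = min 1 (min (e / 2) (d' / (D + 1)))"
    have d': "d' > 0" "d' \<le> 1" "d' \<le> d" using d(1) by (auto simp: d'_def)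
    have \<delta>: "\<delta> > 0" "\<delta> \<le> 1" "\<delta> \<le> e / 2" "\<delta> \<le> d' / (D + 1)"
    proof -
      have "d' / (D + 1) > 0" using d' D(1) by (intro divide_pos_pos) auto
      then show "\<delta> > 0" "\<delta> \<le> 1" "\<delta> \<le> e / 2" "\<delta> \<le> d' / (D + 1)"
        using e unfolding \<delta>_def by linarith+
    qed
    have \<delta>D: "\<delta> * D < d'"
    proof -
      have "\<delta> * (D + 1) \<le> d'" using \<delta>(4) D(1) by (simp add: pos_le_divide_eq)
      then show ?thesis using \<delta>(1) by (simp add: distrib_left)
    qed
    have "lam * w W x + H x (differential A (w W) x) \<le> e" if W: "approx \<delta> W" and x: "x \<in> S j" for W x
    proof -
      define z where "z = cmap (c j) x"
      have z: "z \<in> K j" "x \<in> cdom (c j)" "cinv (c j) z = x" using Sx[OF x] cj by (auto simp: z_def cinv_cmap)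
      have zc: "z \<in> crange (c j)" using z Kj by blast
      define I where "I = {i\<in>F. x \<in> S i}"
      have I: "finite I" "I \<subseteq> F" "I \<noteq> {}" using F x j by (auto simp: I_def)
      have Ic: "c i \<in> A" "x \<in> cdom (c i)" if "i \<in> I" for i using that Sx c by (auto simp: I_def)
      have Wi: "\<bar>W i (cmap (c i) x) - u x\<bar> \<le> \<delta>" "lam * W i (cmap (c i) x) + Hc (c i) (cmap (c i) x) (grad (W i) (cmap (c i) x)) \<le> \<delta>"
        "W i differentiable (at (cmap (c i) x))" if "i \<in> I" for i
      proof -
        have i: "i \<in> F" "cmap (c i) x \<in> K i" using that Sx by (auto simp: I_def)
        with W show "\<bar>W i (cmap (c i) x) - u x\<bar> \<le> \<delta>" "lam * W i (cmap (c i) x) + Hc (c i) (cmap (c i) x) (grad (W i) (cmap (c i) x)) \<le> \<delta>"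
          using Ic[OF that] unfolding approx_def by (auto simp: cinv_cmap dest!: bspec)
        have "Cn_on 1 UNIV (W i)" using W i(1) unfolding approx_def by blast
        then show "W i differentiable (at (cmap (c i) x))" by simp
      qed
      define f where "f i = (\<lambda>z. W i (transition (c j) (c i) z))" for i
      define q where "q i = grad (f i) z" for i
      have fx: "f i z = W i (cmap (c i) x)" for i by (simp add: f_def z(3))
      have Df: "(f i has_derivative (\<lambda>h. q i \<bullet> h)) (at z)"
        and Hq: "Hc (c j) z (q i) = Hc (c i) (cmap (c i) x) (grad (W i) (cmap (c i) x))" if "i \<in> I" for i
      proof -
        note ch = cotangent_of_change_chart[OF cj z(2) Ic[OF that] Wi(3)[OF that]]
        show "(f i has_derivative (\<lambda>h. q i \<bullet> h)) (at z)" using ch(1) by (simp add: f_def q_def z_def)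
        have "H x (cotangent_of A (c j) x (q i)) = H x (cotangent_of A (c i) x (grad (W i) (cmap (c i) x)))"
          using ch(2) by (simp add: f_def q_def z_def)
        then show "Hc (c j) z (q i) = Hc (c i) (cmap (c i) x) (grad (W i) (cmap (c i) x))"
          using H_eq_Hc[OF cj z(2)] H_eq_Hc[OF Ic[OF that]] by (simp add: z_def)
      qed
      have DT: "(T i has_derivative (\<lambda>h. grad (T i) z \<bullet> h)) (at z)" if "i \<in> F" for i
        by (rule has_derivative_grad) (use TC[OF that] zc in auto)
      \<comment> \<open>On this neighbourhood of z only the indices in \<open>I\<close> contribute,
        and all their charts are available. The sum of the T i over the fixed set \<open>I\<close>
        is therefore constantly 1 near z, so their gradients at z add up to 0.\<close>
      define O' where "O' = cmap (c j) ` (cdom (c j) \<inter> ((\<Inter>i\<in>F - I. - S i) \<inter> (\<Inter>i\<in>I. cdom (c i))))"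
      have "open ((\<Inter>i\<in>F - I. - S i) \<inter> (\<Inter>i\<in>I. cdom (c i)))"
        using F I clS Ic by (intro open_Int open_INT ballI open_cdom) auto
      then have O': "open O'" unfolding O'_def by (rule open_cmap_image[OF cj])
      have zO: "z \<in> O'" unfolding O'_def z_def using z(2) Ic by (intro imageI) (auto simp: I_def)
      have TO: "(\<Sum>i\<in>I. T i z') = 1" and wO: "(w W \<circ> cinv (c j)) z' = (\<Sum>i\<in>I. T i z' * f i z')" if z': "z' \<in> O'" for z'
      proof -
        obtain x' where x': "x' \<in> cdom (c j)" "\<And>i. i \<in> F - I \<Longrightarrow> x' \<notin> S i" "z' = cmap (c j) x'"
          using z' unfolding O'_def by auto
        have e: "cinv (c j) z' = x'" using x' cj by (simp add: cinv_cmap)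
        show "(\<Sum>i\<in>I. T i z') = 1"
          using \<theta>(3)[of x'] F I(2) \<theta>S x'(2) unfolding T_def o_def e
          by (subst (asm) sum.mono_neutral_right[of F I]) auto
        have "w W x' = (\<Sum>i\<in>I. \<theta> i x' * W i (cmap (c i) x'))"
          unfolding w_eq by (rule sum.mono_neutral_left) (use F I x'(2) \<theta>S in auto)
        then show "(w W \<circ> cinv (c j)) z' = (\<Sum>i\<in>I. T i z' * f i z')"
          by (simp add: T_def f_def e)
      qed
      have "((\<lambda>z. \<Sum>i\<in>I. T i z) has_derivative (\<lambda>h. \<Sum>i\<in>I. grad (T i) z \<bullet> h)) (at z)"
        using I(2) by (intro has_derivative_sum DT) auto
      then have "((\<lambda>z. 1) has_derivative (\<lambda>h. \<Sum>i\<in>I. grad (T i) z \<bullet> h)) (at z)"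
        by (rule has_derivative_transform_within_open[OF _ O' zO]) (rule TO)
      then have T0: "(\<Sum>i\<in>I. grad (T i) z \<bullet> h) = 0" for h
        using has_derivative_unique[OF has_derivative_const] by metis
      have "((\<lambda>z. \<Sum>i\<in>I. T i z * f i z) has_derivative (\<lambda>h. \<Sum>i\<in>I. T i z * (q i \<bullet> h) + (grad (T i) z \<bullet> h) * f i z)) (at z)"
        using I(2) by (intro has_derivative_sum has_derivative_mult DT Df) auto
      then have Dw: "((w W \<circ> cinv (c j)) has_derivative (\<lambda>h. \<Sum>i\<in>I. T i z * (q i \<bullet> h) + (grad (T i) z \<bullet> h) * f i z)) (at z)"
        by (rule has_derivative_transform_within_open[OF _ O' zO]) (simp only: wO)
      define p where "p = (\<Sum>i\<in>I. T i z *\<^sub>R q i)"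
      \<comment> \<open>Subtracting \<open>u x\<close> changes nothing because the gradients of the
        T i add up to 0, and it makes every coefficient at most \<delta> in absolute value.\<close>
      define \<rho> where "\<rho> = (\<Sum>i\<in>I. (f i z - u x) *\<^sub>R grad (T i) z)"
      have gw: "grad (w W \<circ> cinv (c j)) z = p + \<rho>"
      proof (rule grad_unique, rule has_derivative_eq_rhs[OF Dw], rule ext)
        fix h
        have "(p + \<rho>) \<bullet> h = (\<Sum>i\<in>I. T i z * (q i \<bullet> h) + (grad (T i) z \<bullet> h) * f i z) - u x * (\<Sum>i\<in>I. grad (T i) z \<bullet> h)"
          by (simp add: p_def \<rho>_def inner_add_left inner_sum_left sum.distrib sum_subtractf left_diff_distrib sum_distrib_left mult.commute)
        then show "(\<Sum>i\<in>I. T i z * (q i \<bullet> h) + (grad (T i) z \<bullet> h) * f i z) = (p + \<rho>) \<bullet> h"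
          by (simp add: T0)
      qed
      have Tpos: "T i z \<ge> 0" if "i \<in> I" for i using \<theta>(2) that I(2) by (auto simp: T_def)
      have qR: "norm (q i) \<le> R" if i: "i \<in> I" for i
      proof (rule R[OF z(1)])
        have "lam * (- W i (cmap (c i) x)) \<le> lam * (M + 1)"
          using Wi(1)[OF i] M[of x] \<delta>(2) lam by (intro mult_left_mono) linarith+
        then show "Hc (c j) z (q i) \<le> B" using Wi(2)[OF i] \<delta>(2) unfolding Hq[OF i] B_def by simp
      qed
      have "norm p \<le> (\<Sum>i\<in>I. T i z * R)"
        unfolding p_def using Tpos qR by (intro sum_norm_le) (simp add: mult_left_mono)
      then have pR: "norm p \<le> R" using TO[OF zO] by (simp add: sum_distrib_right[symmetric])
      have "norm \<rho> \<le> (\<Sum>i\<in>I. \<delta> * norm (grad (T i) z))"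
        unfolding \<rho>_def using Wi(1) by (intro sum_norm_le) (simp add: fx mult_right_mono)
      also have "\<dots> \<le> \<delta> * (\<Sum>i\<in>F. norm (grad (T i) z))"
        unfolding sum_distrib_left using \<delta>(1) F I(2) by (intro sum_mono2) auto
      also have "\<dots> \<le> \<delta> * D" using D(2)[OF z(1)] \<delta>(1) by (intro mult_left_mono) auto
      finally have \<rho>d: "norm \<rho> < d'" using \<delta>D by simp
      have "(z, p) \<in> K j \<times> cball 0 R'" "(z, p + \<rho>) \<in> K j \<times> cball 0 R'"
        using z(1) pR \<rho>d d'(2) norm_triangle_ineq[of p \<rho>] by (auto simp: R'_def)
      moreover have "dist (z, p + \<rho>) (z, p) < d" using \<rho>d d'(3) by (simp add: dist_Pair_Pair dist_norm)
      ultimately have "dist (Hc (c j) z (p + \<rho>)) (Hc (c j) z p) < e / 2" using d(2) by fastforce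
      then have 1: "Hc (c j) z (p + \<rho>) < Hc (c j) z p + e / 2" unfolding dist_real_def by linarith
      have "Hc (c j) z p \<le> (\<Sum>i\<in>I. T i z * Hc (c j) z (q i))"
        unfolding p_def by (rule convex_on_sum[OF I(1,3) convex_Hc[OF cj zc] TO[OF zO] Tpos]) auto
      also have "\<dots> \<le> (\<Sum>i\<in>I. T i z * (\<delta> - lam * f i z))"
        using Tpos Wi(2) by (intro sum_mono mult_left_mono) (auto simp: Hq fx algebra_simps)
      also have "\<dots> = \<delta> * (\<Sum>i\<in>I. T i z) - lam * (\<Sum>i\<in>I. T i z * f i z)"
        by (simp add: right_diff_distrib sum_subtractf sum_distrib_left mult.commute mult.left_commute)
      also have "\<dots> = \<delta> - lam * w W x" using TO[OF zO] wO[OF zO] z(3) by simp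
      finally have 2: "lam * w W x + Hc (c j) z p \<le> \<delta>" by simp
      have "H x (differential A (w W) x) = Hc (c j) z (p + \<rho>)"
        using differential_eq[OF C_fun_infinity_imp_1[OF wC[OF W]] cj z(2)] gw H_eq_Hc[OF cj z(2)]
        by (simp add: z_def)
      with 1 2 \<delta>(3) show ?thesis by simp
    qed
    then show ?thesis using \<delta>(1) by blast
  qed
  \<comment> \<open>Lowering the glued function by \<epsilon> / 2 lowers its product with
    \<open>lam\<close> by exactly e and leaves the differential alone; the other half of \<epsilon>
    is kept for the distance to u.\<close>
  define e where "e = lam * \<epsilon> / 2"
  have e: "e > 0" "e / lam = \<epsilon> / 2" using \<epsilon> lam by (auto simp: e_def)
  obtain \<delta> where \<delta>: "\<And>j. j \<in> F \<Longrightarrow> \<delta> j > 0"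
    "\<And>j W x. j \<in> F \<Longrightarrow> approx (\<delta> j) W \<Longrightarrow> x \<in> S j \<Longrightarrow> lam * w W x + H x (differential A (w W) x) \<le> e"
    using claim[OF e(1)] by metis
  define \<delta>0 where "\<delta>0 = Min (insert (\<epsilon> / 2) (\<delta> ` F))"
  have \<delta>0: "\<delta>0 > 0" "\<delta>0 \<le> \<epsilon> / 2" "\<And>j. j \<in> F \<Longrightarrow> \<delta>0 \<le> \<delta> j"
  proof -
    have fin: "finite (insert (\<epsilon> / 2) (\<delta> ` F))" using F by simp
    show "\<delta>0 > 0" unfolding \<delta>0_def using fin \<delta>(1) \<epsilon> by (subst Min_gr_iff) auto
    show "\<delta>0 \<le> \<epsilon> / 2" unfolding \<delta>0_def by (rule Min_le[OF fin]) simp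
    show "\<delta>0 \<le> \<delta> j" if "j \<in> F" for j unfolding \<delta>0_def by (rule Min_le[OF fin]) (use that in simp)
  qed
  have "\<exists>W. (\<forall>n. Cn_on n UNIV W) \<and> (\<forall>z\<in>K i. \<bar>W z - u (cinv (c i) z)\<bar> \<le> \<delta>0 \<and> lam * W z + Hc (c i) z (grad W z) \<le> \<delta>0)"
    if i: "i \<in> F" for i
    using local_smooth_approximation[OF u c[OF i] r(1)[OF i] r(2)[OF i] \<delta>0(1)] unfolding K_def by metis
  then obtain W where "approx \<delta>0 W" unfolding approx_def by metis
  moreover have "approx \<delta>2 W" if "approx \<delta>1 W" "\<delta>1 \<le> \<delta>2" for \<delta>1 \<delta>2
    using that unfolding approx_def by (meson order_trans)
  ultimately have W: "approx \<delta>0 W" "\<And>j. j \<in> F \<Longrightarrow> approx (\<delta> j) W"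
    using \<delta>0(3) by blast+
  show ?thesis
  proof (intro bexI[of _ "\<lambda>x. w W x - \<epsilon> / 2"] conjI allI)
    show "(\<lambda>x. w W x - \<epsilon> / 2) \<in> C_fun A \<infinity>" by (rule C_fun_infinity_diff_const[OF wC[OF W(1)]])
    fix x
    show "\<bar>w W x - \<epsilon> / 2 - u x\<bar> \<le> \<epsilon>" using w_close[OF W(1), of x] \<delta>0(2) by linarith
    obtain j where "j \<in> F" "x \<in> S j" using cover by blast
    then have "lam * w W x + H x (differential A (w W) x) \<le> e" using \<delta>(2) W(2) by blast
    then show "lam * (w W x - \<epsilon> / 2) + H x (differential A (\<lambda>x. w W x - \<epsilon> / 2) x) \<le> 0"
      unfolding differential_diff_const[OF wC[OF W(1)]] by (simp add: e_def algebra_simps)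
  qed
qed

end

section \<open>Domination and comparison\<close>

lemma Lipschitz_on_compact_convex:
  fixes F :: "'a::euclidean_space \<Rightarrow> real"
  assumes K: "compact K" "convex K" "K \<subseteq> S" and S: "open S" and F: "Cn_on 1 S F"
  shows "\<exists>L. \<forall>x\<in>K. \<forall>y\<in>K. norm (F x - F y) \<le> L * norm (x - y)"
proof -
  have "continuous_on K (grad F)" by (rule continuous_on_subset[OF continuous_on_grad[OF F S] K(3)])
  from compact_imp_bounded[OF compact_continuous_image[OF this K(1)]]
  obtain L where "\<forall>w\<in>grad F ` K. norm w \<le> L" unfolding bounded_iff by (rule exE)
  then have L: "norm (grad F x) \<le> L" if "x \<in> K" for x using that by auto
  have "norm (F x - F y) \<le> L * norm (x - y)" if "x \<in> K" "y \<in> K" for x y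
  proof (rule differentiable_bound[OF K(2), where f' = "\<lambda>x h. grad F x \<bullet> h"])
    fix z assume z: "z \<in> K"
    have "(F has_derivative (\<lambda>h. grad F z \<bullet> h)) (at z)"
      by (rule has_derivative_grad) (use F z K(3) in auto)
    then show "(F has_derivative (\<lambda>h. grad F z \<bullet> h)) (at z within K)" by (rule has_derivative_at_withinI)
    show "onorm (\<lambda>h. grad F z \<bullet> h) \<le> L"
    proof (rule onorm_bound)
      show "0 \<le> L" using L[OF z] norm_ge_zero order_trans by blast
      show "norm (grad F z \<bullet> h) \<le> L * norm h" for h
        using Cauchy_Schwarz_ineq2[of "grad F z" h] mult_right_mono[OF L[OF z] norm_ge_zero[of h]] by simp
    qed
  qed (use that in auto)
  then show ?thesis by blast
qed

context hamiltonian
begin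

text \<open>In a ball of a chart, time and position enter through one C^1 function on a compact
  convex set; it is Lipschitz there, so it is absolutely continuous along the curve. Almost
  everywhere its derivative is \<open>exp (lam * \<tau>)\<close> times the sum of
  \<open>lam * w\<close> and the slope of w along the velocity, which Fenchel's inequality and the
  subsolution property bound by the integrand.\<close>

lemma classical_subsolution_dominated_local:
  assumes w: "w \<in> C_fun A 1" "\<And>x. lam * w x + H x (differential A w x) \<le> 0"
    and c: "c \<in> A" and r: "cball y0 r \<subseteq> crange c" and st: "s \<le> t"
    and \<gamma>: "abs_continuous_curve A s t \<gamma>" "\<And>\<tau>. \<tau> \<in> {s..t} \<Longrightarrow> \<gamma> \<tau> \<in> cdom c \<and> cmap c (\<gamma> \<tau>) \<in> cball y0 r"
    and int: "(\<lambda>\<tau>. exp (lam * \<tau>) * lagrangian A H (\<gamma> \<tau>) (velocity A \<gamma> \<tau>)) integrable_on {s..t}"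
  shows "exp (lam * t) * w (\<gamma> t) - exp (lam * s) * w (\<gamma> s)
    \<le> integral {s..t} (\<lambda>\<tau>. exp (lam * \<tau>) * lagrangian A H (\<gamma> \<tau>) (velocity A \<gamma> \<tau>))"
proof -
  define \<eta> where "\<eta> = cmap c \<circ> \<gamma>"
  define F where "F = w \<circ> cinv c"
  have FC: "Cn_on 1 (crange c) F" unfolding F_def by (rule C_fun_Cn_on[OF w(1) c])
  have \<eta>K: "\<eta> \<tau> \<in> cball y0 r" "\<gamma> \<tau> \<in> cdom c" if "\<tau> \<in> {s..t}" for \<tau> using \<gamma>(2)[OF that] by (auto simp: \<eta>_def)
  have F\<eta>: "F (\<eta> \<tau>) = w (\<gamma> \<tau>)" if "\<tau> \<in> {s..t}" for \<tau> using \<eta>K(2)[OF that] c by (simp add: F_def \<eta>_def cinv_cmap)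
  have ac: "abs_continuous_on s t \<eta>"
    using \<gamma>(1) c st \<eta>K(2) unfolding abs_continuous_curve_def \<eta>_def by blast
  define E where "E z = exp (lam * fst z) * F (snd z)" for z :: "real \<times> 'e"
  have CE: "Cn_on 1 (UNIV \<times> crange c) E"
  proof -
    have op: "open ((UNIV :: real set) \<times> crange c)" by (intro open_Times open_UNIV open_crange c)
    have e: "Cn_on 1 UNIV (\<lambda>x::real. exp (lam * x))"
    proof -
      have "Cn_on (Suc 0) UNIV (\<lambda>x::real. exp (lam * x))"
        by (rule Cn_on_SucI[where f' = "\<lambda>x v. exp (lam * x) * lam * v"])
          (auto intro!: derivative_eq_intros continuous_intros)
      then show ?thesis by (simp del: Cn_on.simps)
    qed
    show ?thesis unfolding E_def[abs_def]
      by (intro Cn_on_mult op Cn_on_compose[OF op open_UNIV _ e] Cn_on_compose[OF op open_crange[OF c] _ FC]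
          Cn_on_linear bounded_linear_fst bounded_linear_snd) auto
  qed
  have "\<exists>L. \<forall>a\<in>{s..t} \<times> cball y0 r. \<forall>b\<in>{s..t} \<times> cball y0 r. norm (E a - E b) \<le> L * norm (a - b)"
  proof (rule Lipschitz_on_compact_convex[OF _ _ _ _ CE])
    show "compact ({s..t} \<times> cball y0 r)" by (intro compact_Times compact_Icc compact_cball)
    show "convex ({s..t} \<times> cball y0 r)" by (intro convex_Times convex_real_interval convex_cball)
    show "{s..t} \<times> cball y0 r \<subseteq> UNIV \<times> crange c" using r by blast
    show "open ((UNIV :: real set) \<times> crange c)" by (intro open_Times open_UNIV open_crange c)
  qed
  then obtain L where L: "\<forall>a\<in>{s..t} \<times> cball y0 r. \<forall>b\<in>{s..t} \<times> cball y0 r. norm (E a - E b) \<le> L * norm (a - b)"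
    by (rule exE)
  define G where "G \<tau> = E (\<tau>, \<eta> \<tau>)" for \<tau>
  have acG: "abs_continuous_on s t G"
  proof (rule abs_continuous_on_Lipschitz_compose[OF abs_continuous_on_Pair[OF abs_continuous_on_id ac], of G L])
    fix \<sigma> \<tau> assume "\<sigma> \<in> {s..t}" "\<tau> \<in> {s..t}"
    then have "(\<sigma>, \<eta> \<sigma>) \<in> {s..t} \<times> cball y0 r" "(\<tau>, \<eta> \<tau>) \<in> {s..t} \<times> cball y0 r" using \<eta>K(1) by auto
    then show "norm (G \<sigma> - G \<tau>) \<le> L * norm ((\<sigma>, \<eta> \<sigma>) - (\<tau>, \<eta> \<tau>))"
      unfolding G_def using L by blast
  qed
  have "G t - G s \<le> integral {s..t} (\<lambda>\<tau>. exp (lam * \<tau>) * lagrangian A H (\<gamma> \<tau>) (velocity A \<gamma> \<tau>))"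
  proof (rule abs_continuous_on_derivative_le_imp[OF st acG int])
    \<comment> \<open>The endpoints join the null set because the curve is known to lie in the chart
      on \<open>{s..t}\<close> only, while velocities are two-sided derivatives.\<close>
    show "negligible ({\<tau> \<in> {s..t}. \<not> \<eta> differentiable (at \<tau>)} \<union> {s, t})"
      by (intro negligible_Un abs_continuous_on_differentiable_ae[OF ac] negligible_finite) auto
    fix \<tau> assume "\<tau> \<in> {s..t} - ({\<tau> \<in> {s..t}. \<not> \<eta> differentiable (at \<tau>)} \<union> {s, t})"
    then have \<tau>: "\<tau> \<in> {s<..<t}" "\<tau> \<in> {s..t}" "\<eta> differentiable (at \<tau>)" by auto
    define e where "e = vector_derivative \<eta> (at \<tau>)"
    have D\<eta>: "(\<eta> has_vector_derivative e) (at \<tau>)" using \<tau>(3) by (simp add: e_def vector_derivative_works)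
    have \<gamma>c: "\<gamma> \<tau> \<in> cdom c" and y: "\<eta> \<tau> \<in> crange c" using \<eta>K[OF \<tau>(2)] r by auto
    have "\<forall>\<^sub>F \<sigma> in nhds \<tau>. \<sigma> \<in> {s<..<t}" by (rule eventually_nhds_in_open[OF open_greaterThanLessThan \<tau>(1)])
    then have "\<forall>\<^sub>F \<sigma> in nhds \<tau>. \<gamma> \<sigma> \<in> cdom c" by (rule eventually_mono) (use \<eta>K(2) in auto)
    then have vel: "velocity A \<gamma> \<tau> = tangent_of A c (\<gamma> \<tau>) e"
      by (rule velocity_eq[of c \<gamma> \<tau>, OF c \<gamma>c]) (use D\<eta> in \<open>simp add: \<eta>_def\<close>)
    have lag: "lagrangian A H (\<gamma> \<tau>) (velocity A \<gamma> \<tau>) = Lc c (\<eta> \<tau>) e"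
      unfolding vel by (simp add: lagrangian_eq[OF c \<gamma>c] \<eta>_def)
    have DF: "(F has_derivative (\<lambda>h. grad F (\<eta> \<tau>) \<bullet> h)) (at (\<eta> \<tau>))"
      by (rule has_derivative_grad) (use FC y in auto)
    have "((\<lambda>\<tau>. F (\<eta> \<tau>)) has_derivative (\<lambda>h. grad F (\<eta> \<tau>) \<bullet> (h *\<^sub>R e))) (at \<tau>)"
      by (rule has_derivative_compose[of \<eta> "\<lambda>h. h *\<^sub>R e" \<tau> UNIV F, OF _ DF])
        (use D\<eta> in \<open>simp add: has_vector_derivative_def\<close>)
    then have "((\<lambda>\<tau>. F (\<eta> \<tau>)) has_real_derivative grad F (\<eta> \<tau>) \<bullet> e) (at \<tau>)"
      by (simp add: has_field_derivative_def mult.commute[of _ "grad F (\<eta> \<tau>) \<bullet> e"])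
    then have DG: "(G has_real_derivative exp (lam * \<tau>) * (lam * F (\<eta> \<tau>) + grad F (\<eta> \<tau>) \<bullet> e)) (at \<tau>)"
      unfolding G_def E_def by (auto intro!: derivative_eq_intros simp: algebra_simps)
    have "grad F (\<eta> \<tau>) \<bullet> e \<le> Lc c (\<eta> \<tau>) e + Hc c (\<eta> \<tau>) (grad F (\<eta> \<tau>))" by (rule Fenchel[OF c y])
    moreover have "H (\<gamma> \<tau>) (differential A w (\<gamma> \<tau>)) = Hc c (\<eta> \<tau>) (grad F (\<eta> \<tau>))"
      using differential_eq[OF w(1) c \<gamma>c] H_eq_Hc[OF c \<gamma>c] by (simp add: F_def \<eta>_def)
    moreover have "lam * w (\<gamma> \<tau>) + H (\<gamma> \<tau>) (differential A w (\<gamma> \<tau>)) \<le> 0" by (rule w(2))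
    ultimately have "lam * F (\<eta> \<tau>) + grad F (\<eta> \<tau>) \<bullet> e \<le> lagrangian A H (\<gamma> \<tau>) (velocity A \<gamma> \<tau>)"
      unfolding lag F\<eta>[OF \<tau>(2)] by linarith
    then have "exp (lam * \<tau>) * (lam * F (\<eta> \<tau>) + grad F (\<eta> \<tau>) \<bullet> e) \<le> exp (lam * \<tau>) * lagrangian A H (\<gamma> \<tau>) (velocity A \<gamma> \<tau>)"
      by (intro mult_left_mono) auto
    with DG show "\<exists>D. (G has_real_derivative D) (at \<tau>) \<and> D \<le> exp (lam * \<tau>) * lagrangian A H (\<gamma> \<tau>) (velocity A \<gamma> \<tau>)" by blast
  qed
  then show ?thesis using F\<eta>[of s] F\<eta>[of t] st by (simp add: G_def E_def)
qed

text \<open>Increments and integrals are additive over adjacent intervals, so by bisection it is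
  enough to treat short intervals, on which continuity keeps the curve in a ball of one
  chart.\<close>

lemma classical_subsolution_dominated:
  assumes w: "w \<in> C_fun A 1" "\<And>x. lam * w x + H x (differential A w x) \<le> 0"
  shows "dominated A H lam w"
  unfolding dominated_def
proof (intro allI impI)
  fix a b \<gamma>
  define h where "h \<tau> = exp (lam * \<tau>) * lagrangian A H (\<gamma> \<tau>) (velocity A \<gamma> \<tau>)" for \<tau>
  assume *: "a \<le> b \<and> abs_continuous_curve A a b \<gamma> \<and>
        (\<lambda>t. exp (lam * t) * lagrangian A H (\<gamma> t) (velocity A \<gamma> t)) absolutely_integrable_on {a..b}"
  then have ab: "a \<le> b" and \<gamma>: "abs_continuous_curve A a b \<gamma>" and h: "h integrable_on {a..b}"
    unfolding h_def by (auto intro: set_lebesgue_integral_eq_integral)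
  have hs: "h integrable_on {s..t}" if "a \<le> s" "t \<le> b" for s t
    by (rule integrable_on_subinterval[OF h]) (use that in auto)
  define P where "P s t \<longleftrightarrow> (a \<le> s \<longrightarrow> s \<le> t \<longrightarrow> t \<le> b \<longrightarrow>
    exp (lam * t) * w (\<gamma> t) - exp (lam * s) * w (\<gamma> s) \<le> integral {s..t} h)" for s t
  have "P a b"
    using ab
  proof (induction rule: Bolzano)
    case (trans s t v)
    show ?case
      unfolding P_def
    proof (intro impI)
      assume l: "a \<le> s" "s \<le> v" "v \<le> b"
      have "integral {s..t} h + integral {t..v} h = integral {s..v} h"
        by (rule Henstock_Kurzweil_Integration.integral_combine) (use trans(3,4) hs l in auto)
      then show "exp (lam * v) * w (\<gamma> v) - exp (lam * s) * w (\<gamma> s) \<le> integral {s..v} h"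
        using trans l unfolding P_def by linarith
    qed
  next
    case (local x)
    obtain c where c: "c \<in> A" "\<gamma> x \<in> cdom c" using ex_chart by blast
    then have "cmap c (\<gamma> x) \<in> crange c" by simp
    then obtain r where r: "r > 0" "cball (cmap c (\<gamma> x)) r \<subseteq> crange c"
      using open_crange[OF c(1)] unfolding open_contains_cball by blast
    define O' where "O' = {z \<in> cdom c. cmap c z \<in> ball (cmap c (\<gamma> x)) r}"
    have O': "open O'" "\<gamma> x \<in> O'" using open_chart_preimage[OF c(1) open_ball] c r(1) by (auto simp: O'_def)
    have "continuous_on {a..b} \<gamma>" using \<gamma> by (simp add: abs_continuous_curve_def)
    then have "(\<gamma> \<longlongrightarrow> \<gamma> x) (at x within {a..b})" using local by (simp add: continuous_on_def)
    from topological_tendstoD[OF this O'] obtain d where d: "d > 0"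
      "\<And>\<tau>. \<tau> \<in> {a..b} \<Longrightarrow> \<tau> \<noteq> x \<Longrightarrow> dist \<tau> x < d \<Longrightarrow> \<gamma> \<tau> \<in> O'"
      by (auto simp: eventually_at)
    then have d': "\<gamma> \<tau> \<in> O'" if "\<tau> \<in> {a..b}" "\<bar>\<tau> - x\<bar> < d" for \<tau>
      using that O'(2) by (cases "\<tau> = x") (auto simp: dist_real_def)
    show ?case
    proof (intro exI[of _ d] conjI allI impI d(1))
      fix s t assume st: "s \<le> x \<and> x \<le> t \<and> t - s < d"
      show "P s t"
        unfolding P_def
      proof (intro impI)
        assume l: "a \<le> s" "s \<le> t" "t \<le> b"
        show "exp (lam * t) * w (\<gamma> t) - exp (lam * s) * w (\<gamma> s) \<le> integral {s..t} h"
          unfolding h_def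
        proof (rule classical_subsolution_dominated_local[OF w c(1) r(2) l(2)])
          have sub: "{s..t} \<subseteq> {a..b}" using l by auto
          have "continuous_on {s..t} \<gamma>"
            using \<gamma> sub continuous_on_subset unfolding abs_continuous_curve_def by blast
          moreover have "\<forall>c\<in>A. \<forall>s' t'. s \<le> s' \<and> s' \<le> t' \<and> t' \<le> t \<and> \<gamma> ` {s'..t'} \<subseteq> cdom c \<longrightarrow> abs_continuous_on s' t' (cmap c \<circ> \<gamma>)"
            using \<gamma> l unfolding abs_continuous_curve_def by (meson order_trans)
          ultimately show "abs_continuous_curve A s t \<gamma>" unfolding abs_continuous_curve_def by blast
          show "(\<lambda>\<tau>. exp (lam * \<tau>) * lagrangian A H (\<gamma> \<tau>) (velocity A \<gamma> \<tau>)) integrable_on {s..t}"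
            using hs[OF l(1,3)] unfolding h_def[abs_def] .
          fix \<tau> assume "\<tau> \<in> {s..t}"
          then have "\<gamma> \<tau> \<in> O'" using st l by (intro d') auto
          then show "\<gamma> \<tau> \<in> cdom c \<and> cmap c (\<gamma> \<tau>) \<in> cball (cmap c (\<gamma> x)) r" by (auto simp: O'_def)
        qed
      qed
    qed
  qed
  then show "exp (lam * b) * w (\<gamma> b) - exp (lam * a) * w (\<gamma> a)
          \<le> integral {a..b} (\<lambda>t. exp (lam * t) * lagrangian A H (\<gamma> t) (velocity A \<gamma> t))"
    using ab unfolding P_def h_def[abs_def] by simp
qed

lemma viscosity_subsolution_dominated:
  assumes u: "viscosity_subsolution A H lam u"
  shows "dominated A H lam u"
  unfolding dominated_def
proof (intro allI impI, rule field_le_epsilon)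
  fix a b \<gamma> and e :: real
  assume *: "a \<le> b \<and> abs_continuous_curve A a b \<gamma> \<and>
        (\<lambda>t. exp (lam * t) * lagrangian A H (\<gamma> t) (velocity A \<gamma> t)) absolutely_integrable_on {a..b}"
    and e: "e > 0"
  \<comment> \<open>Replacing u by w costs \<epsilon> at either end of the curve, weighted by the
    exponentials; the two costs add up to e.\<close>
  define \<epsilon> where "\<epsilon> = e / (exp (lam * b) + exp (lam * a))"
  have pos: "exp (lam * b) + exp (lam * a) > 0" by (intro add_pos_pos) auto
  have "(exp (lam * b) + exp (lam * a)) * \<epsilon> = e" unfolding \<epsilon>_def using pos by (subst times_divide_eq_right) simp
  then have \<epsilon>: "\<epsilon> > 0" "exp (lam * b) * \<epsilon> + exp (lam * a) * \<epsilon> = e"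
    using e pos by (simp add: \<epsilon>_def, simp only: distrib_right)
  obtain w where w: "w \<in> C_fun A \<infinity>" "\<And>x. \<bar>w x - u x\<bar> \<le> \<epsilon>" "\<And>x. lam * w x + H x (differential A w x) \<le> 0"
    using global_smooth_approximation[OF u \<epsilon>(1)] by blast
  have "dominated A H lam w"
    by (rule classical_subsolution_dominated[OF C_fun_infinity_imp_1[OF w(1)] w(3)])
  then have "exp (lam * b) * w (\<gamma> b) - exp (lam * a) * w (\<gamma> a)
          \<le> integral {a..b} (\<lambda>t. exp (lam * t) * lagrangian A H (\<gamma> t) (velocity A \<gamma> t))"
    using * unfolding dominated_def by blast
  moreover have "exp (lam * b) * u (\<gamma> b) \<le> exp (lam * b) * (w (\<gamma> b) + \<epsilon>)"
    using w(2)[of "\<gamma> b"] by (intro mult_left_mono) (linarith, simp)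
  moreover have "exp (lam * a) * (w (\<gamma> a) - \<epsilon>) \<le> exp (lam * a) * u (\<gamma> a)"
    using w(2)[of "\<gamma> a"] by (intro mult_left_mono) (linarith, simp)
  ultimately show "exp (lam * b) * u (\<gamma> b) - exp (lam * a) * u (\<gamma> a)
          \<le> integral {a..b} (\<lambda>t. exp (lam * t) * lagrangian A H (\<gamma> t) (velocity A \<gamma> t)) + e"
    using \<epsilon>(2) by (simp add: distrib_left right_diff_distrib)
qed

section \<open>From domination back to the viscosity inequality\<close>

text \<open>Coordinate lines are the curves along which domination will be tested. In any other
  chart they are C^1 images of segments, hence Lipschitz on compact intervals.\<close>

lemma line_abs_continuous_curve:
  assumes c: "c \<in> A" and seg: "\<And>\<tau>. \<tau> \<in> {a..b} \<Longrightarrow> y + \<tau> *\<^sub>R v \<in> crange c"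
  shows "abs_continuous_curve A a b (\<lambda>\<tau>. cinv c (y + \<tau> *\<^sub>R v))"
  unfolding abs_continuous_curve_def
proof (intro conjI ballI allI impI)
  show "continuous_on {a..b} (\<lambda>\<tau>. cinv c (y + \<tau> *\<^sub>R v))"
    by (rule continuous_on_compose2[OF continuous_on_cinv[OF c]]) (use seg in \<open>auto intro!: continuous_intros\<close>)
  fix d s t
  assume d: "d \<in> A" and st: "a \<le> s \<and> s \<le> t \<and> t \<le> b \<and> (\<lambda>\<tau>. cinv c (y + \<tau> *\<^sub>R v)) ` {s..t} \<subseteq> cdom d"
  let ?O = "cmap c ` (cdom c \<inter> cdom d)"
  let ?f = "cmap d \<circ> (\<lambda>\<tau>. cinv c (y + \<tau> *\<^sub>R v))"
  have O': "y + \<tau> *\<^sub>R v \<in> ?O" if "\<tau> \<in> {s..t}" for \<tau>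
  proof -
    have "y + \<tau> *\<^sub>R v \<in> crange c" using seg that st by auto
    moreover have "cinv c (y + \<tau> *\<^sub>R v) \<in> cdom d" using st that by blast
    ultimately show ?thesis using c cinv_in cmap_cinv by (metis IntI imageI)
  qed
  define f' where "f' \<tau> = frechet_derivative (transition c d) (at (y + \<tau> *\<^sub>R v)) v" for \<tau>
  have C1: "Cn_on 1 ?O (transition c d)" by (rule transition_Cn_on[OF c d])
  have "continuous_on ?O (\<lambda>z. frechet_derivative (transition c d) (at z) v)" using C1 by simp
  then have "continuous_on {s..t} f'"
    unfolding f'_def by (rule continuous_on_compose2) (use O' in \<open>auto intro!: continuous_intros\<close>)
  from compact_imp_bounded[OF compact_continuous_image[OF this compact_Icc]]
  obtain L where "\<forall>w\<in>f' ` {s..t}. norm w \<le> L" unfolding bounded_iff by (rule exE)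
  then have L: "norm (f' \<tau>) \<le> L" if "\<tau> \<in> {s..t}" for \<tau> using that by auto
  have D: "(?f has_derivative (\<lambda>h. h *\<^sub>R f' \<tau>)) (at \<tau>)" if "\<tau> \<in> {s..t}" for \<tau>
  proof -
    have td: "(transition c d has_derivative frechet_derivative (transition c d) (at (y + \<tau> *\<^sub>R v))) (at (y + \<tau> *\<^sub>R v))"
      by (rule Cn_on_has_derivative[OF C1 _ O'[OF that]]) simp
    have "((\<lambda>\<tau>. y + \<tau> *\<^sub>R v) has_derivative (\<lambda>h. h *\<^sub>R v)) (at \<tau>)" by (auto intro!: derivative_eq_intros)
    from has_derivative_compose[OF this td]
    have "(?f has_derivative (\<lambda>h. frechet_derivative (transition c d) (at (y + \<tau> *\<^sub>R v)) (h *\<^sub>R v))) (at \<tau>)"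
      by (simp add: o_def)
    then show ?thesis
      using has_derivative_bounded_linear[OF td] by (simp add: f'_def linear_cmul bounded_linear.linear)
  qed
  show "abs_continuous_on s t ?f"
  proof (rule abs_continuous_on_Lipschitz)
    fix \<sigma> \<tau> assume "\<sigma> \<in> {s..t}" "\<tau> \<in> {s..t}"
    then have "norm (?f \<sigma> - ?f \<tau>) \<le> L * norm (\<sigma> - \<tau>)"
    proof (intro differentiable_bound[of "{s..t}" ?f "\<lambda>\<tau> h. h *\<^sub>R f' \<tau>" L])
      fix \<rho> assume \<rho>: "\<rho> \<in> {s..t}"
      show "(?f has_derivative (\<lambda>h. h *\<^sub>R f' \<rho>)) (at \<rho> within {s..t})"
        by (rule has_derivative_at_withinI[OF D[OF \<rho>]])
      show "onorm (\<lambda>h. h *\<^sub>R f' \<rho>) \<le> L"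
      proof (rule onorm_bound)
        show "0 \<le> L" using L[OF \<rho>] norm_ge_zero order_trans by blast
        show "norm (h *\<^sub>R f' \<rho>) \<le> L * norm h" for h
          using mult_left_mono[OF L[OF \<rho>], of "\<bar>h\<bar>"] by (simp add: mult.commute)
      qed
    qed auto
    then show "norm (?f \<sigma> - ?f \<tau>) \<le> L * \<bar>\<sigma> - \<tau>\<bar>" by simp
  qed
qed

lemma continuous_on_Lc:
  assumes c: "c \<in> A" and K: "compact K" "K \<subseteq> crange c"
  shows "continuous_on K (\<lambda>y. Lc c y v)"
  unfolding continuous_on_iff
proof (intro ballI allI impI)
  fix y and e :: real assume y: "y \<in> K" and "0 < e"
  then have "e / 2 > 0" by simp
  then obtain \<eta> where \<eta>: "\<eta> > 0" "\<forall>y\<in>K. \<forall>z\<in>K. dist y z < \<eta> \<longrightarrow> (\<forall>v'. norm v' \<le> norm v \<longrightarrow> Lc c z v' \<le> Lc c y v' + e / 2)"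
    using Lc_uniformly_continuous[OF c K] by blast
  show "\<exists>d>0. \<forall>z\<in>K. dist z y < d \<longrightarrow> dist (Lc c z v) (Lc c y v) < e"
  proof (intro exI[of _ \<eta>] conjI ballI impI \<eta>(1))
    fix z assume "z \<in> K" "dist z y < \<eta>"
    then have "Lc c z v \<le> Lc c y v + e / 2" "Lc c y v \<le> Lc c z v + e / 2"
      using \<eta>(2) y by (auto simp: dist_commute)
    then show "dist (Lc c z v) (Lc c y v) < e" using \<open>0 < e\<close> unfolding dist_real_def by linarith
  qed
qed

text \<open>Domination is tested on the coordinate line through x whose velocity v gives equality in
  Fenchel's inequality for the differential of f, over the times from - \<tau> to 0. Ending at x is
  essential: domination bounds u at x from above by u at the earlier point, where the touching
  function bounds u from above again. Dividing by \<tau> gives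
  \<open>lam * u x + q \<bullet> v \<le> Lc c y v\<close> in the limit, which is the claim by the
  choice of v.\<close>

lemma dominated_imp_viscosity_subsolution:
  assumes u: "continuous_on UNIV u" and dom: "dominated A H lam u"
  shows "viscosity_subsolution A H lam u"
  unfolding viscosity_subsolution_def
proof (intro conjI u ballI allI impI)
  fix f x assume f: "f \<in> C_fun A 1" and max: "\<forall>\<^sub>F y in nhds x. u y - f y \<le> u x - f x"
  obtain c where c: "c \<in> A" "x \<in> cdom c" using ex_chart by blast
  define y where "y = cmap c x"
  have y: "y \<in> crange c" "cinv c y = x" using c by (auto simp: y_def cinv_cmap)
  define q where "q = grad (f \<circ> cinv c) y"
  have Hq: "H x (differential A f x) = Hc c y q"
    using differential_eq[OF f c] H_eq_Hc[OF c] by (simp add: q_def y_def)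
  obtain v where v: "Lc c y v = q \<bullet> v - Hc c y q" using Fenchel_equality[OF c(1) y(1)] by blast
  obtain r where r: "r > 0" "cball y r \<subseteq> crange c" using open_crange[OF c(1)] y(1) unfolding open_contains_cball by blast
  define \<gamma> where "\<gamma> \<tau> = cinv c (y + \<tau> *\<^sub>R v)" for \<tau> :: real
  have "\<exists>T>0. \<forall>\<tau>. \<bar>\<tau>\<bar> < T \<longrightarrow> y + \<tau> *\<^sub>R v \<in> cball y r"
  proof (intro exI[of _ "r / (norm v + 1)"] conjI allI impI)
    show "r / (norm v + 1) > 0" using r(1) by (intro divide_pos_pos add_nonneg_pos) auto
    fix \<tau> assume "\<bar>\<tau>\<bar> < r / (norm v + 1)"
    then have "\<bar>\<tau>\<bar> * (norm v + 1) < r" by (subst (asm) pos_less_divide_eq) (auto intro: add_nonneg_pos)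
    then have "norm (\<tau> *\<^sub>R v) \<le> r" by (simp add: distrib_left)
    then show "y + \<tau> *\<^sub>R v \<in> cball y r" by (simp add: dist_norm)
  qed
  then obtain T where T: "T > 0" "\<And>\<tau>. \<bar>\<tau>\<bar> < T \<Longrightarrow> y + \<tau> *\<^sub>R v \<in> cball y r" by blast
  have Tc: "y + \<tau> *\<^sub>R v \<in> crange c" if "\<bar>\<tau>\<bar> < T" for \<tau> using T(2)[OF that] r(2) by blast
  have \<gamma>_in: "\<gamma> \<tau> \<in> cdom c" "cmap c (\<gamma> \<tau>) = y + \<tau> *\<^sub>R v" if "\<bar>\<tau>\<bar> < T" for \<tau>
    unfolding \<gamma>_def using cinv_in[OF c(1) Tc[OF that]] cmap_cinv[OF c(1) Tc[OF that]] by auto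
  define act where "act \<tau> = exp (lam * \<tau>) * Lc c (y + \<tau> *\<^sub>R v) v" for \<tau>
  have lag: "exp (lam * \<tau>) * lagrangian A H (\<gamma> \<tau>) (velocity A \<gamma> \<tau>) = act \<tau>" if \<tau>: "\<bar>\<tau>\<bar> < T" for \<tau>
  proof -
    note \<gamma>\<tau> = \<gamma>_in[OF \<tau>]
    have op: "open {\<sigma>::real. \<bar>\<sigma>\<bar> < T}" by (intro open_Collect_less continuous_intros)
    have "\<forall>\<^sub>F \<sigma> in nhds \<tau>. \<sigma> \<in> {\<sigma>. \<bar>\<sigma>\<bar> < T}"
      by (rule eventually_nhds_in_open[OF op]) (use \<tau> in simp)
    then have ev: "\<forall>\<^sub>F \<sigma> in nhds \<tau>. \<bar>\<sigma>\<bar> < T" by simp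
    have "velocity A \<gamma> \<tau> = tangent_of A c (\<gamma> \<tau>) v"
    proof (rule velocity_eq[of c \<gamma> \<tau>, OF c(1) \<gamma>\<tau>(1)])
      show "\<forall>\<^sub>F \<sigma> in nhds \<tau>. \<gamma> \<sigma> \<in> cdom c"
        using ev by (rule eventually_mono) (rule \<gamma>_in(1))
      have "((\<lambda>\<sigma>. y + \<sigma> *\<^sub>R v) has_vector_derivative v) (at \<tau>)"
        by (auto intro!: derivative_eq_intros simp: has_vector_derivative_def)
      then show "((cmap c \<circ> \<gamma>) has_vector_derivative v) (at \<tau>)"
        by (rule has_vector_derivative_transform_within_open[where S = "{\<sigma>. \<bar>\<sigma>\<bar> < T}"])
          (use op \<tau> in \<open>auto simp: \<gamma>_in(2)\<close>)
    qed
    then show ?thesis by (simp add: act_def lagrangian_eq[OF c(1) \<gamma>\<tau>(1)] \<gamma>\<tau>(2))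
  qed
  have cl: "continuous_on {-T<..<T} act"
    unfolding act_def
    by (intro continuous_intros continuous_on_compose2[OF continuous_on_Lc[OF c(1) compact_cball r(2)]]) (use T(2) in auto)
  \<comment> \<open>For small \<tau> this is the upper bound that touching by f gives for the
    weighted value of u at time - \<tau>. It is exact at \<tau> = 0, so its derivative there carries
    the information.\<close>
  define \<psi> where "\<psi> \<tau> = exp (- (lam * \<tau>)) * (u x - f x + (f \<circ> cinv c) (y + (- \<tau>) *\<^sub>R v))" for \<tau>
  have \<psi>0: "\<psi> 0 = u x" using y(2) by (simp add: \<psi>_def)
  have D\<psi>: "(\<psi> has_real_derivative - (lam * u x + q \<bullet> v)) (at 0)"
  proof -
    have Df: "((f \<circ> cinv c) has_derivative (\<lambda>h. q \<bullet> h)) (at (y + (- 0) *\<^sub>R v))"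
    proof -
      have "(f \<circ> cinv c) differentiable (at y)"
        by (rule differentiableI[OF Cn_on_has_derivative[OF C_fun_Cn_on[OF f c(1)] _ y(1)]]) simp
      from has_derivative_grad[OF this] show ?thesis by (simp add: q_def)
    qed
    have "((\<lambda>\<tau>. (f \<circ> cinv c) (y + (- \<tau>) *\<^sub>R v)) has_derivative (\<lambda>\<tau>. q \<bullet> ((- \<tau>) *\<^sub>R v))) (at (0::real))"
      by (rule has_derivative_compose[of "\<lambda>\<tau>. y + (- \<tau>) *\<^sub>R v" "\<lambda>\<tau>. (- \<tau>) *\<^sub>R v" 0 UNIV "f \<circ> cinv c", OF _ Df])
        (auto intro!: derivative_eq_intros)
    then have "((\<lambda>\<tau>. (f \<circ> cinv c) (y + (- \<tau>) *\<^sub>R v)) has_real_derivative - (q \<bullet> v)) (at 0)"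
      unfolding has_field_derivative_def by (rule has_derivative_eq_rhs) (simp add: fun_eq_iff)
    then show ?thesis unfolding \<psi>_def[abs_def] using y(2)
      by (auto intro!: derivative_eq_intros)
  qed
  have "lam * u x + q \<bullet> v \<le> Lc c y v + e" if e: "e > 0" for e
  proof -
    have "isCont act 0" using cl T(1) by (simp add: continuous_on_eq_continuous_at)
    then have "(act \<longlongrightarrow> act 0) (nhds 0)" by (simp add: isCont_def tendsto_at_iff_tendsto_nhds)
    moreover have "act 0 < Lc c y v + e" using e by (simp add: act_def)
    ultimately have "\<forall>\<^sub>F \<tau> in nhds 0. act \<tau> < Lc c y v + e" by (rule order_tendstoD)
    then obtain d1 where d1: "d1 > 0" "\<And>\<tau>. \<bar>\<tau>\<bar> < d1 \<Longrightarrow> act \<tau> < Lc c y v + e"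
      by (auto simp: eventually_nhds_metric dist_real_def)
    have "continuous_on {-T<..<T} \<gamma>"
      unfolding \<gamma>_def
      by (rule continuous_on_compose2[OF continuous_on_cinv[OF c(1)]]) (use Tc in \<open>auto intro!: continuous_intros\<close>)
    then have "isCont \<gamma> 0" using T(1) by (simp add: continuous_on_eq_continuous_at)
    moreover have "\<gamma> 0 = x" using y(2) by (simp add: \<gamma>_def)
    ultimately have "(\<gamma> \<longlongrightarrow> x) (nhds 0)" by (metis isCont_def tendsto_at_iff_tendsto_nhds)
    from eventually_compose_filterlim[OF max this]
    have "\<forall>\<^sub>F \<tau> in nhds 0. u (\<gamma> \<tau>) - f (\<gamma> \<tau>) \<le> u x - f x" .
    then obtain d2 where d2: "d2 > 0" "\<And>\<tau>. \<bar>\<tau>\<bar> < d2 \<Longrightarrow> u (\<gamma> \<tau>) - f (\<gamma> \<tau>) \<le> u x - f x"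
      by (auto simp: eventually_nhds_metric dist_real_def)
    have key: "\<psi> 0 - \<psi> \<tau> \<le> \<tau> * (Lc c y v + e)" if \<tau>: "0 < \<tau>" "\<tau> < T" "\<tau> < d1" "\<tau> < d2" for \<tau>
    proof -
      have sub: "\<bar>\<sigma>\<bar> < T" "\<bar>\<sigma>\<bar> < d1" if "\<sigma> \<in> {-\<tau>..0}" for \<sigma> using that \<tau> by auto
      have "abs_continuous_curve A (-\<tau>) 0 \<gamma>"
        unfolding \<gamma>_def by (rule line_abs_continuous_curve[OF c(1)]) (use Tc sub in auto)
      moreover have cl': "continuous_on {-\<tau>..0} act" by (rule continuous_on_subset[OF cl]) (use \<tau> in auto)
      then have "(\<lambda>t. exp (lam * t) * lagrangian A H (\<gamma> t) (velocity A \<gamma> t)) absolutely_integrable_on {-\<tau>..0}"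
        by (intro absolutely_integrable_continuous_real) (rule continuous_on_eq, assumption, simp only: lag sub)
      moreover have "-\<tau> \<le> 0" using \<tau> by simp
      ultimately have "exp (lam * 0) * u (\<gamma> 0) - exp (lam * (-\<tau>)) * u (\<gamma> (-\<tau>))
          \<le> integral {-\<tau>..0} (\<lambda>t. exp (lam * t) * lagrangian A H (\<gamma> t) (velocity A \<gamma> t))"
        using dom unfolding dominated_def by blast
      also have "\<dots> = integral {-\<tau>..0} act" by (rule integral_cong) (rule lag[OF sub(1)])
      also have "\<dots> \<le> integral {-\<tau>..0} (\<lambda>_. Lc c y v + e)"
        by (intro integral_le integrable_continuous_real cl' continuous_on_const less_imp_le d1(2) sub)
      also have "\<dots> = \<tau> * (Lc c y v + e)" using \<tau> by simp
      finally have "u x - exp (- (lam * \<tau>)) * u (\<gamma> (-\<tau>)) \<le> \<tau> * (Lc c y v + e)"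
        using \<open>\<gamma> 0 = x\<close> by simp
      moreover have "exp (- (lam * \<tau>)) * u (\<gamma> (-\<tau>)) \<le> exp (- (lam * \<tau>)) * (u x - f x + f (\<gamma> (-\<tau>)))"
        using d2(2)[of "-\<tau>"] \<tau> by (intro mult_left_mono) auto
      ultimately have "u x - exp (- (lam * \<tau>)) * (u x - f x + f (\<gamma> (-\<tau>))) \<le> \<tau> * (Lc c y v + e)"
        by linarith
      then show ?thesis unfolding \<psi>0 by (simp add: \<psi>_def \<gamma>_def)
    qed
    have "((\<lambda>\<tau>. (\<psi> \<tau> - \<psi> 0) / \<tau>) \<longlongrightarrow> - (lam * u x + q \<bullet> v)) (at_right 0)"
      using D\<psi> by (simp add: has_field_derivative_iff filterlim_at_split)
    moreover have "\<forall>\<^sub>F \<tau> in at_right 0. - (Lc c y v + e) \<le> (\<psi> \<tau> - \<psi> 0) / \<tau>"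
    proof -
      have "\<forall>\<^sub>F \<tau> in at_right 0. \<tau> \<in> {0<..<min T (min d1 d2)}"
        by (rule eventually_at_right_real) (use T d1 d2 in auto)
      then show ?thesis
      proof (rule eventually_mono)
        fix \<tau> assume \<tau>: "\<tau> \<in> {0<..<min T (min d1 d2)}"
        then have "\<psi> 0 - \<psi> \<tau> \<le> \<tau> * (Lc c y v + e)" by (intro key) auto
        then show "- (Lc c y v + e) \<le> (\<psi> \<tau> - \<psi> 0) / \<tau>"
          using \<tau> by (subst pos_le_divide_eq) (auto simp: algebra_simps)
      qed
    qed
    ultimately have "- (Lc c y v + e) \<le> - (lam * u x + q \<bullet> v)" by (rule tendsto_lowerbound) simp
    then show ?thesis by simp
  qed
  then have "lam * u x + q \<bullet> v \<le> Lc c y v" by (rule field_le_epsilon)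
  then show "lam * u x + H x (differential A f x) \<le> 0" unfolding Hq using v by simp
qed

lemma S_minus_eq: "S_minus A H lam = {u. viscosity_subsolution A H lam u}"
  using viscosity_subsolution_dominated dominated_imp_viscosity_subsolution
  unfolding S_minus_def viscosity_subsolution_def by blast

section \<open>Comparison with supersolutions\<close>

lemma smooth_subsolution_le_supersolution:
  assumes w: "w \<in> C_fun A 1" "\<And>x. lam * w x + H x (differential A w x) \<le> 0"
    and um: "viscosity_supersolution A H lam um"
  shows "w x \<le> um x"
proof -
  have "continuous_on UNIV (\<lambda>x. um x - w x)"
    using um continuous_on_C_fun[OF w(1)] unfolding viscosity_supersolution_def by (intro continuous_on_diff) auto
  from continuous_attains_inf[OF compact_UNIV _ this]
  obtain z where z: "\<And>x. um z - w z \<le> um x - w x" by auto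
  have "lam * um z + H z (differential A w z) \<ge> 0"
    using um w(1) z unfolding viscosity_supersolution_def by (simp add: eventually_True)
  then have "lam * w z \<le> lam * um z" using w(2)[of z] by linarith
  then have "w z \<le> um z" using lam by simp
  then show ?thesis using z[of x] by linarith
qed

lemma subsolution_le_supersolution:
  assumes u: "viscosity_subsolution A H lam u" and um: "viscosity_supersolution A H lam um"
  shows "u x \<le> um x"
proof (rule field_le_epsilon)
  fix e :: real assume "e > 0"
  then obtain w where w: "w \<in> C_fun A \<infinity>" "\<And>x. \<bar>w x - u x\<bar> \<le> e" "\<And>x. lam * w x + H x (differential A w x) \<le> 0"
    using global_smooth_approximation[OF u] by blast
  have "w x \<le> um x" by (rule smooth_subsolution_le_supersolution[OF C_fun_infinity_imp_1[OF w(1)] w(3) um])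
  then show "u x \<le> um x + e" using w(2)[of x] by linarith
qed

end

theorem theorem1p5:
  fixes A :: "('m::t2_space, 'e::euclidean_space) chart set"
    and g :: "'m \<Rightarrow> ('m, 'e) tangent \<Rightarrow> ('m, 'e) tangent \<Rightarrow> real"
    and H :: "'m \<Rightarrow> ('m, 'e) cotangent \<Rightarrow> real"
    and k :: enat
    and lam :: real
    and um :: "'m \<Rightarrow> real"
  assumes "closed_manifold A"
    and "riemannian_metric A g"
    and "k \<ge> 2"
    and "C_cotangent_bundle A k H"
    and "tonelli A g H"
    and "lam > 0"
    and "viscosity_solution A H lam um"
  shows "S_minus A H lam = {u. viscosity_subsolution A H lam u} \<and>
    (\<forall>x. ereal (um x) = (SUP u \<in> S_minus A H lam. ereal (u x)) \<and>
         (SUP u \<in> S_minus A H lam. ereal (u x))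
           = (SUP u \<in> C_fun A \<infinity> \<inter> S_minus A H lam. ereal (u x)))"
proof -
  interpret hamiltonian A g H k lam
    by unfold_locales (fact assms)+
  have sub: "viscosity_subsolution A H lam um" and super: "viscosity_supersolution A H lam um"
    using assms(7) by (auto simp: viscosity_solution_def)
  have le: "u x \<le> um x" if "u \<in> S_minus A H lam" for u x
    using that subsolution_le_supersolution[OF _ super] by (simp add: S_minus_eq)
  \<comment> \<open>Smooth approximations of \<open>um\<close> itself are competitors in the smaller
    supremum.\<close>
  have ge: "ereal (um x) \<le> (SUP u \<in> C_fun A \<infinity> \<inter> S_minus A H lam. ereal (u x))" for x
  proof (rule ereal_le_epsilon2)
    fix e :: real assume "0 < e"
    then obtain w where w: "w \<in> C_fun A \<infinity>" "\<And>x. \<bar>w x - um x\<bar> \<le> e" "\<And>x. lam * w x + H x (differential A w x) \<le> 0"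
      using global_smooth_approximation[OF sub] by blast
    have w1: "w \<in> C_fun A 1" by (rule C_fun_infinity_imp_1[OF w(1)])
    have "w \<in> S_minus A H lam"
      using continuous_on_C_fun[OF w1] classical_subsolution_dominated[OF w1 w(3)] by (simp add: S_minus_def)
    then have "ereal (w x) \<le> (SUP u \<in> C_fun A \<infinity> \<inter> S_minus A H lam. ereal (u x))"
      using w(1) by (intro SUP_upper) auto
    moreover have "ereal (um x) \<le> ereal (w x) + ereal e" using w(2)[of x] by (simp add: abs_le_iff)
    ultimately show "ereal (um x) \<le> (SUP u \<in> C_fun A \<infinity> \<inter> S_minus A H lam. ereal (u x)) + ereal e"
      by (meson add_right_mono order_trans)
  qed
  have "(SUP u \<in> S_minus A H lam. ereal (u x)) = ereal (um x)"
    and "(SUP u \<in> C_fun A \<infinity> \<inter> S_minus A H lam. ereal (u x)) = ereal (um x)" for x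
  proof -
    have 1: "(SUP u \<in> C_fun A \<infinity> \<inter> S_minus A H lam. ereal (u x)) \<le> (SUP u \<in> S_minus A H lam. ereal (u x))"
      by (rule SUP_subset_mono) auto
    have 2: "(SUP u \<in> S_minus A H lam. ereal (u x)) \<le> ereal (um x)"
      by (rule SUP_least) (simp add: le)
    show "(SUP u \<in> S_minus A H lam. ereal (u x)) = ereal (um x)"
      using 1 2 ge[of x] by (metis order_antisym order_trans)
    show "(SUP u \<in> C_fun A \<infinity> \<inter> S_minus A H lam. ereal (u x)) = ereal (um x)"
      using 1 2 ge[of x] by (metis order_antisym order_trans)
  qed
  then show ?thesis using S_minus_eq by simp
qed

end
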